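(* Let $f:\mathbb{R}^n\to\mathbb{R}$ be $\mu$-strongly convex with $\mu>0$ and minimizer $x^*$, let $x^0\in\mathbb{R}^n$, $R_0\ge\|x^0-x^*\|_2$, $R_0>0$, and $Q=B_{3R_0}(x^* )=\{x\in\mathbb{R}^n: \|x-x^*\|_2\le 3R_0\}$. Assume that the stochastic gradient satisfies the oracle condition (unbiasedness and variance at most $\sigma^2$) on $Q$ with $\sigma>0$, and that $f$ satisfies the smoothness conditions with exponent $\nu\in[0,1]$ and constant $M_\nu>0$ on $Q$ (oracle condition and smoothness conditions are spelled out in the context). Let $\varepsilon>0$ and $\beta\in(0,1)$. Then there exists a choice of the parameters of R-clipped-SSTM such that R-clipped-SSTM started at $x^0$ achieves $f(\hat x^\tau)-f(x^* )\le\varepsilon$ with probability at least $1-\beta$ after $$\hat N=\mathcal{O}\left(D\ln^{\frac{2(1+\nu)}{1+3\nu}}\frac{D}{\beta}\right),\qquad D=\max\left\{\left(\frac{M_\nu}{\mu R_0^{1-\nu}}\right)^{\frac{2}{1+3\nu}}\ln\frac{\mu R_0^2}{\varepsilon},\ \left(\frac{M_\nu^2}{\mu^{1+\nu}\varepsilon^{1-\nu}}\right)^{\frac{1}{1+3\nu}}\right\}$$ iterations of clipped-SSTM in total, and requires $$\mathcal{O}\left(\max\left\{D\ln^{\frac{2(1+\nu)}{1+3\nu}}\frac{D}{\beta},\ \frac{\sigma^2}{\mu\varepsilon}\ln\frac{D}{\beta}\right\}\right)\ \text{oracle calls}.$$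
   Context: Problem: minimize $f(x)=\mathbb{E}_\xi[f(x,\xi)]$ over $\mathbb{R}^n$; $x^*$ is the solution. $f$ is $\mu$-strongly convex if $f(y)\ge f(x)+\langle\nabla f(x),y-x\rangle+\frac\mu2\|y-x\|_2^2$ for all $x,y$. Oracle condition on $Q$: at each $x\in\mathbb{R}^n$ one can sample a stochastic gradient $\nabla f(x,\xi)$ with $\mathbb{E}_\xi\|\nabla f(x,\xi)-\nabla f(x)\|_2^2<\infty$, and for $x\in Q$: $\mathbb{E}_\xi[\nabla f(x,\xi)]=\nabla f(x)$ and $\mathbb{E}_\xi\|\nabla f(x,\xi)-\nabla f(x)\|_2^2\le\sigma^2$. No other tail assumption is made. Smoothness conditions on $Q$ with $(\nu,M_\nu)$: (i) $\|\nabla f(x)-\nabla f(y)\|_2\le M_\nu\|x-y\|_2^\nu$ for all $x,y\in Q$; (ii) $\|\nabla f(x)\|_2\le\left(\frac{1+\nu}{\nu}\right)^{\frac{\nu}{1+\nu}}M_\nu^{\frac{1}{1+\nu}}(f(x)-f(x^* ))^{\frac{\nu}{1+\nu}}$ for all $x\in Q$ (for $\nu=0$ the factor $(\frac{1+\nu}{\nu})^{\frac{\nu}{1+\nu}}$ is its limit $1$, so the bound reads $\|\nabla f(x)\|_2\le M_0$); (iii) $\|\nabla f(x)\|_2^2\le 2(1/\delta)^{\frac{1-\nu}{1+\nu}}M_\nu^{\frac{2}{1+\nu}}(f(x)-f(x^* ))+\delta^{\frac{2\nu}{1+\nu}}M_\nu^{\frac{2}{1+\nu}}$ for all $x\in Q$,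 $\delta>0$. For $\nu=0$, $f$ need not be differentiable and $\nabla f(x)$ denotes a subgradient (with $\nabla f(x^* )=0$). Clipping: $\mathrm{clip}(g,\lambda)=\min\{1,\lambda/\|g\|_2\}\,g$ (and $\mathrm{clip}(0,\lambda)=0$). Algorithm clipped-SSTM with starting point $x^0$, number of iterations $N$, batch sizes $m_0,\dots,m_{N-1}\in\mathbb{Z}_{\ge1}$, stepsize parameter $\alpha>0$, clipping parameter $B>0$: set $A_0=\alpha_0=0$, $y^0=z^0=x^0$. For $k=0,\dots,N-1$: $\alpha_{k+1}=\alpha(k+1)^{\frac{2\nu}{1+\nu}}$, $A_{k+1}=A_k+\alpha_{k+1}$, $\lambda_{k+1}=B/\alpha_{k+1}$; $x^{k+1}=(A_ky^k+\alpha_{k+1}z^k)/A_{k+1}$; draw fresh i.i.d. samples $\xi_1^k,\dots,\xi_{m_k}^k$, let $\nabla f(x^{k+1},\boldsymbol\xi^k)=\frac1{m_k}\sum_{i=1}^{m_k}\nabla f(x^{k+1},\xi_i^k)$ and $\widetilde\nabla f(x^{k+1},\boldsymbol\xi^k)=\mathrm{clip}(\nabla f(x^{k+1},\boldsymbol\xi^k),\lambda_{k+1})$; $z^{k+1}=z^k-\alpha_{k+1}\widetilde\nabla f(x^{k+1},\boldsymbol\xi^k)$; $y^{k+1}=(A_ky^k+\alpha_{k+1}z^{k+1})/A_{k+1}$. Output: $y^N$. Algorithm R-clipped-SSTM with starting point $x^0$, number of restarts $\tau$, iteration numbers $N_1,\dots,N_\tau$, batch sizes $m_k^t$ ($0\le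 k\le N_t-1$, $1\le t\le\tau$), stepsize parameters $\alpha^t$ and clipping parameters $B_t$: set $\hat x^0=x^0$; for $t=1,\dots,\tau$ run clipped-SSTM for $N_t$ iterations from starting point $\hat x^{t-1}$ with batch sizes $m_k^t$, stepsize parameter $\alpha^t$, clipping parameter $B_t$, using fresh samples, and let $\hat x^t$ be its output. Output: $\hat x^\tau$. The number of oracle calls is the total number of computed stochastic gradients $\nabla f(x,\xi)$. All parameters may depend on $\nu,M_\nu,R_0,\sigma,\mu,\varepsilon,\beta$. $\mathcal{O}(\cdot)$ hides numerical constant factors (for fixed $\nu$), independent of $f,n,M_\nu,R_0,\sigma,\mu,\varepsilon,\beta$.
   Formalization: The factor ln(D/β) is read as max{1, ln(D/β)}, since the bare bound fails when D and β are near 1 and is undefined for D<β; the hidden constant is stated for each fixed type of sample values and underlying probability space. *)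

theory Defs
  imports "HOL-Probability.Probability"
begin

text \<open>
  The hidden constants of the complexity bounds must not depend on the dimension \<open>n\<close>, so \<open>n\<close> is
  quantified inside the statement. Therefore \<open>\<real>\<^sup>n\<close> is rendered with an explicit carrier: the
  extensional functions on \<open>{..<n}\<close>, which is the space of the library's product
  \<open>\<sigma>\<close>-algebra \<open>Pi\<^sub>M {..<n} (\<lambda>_. borel)\<close>.
\<close>

type_synonym rvec = "nat \<Rightarrow> real"

definition Rn :: "nat \<Rightarrow> rvec set" where
  "Rn n = ({..<n} \<rightarrow>\<^sub>E UNIV)"

abbreviation borel_Rn :: "nat \<Rightarrow> rvec measure" where
  "borel_Rn n \<equiv> Pi\<^sub>M {..<n} (\<lambda>_. borel)"

abbreviation norm_Rn :: "nat \<Rightarrow> rvec \<Rightarrow> real" where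
  "norm_Rn n v \<equiv> L2_set v {..<n}"

abbreviation dist_Rn :: "nat \<Rightarrow> rvec \<Rightarrow> rvec \<Rightarrow> real" where
  "dist_Rn n x y \<equiv> norm_Rn n (\<lambda>i. x i - y i)"

definition inner_Rn :: "nat \<Rightarrow> rvec \<Rightarrow> rvec \<Rightarrow> real" where
  "inner_Rn n u v = (\<Sum>i<n. u i * v i)"

definition cball_Rn :: "nat \<Rightarrow> rvec \<Rightarrow> real \<Rightarrow> rvec set" where
  "cball_Rn n c r = {x \<in> Rn n. dist_Rn n x c \<le> r}"

definition minimizer :: "nat \<Rightarrow> (rvec \<Rightarrow> real) \<Rightarrow> rvec \<Rightarrow> bool" where
  "minimizer n f xs \<longleftrightarrow> xs \<in> Rn n \<and> (\<forall>x\<in>Rn n. f xs \<le> f x)"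

definition has_gradient :: "nat \<Rightarrow> (rvec \<Rightarrow> real) \<Rightarrow> rvec \<Rightarrow> rvec \<Rightarrow> bool" where
  "has_gradient n f v x \<longleftrightarrow>
     (\<forall>e>0. \<exists>d>0. \<forall>y\<in>Rn n. dist_Rn n y x < d \<longrightarrow>
        \<bar>f y - f x - inner_Rn n v (\<lambda>i. y i - x i)\<bar> \<le> e * dist_Rn n y x)"

definition is_subgradient :: "nat \<Rightarrow> (rvec \<Rightarrow> real) \<Rightarrow> rvec \<Rightarrow> rvec \<Rightarrow> bool" where
  "is_subgradient n f v x \<longleftrightarrow> (\<forall>y\<in>Rn n. f y \<ge> f x + inner_Rn n v (\<lambda>i. y i - x i))"

text \<open>
  The map \<open>G\<close> plays the role of \<open>\<nabla>f\<close>: the gradient for \<open>\<nu> > 0\<close>, and for \<open>\<nu> = 0\<close> a fixed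
  selection of subgradients that vanishes at the minimizer \<open>xs\<close>.
\<close>

definition gradient_map ::
  "nat \<Rightarrow> real \<Rightarrow> (rvec \<Rightarrow> real) \<Rightarrow> rvec \<Rightarrow> (rvec \<Rightarrow> rvec) \<Rightarrow> bool" where
  "gradient_map n \<nu> f xs G \<longleftrightarrow>
     (\<forall>x\<in>Rn n. G x \<in> Rn n) \<and>
     (if \<nu> = 0
      then (\<forall>x\<in>Rn n. is_subgradient n f (G x) x) \<and> (\<forall>i<n. G xs i = 0)
      else (\<forall>x\<in>Rn n. has_gradient n f (G x) x))"

definition strongly_convex ::
  "nat \<Rightarrow> real \<Rightarrow> (rvec \<Rightarrow> real) \<Rightarrow> (rvec \<Rightarrow> rvec) \<Rightarrow> bool" where
  "strongly_convex n \<mu> f G \<longleftrightarrow>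
     (\<forall>x\<in>Rn n. \<forall>y\<in>Rn n.
        f y \<ge> f x + inner_Rn n (G x) (\<lambda>i. y i - x i) + \<mu> / 2 * (dist_Rn n y x)\<^sup>2)"

definition stochastic_objective ::
  "nat \<Rightarrow> 'x measure \<Rightarrow> (rvec \<Rightarrow> 'x \<Rightarrow> real) \<Rightarrow> (rvec \<Rightarrow> real) \<Rightarrow> bool" where
  "stochastic_objective n P F f \<longleftrightarrow>
     (\<forall>x\<in>Rn n. integrable P (F x) \<and> f x = (\<integral>\<xi>. F x \<xi> \<partial>P))"

text \<open>
  \<open>P\<close> is the law of \<open>\<xi>\<close> and \<open>g x \<xi>\<close> the stochastic gradient. Joint measurability is what makes
  \<open>g\<close> evaluated at a random iterate a random vector. On \<open>Q\<close> the coordinates of \<open>g x\<close> are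
  integrable since their second moments are finite.
\<close>

definition stochastic_oracle ::
  "nat \<Rightarrow> 'x measure \<Rightarrow> (rvec \<Rightarrow> 'x \<Rightarrow> rvec) \<Rightarrow> (rvec \<Rightarrow> rvec) \<Rightarrow> rvec set \<Rightarrow> real \<Rightarrow> bool" where
  "stochastic_oracle n P g G Q \<sigma> \<longleftrightarrow>
     (\<lambda>(x, \<xi>). g x \<xi>) \<in> (borel_Rn n \<Otimes>\<^sub>M P) \<rightarrow>\<^sub>M borel_Rn n \<and>
     (\<forall>x\<in>Rn n. integrable P (\<lambda>\<xi>. (dist_Rn n (g x \<xi>) (G x))\<^sup>2)) \<and>
     (\<forall>x\<in>Q. (\<forall>i<n. (\<integral>\<xi>. g x \<xi> i \<partial>P) = G x i) \<and>
             (\<integral>\<xi>. (dist_Rn n (g x \<xi>) (G x))\<^sup>2 \<partial>P) \<le> \<sigma>\<^sup>2)"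

text \<open>
  The case \<open>\<nu> = 0\<close> of the second condition is separate because there
  \<open>((1 + \<nu>) / \<nu>) powr (\<nu> / (1 + \<nu>))\<close> would be \<open>0 powr 0 = 0\<close> instead of its limit \<open>1\<close>.
  In the first condition \<open>0 powr 0 = 0\<close> occurs only for \<open>x = y\<close>, where it is harmless.
\<close>

definition smoothness_conditions ::
  "nat \<Rightarrow> real \<Rightarrow> real \<Rightarrow> (rvec \<Rightarrow> real) \<Rightarrow> (rvec \<Rightarrow> rvec) \<Rightarrow> rvec \<Rightarrow> rvec set \<Rightarrow> bool" where
  "smoothness_conditions n \<nu> M f G xs Q \<longleftrightarrow>
     (\<forall>x\<in>Q. \<forall>y\<in>Q. dist_Rn n (G x) (G y) \<le> M * dist_Rn n x y powr \<nu>) \<and>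
     (\<forall>x\<in>Q. norm_Rn n (G x) \<le>
        (if \<nu> = 0 then M
         else ((1 + \<nu>) / \<nu>) powr (\<nu> / (1 + \<nu>)) * M powr (1 / (1 + \<nu>))
                * (f x - f xs) powr (\<nu> / (1 + \<nu>)))) \<and>
     (\<forall>x\<in>Q. \<forall>\<delta>>0. (norm_Rn n (G x))\<^sup>2 \<le>
        2 * (1 / \<delta>) powr ((1 - \<nu>) / (1 + \<nu>)) * M powr (2 / (1 + \<nu>)) * (f x - f xs)
        + \<delta> powr (2 * \<nu> / (1 + \<nu>)) * M powr (2 / (1 + \<nu>)))"

text \<open>Since \<open>lam / 0 = 0\<close>, this gives \<open>clip 0 = 0\<close>.\<close>

definition clip :: "nat \<Rightarrow> rvec \<Rightarrow> real \<Rightarrow> rvec" where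
  "clip n v lam = (\<lambda>i\<in>{..<n}. min 1 (lam / norm_Rn n v) * v i)"

definition batch_gradient ::
  "nat \<Rightarrow> (rvec \<Rightarrow> 'x \<Rightarrow> rvec) \<Rightarrow> rvec \<Rightarrow> nat \<Rightarrow> (nat \<Rightarrow> 'x) \<Rightarrow> rvec" where
  "batch_gradient n g x m \<xi> = (\<lambda>i\<in>{..<n}. (\<Sum>j=1..m. g x (\<xi> j) i) / real m)"

fun sstm_\<alpha> :: "real \<Rightarrow> real \<Rightarrow> nat \<Rightarrow> real" where
  "sstm_\<alpha> \<nu> a 0 = 0"
| "sstm_\<alpha> \<nu> a (Suc k) = a * real (k + 1) powr (2 * \<nu> / (1 + \<nu>))"

fun sstm_A :: "real \<Rightarrow> real \<Rightarrow> nat \<Rightarrow> real" where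
  "sstm_A \<nu> a 0 = 0"
| "sstm_A \<nu> a (Suc k) = sstm_A \<nu> a k + sstm_\<alpha> \<nu> a (Suc k)"

text \<open>
  The state after \<open>k\<close> iterations is the pair \<open>(y\<^sup>k, z\<^sup>k)\<close>; \<open>\<xi> k j\<close> is the \<open>j\<close>-th sample of
  iteration \<open>k\<close>, with \<open>1 \<le> j \<le> m k\<close>.
\<close>

fun sstm_state ::
  "nat \<Rightarrow> real \<Rightarrow> (rvec \<Rightarrow> 'x \<Rightarrow> rvec) \<Rightarrow> rvec \<Rightarrow> (nat \<Rightarrow> nat) \<Rightarrow> real \<Rightarrow> real \<Rightarrow>
   (nat \<Rightarrow> nat \<Rightarrow> 'x) \<Rightarrow> nat \<Rightarrow> rvec \<times> rvec" where
  "sstm_state n \<nu> g x0 m a B \<xi> 0 = (x0, x0)"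
| "sstm_state n \<nu> g x0 m a B \<xi> (Suc k) =
     (let (y, z) = sstm_state n \<nu> g x0 m a B \<xi> k;
          A = sstm_A \<nu> a k;
          \<alpha>' = sstm_\<alpha> \<nu> a (Suc k);
          A' = sstm_A \<nu> a (Suc k);
          x' = (\<lambda>i\<in>{..<n}. (A * y i + \<alpha>' * z i) / A');
          g' = clip n (batch_gradient n g x' (m k) (\<xi> k)) (B / \<alpha>');
          z' = (\<lambda>i\<in>{..<n}. z i - \<alpha>' * g' i);
          y' = (\<lambda>i\<in>{..<n}. (A * y i + \<alpha>' * z' i) / A')
      in (y', z'))"

definition clipped_SSTM ::
  "nat \<Rightarrow> real \<Rightarrow> (rvec \<Rightarrow> 'x \<Rightarrow> rvec) \<Rightarrow> rvec \<Rightarrow> nat \<Rightarrow> (nat \<Rightarrow> nat) \<Rightarrow> real \<Rightarrow> real \<Rightarrow>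
   (nat \<Rightarrow> nat \<Rightarrow> 'x) \<Rightarrow> rvec" where
  "clipped_SSTM n \<nu> g x0 N m a B \<xi> = fst (sstm_state n \<nu> g x0 m a B \<xi> N)"

text \<open>
  Below, \<open>Ns t\<close>, \<open>ms t k\<close>, \<open>as t\<close>, \<open>Bs t\<close> are the parameters of restart \<open>t \<ge> 1\<close>, and \<open>\<xi> t k j\<close> are
  its samples.
\<close>

fun R_clipped_SSTM ::
  "nat \<Rightarrow> real \<Rightarrow> (rvec \<Rightarrow> 'x \<Rightarrow> rvec) \<Rightarrow> rvec \<Rightarrow> (nat \<Rightarrow> nat) \<Rightarrow> (nat \<Rightarrow> nat \<Rightarrow> nat) \<Rightarrow>
   (nat \<Rightarrow> real) \<Rightarrow> (nat \<Rightarrow> real) \<Rightarrow> (nat \<Rightarrow> nat \<Rightarrow> nat \<Rightarrow> 'x) \<Rightarrow> nat \<Rightarrow> rvec" where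
  "R_clipped_SSTM n \<nu> g x0 Ns ms as Bs \<xi> 0 = x0"
| "R_clipped_SSTM n \<nu> g x0 Ns ms as Bs \<xi> (Suc t) =
     clipped_SSTM n \<nu> g (R_clipped_SSTM n \<nu> g x0 Ns ms as Bs \<xi> t)
       (Ns (Suc t)) (ms (Suc t)) (as (Suc t)) (Bs (Suc t)) (\<xi> (Suc t))"

definition admissible_parameters ::
  "nat \<Rightarrow> (nat \<Rightarrow> nat) \<Rightarrow> (nat \<Rightarrow> nat \<Rightarrow> nat) \<Rightarrow> (nat \<Rightarrow> real) \<Rightarrow> (nat \<Rightarrow> real) \<Rightarrow> bool" where
  "admissible_parameters \<tau> Ns ms as Bs \<longleftrightarrow>
     (\<forall>t\<in>{1..\<tau>}. Ns t \<ge> 1 \<and> (\<forall>k<Ns t. ms t k \<ge> 1) \<and> as t > 0 \<and> Bs t > 0)"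

definition total_iterations :: "nat \<Rightarrow> (nat \<Rightarrow> nat) \<Rightarrow> nat" where
  "total_iterations \<tau> Ns = (\<Sum>t=1..\<tau>. Ns t)"

definition oracle_calls :: "nat \<Rightarrow> (nat \<Rightarrow> nat) \<Rightarrow> (nat \<Rightarrow> nat \<Rightarrow> nat) \<Rightarrow> nat" where
  "oracle_calls \<tau> Ns ms = (\<Sum>t=1..\<tau>. \<Sum>k<Ns t. ms t k)"

text \<open>The samples that a run actually draws are independent with law \<open>P\<close>.\<close>

definition fresh_samples ::
  "'w measure \<Rightarrow> 'x measure \<Rightarrow> nat \<Rightarrow> (nat \<Rightarrow> nat) \<Rightarrow> (nat \<Rightarrow> nat \<Rightarrow> nat) \<Rightarrow>
   (nat \<Rightarrow> nat \<Rightarrow> nat \<Rightarrow> 'w \<Rightarrow> 'x) \<Rightarrow> bool" where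
  "fresh_samples W P \<tau> Ns ms X \<longleftrightarrow>
     (let I = {(t, k, j). t \<in> {1..\<tau>} \<and> k < Ns t \<and> j \<in> {1..ms t k}}
      in prob_space.indep_vars W (\<lambda>_. P) (\<lambda>(t, k, j). X t k j) I \<and>
         (\<forall>(t, k, j)\<in>I. distr W P (X t k j) = P))"

definition complexity_D :: "real \<Rightarrow> real \<Rightarrow> real \<Rightarrow> real \<Rightarrow> real \<Rightarrow> real" where
  "complexity_D \<nu> M R0 \<mu> \<epsilon> =
     max ((M / (\<mu> * R0 powr (1 - \<nu>))) powr (2 / (1 + 3 * \<nu>)) * ln (\<mu> * R0\<^sup>2 / \<epsilon>))
         ((M\<^sup>2 / (\<mu> powr (1 + \<nu>) * \<epsilon> powr (1 - \<nu>))) powr (1 / (1 + 3 * \<nu>)))"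

text \<open>
  The logarithmic factor \<open>ln (D / \<beta>)\<close> of the complexity bounds. As usual inside \<open>\<O>\<close>, it is read as
  at least \<open>1\<close>: \<open>D / \<beta>\<close> may be arbitrarily close to (or below) \<open>1\<close>, for instance for \<open>\<nu> = 1\<close>,
  \<open>M = \<mu>\<close> and \<open>\<beta>\<close> near \<open>1\<close>, and then no positive number of iterations would satisfy a bound with
  the bare logarithm. For \<open>D / \<beta> \<ge> exp 1\<close> it is exactly \<open>ln (D / \<beta>)\<close>.
\<close>

definition log_factor :: "real \<Rightarrow> real \<Rightarrow> real" where
  "log_factor D \<beta> = max 1 (ln (D / \<beta>))"

end

theory Submission
  imports Defs
begin

text \<open>The proof has two layers: an exponential supermartingale for a single run, and a restart scheme that
  uses strong convexity.

  One run. Let \<open>\<Phi>\<^sub>k = A\<^sub>k (f y\<^sup>k - f x\<^sup>*) + |z\<^sup>k - x\<^sup>*|\<^sup>2 / 2\<close>. With \<open>\<theta>\<close> the error of the clipped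
  mini-batch gradient, convexity and Hoelder continuity give
  \<open>\<Phi>\<^sub>k\<^sub>+\<^sub>1 \<le> \<Phi>\<^sub>k + \<alpha> \<langle>\<theta>, x\<^sup>* - z\<^sup>k\<rangle> + \<alpha>\<^sup>2 |\<theta>|\<^sup>2 + R\<^sup>2 / (2 N)\<close> (\<open>descent_step\<close>, \<open>lyapunov_step\<close>).
  While \<open>\<Phi>\<^sub>k \<le> 2 R\<^sup>2\<close>, the iterates stay in the ball of radius \<open>3 R\<close> and the gradient at the query point
  is at most half the clipping level (\<open>query_gradient_bound\<close>). Clipping is then the projection onto
  a ball that contains the true gradient, so it does not increase the variance, its bias is of
  second order in the noise, and the random increment of \<open>2 l / R\<^sup>2 \<cdot> \<Phi>\<close> is at most \<open>1\<close>. Hence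
  \<open>exp y \<le> 1 + y + y\<^sup>2\<close> bounds the conditional exponential moment
  (\<open>clipped_batch_exp_moment\<close>), and the exponential of \<open>2 l / R\<^sup>2 \<cdot> (\<Phi>\<^sub>k - 2 R\<^sup>2)\<close>, corrected by a deterministic
  drift and cut off at \<open>1\<close>, is a supermartingale (\<open>failure_bound_supermartingale\<close>). It starts below
  \<open>exp (- l)\<close> and ends at \<open>1\<close> if the run misses its target. The cut-off replaces a stopping time: once
  \<open>\<Phi>\<^sub>k\<close> exceeds \<open>2 R\<^sup>2\<close> nothing has to be shown any more. No union bound over the iterations occurs, so
  the number of iterations does not enter the logarithm.

  Restarts. If the previous runs succeed, run \<open>t\<close> starts within distance \<open>R\<^sub>t\<close> of \<open>x\<^sup>*\<close>. Its target accuracy is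
  \<open>e\<^sub>t = max \<epsilon> (\<mu> R\<^sub>t\<^sup>2 / 4)\<close>. By strong convexity success halves the squared distance. The number of
  restarts is at most \<open>2 D\<close>, so \<open>l = 2 max 1 (ln (D / \<beta>))\<close> makes the failure probabilities add up to at most
  \<open>\<beta>\<close> (\<open>failure_budget\<close>). The iteration numbers form a geometric sum for \<open>\<nu> < 1\<close>, dominated by the
  last run, which is the second term of \<open>D\<close>; for \<open>\<nu> = 1\<close> they are all of the same order, which gives
  the first term of \<open>D\<close> (\<open>geometric_sum\<close>). The batch sizes beyond \<open>1\<close> are proportional to \<open>l \<sigma>\<^sup>2 / (\<mu> e\<^sub>t)\<close> in total and
  always form a geometric sum. If \<open>M < \<mu> R\<^sub>0\<^sup>1\<^sup>-\<^sup>\<nu>\<close>, no problem satisfies the hypotheses, and if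
  \<open>M R\<^sub>0\<^sup>1\<^sup>+\<^sup>\<nu> \<le> \<epsilon>\<close>, the starting point is a solution; in both cases no run is made at all
  (\<open>start_is_solution\<close>). Otherwise \<open>D \<ge> 1\<close>, and rounding iteration numbers up is harmless.\<close>

section \<open>Geometry of the Euclidean space\<close>

lemma norm_Rn_sq: "(norm_Rn n u)\<^sup>2 = inner_Rn n u u"
  by (simp add: L2_set_def inner_Rn_def sum_nonneg power2_eq_square)

lemma norm_Rn_sq_sum: "(norm_Rn n u)\<^sup>2 = (\<Sum>i<n. (u i)\<^sup>2)"
  by (simp add: L2_set_def sum_nonneg)

lemma abs_inner_Rn_le: "\<bar>inner_Rn n u v\<bar> \<le> norm_Rn n u * norm_Rn n v"
  unfolding inner_Rn_def
  by (rule order_trans[OF sum_abs]) (simp add: abs_mult L2_set_mult_ineq)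

lemma inner_Rn_le: "inner_Rn n u v \<le> norm_Rn n u * norm_Rn n v"
  using abs_inner_Rn_le[of n u v] by linarith

lemma inner_Rn_commute: "inner_Rn n u v = inner_Rn n v u"
  by (simp add: inner_Rn_def mult.commute)

lemma inner_Rn_diff_left: "inner_Rn n (\<lambda>i. u i - v i) w = inner_Rn n u w - inner_Rn n v w"
  by (simp add: inner_Rn_def algebra_simps sum_subtractf)

lemma inner_Rn_add_left: "inner_Rn n (\<lambda>i. u i + v i) w = inner_Rn n u w + inner_Rn n v w"
  by (simp add: inner_Rn_def algebra_simps sum.distrib)

lemma inner_Rn_scale_left: "inner_Rn n (\<lambda>i. c * u i) w = c * inner_Rn n u w"
  by (simp add: inner_Rn_def algebra_simps sum_distrib_left)

lemmas inner_Rn_linear_left = inner_Rn_diff_left inner_Rn_add_left inner_Rn_scale_left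

lemma inner_Rn_linear_right:
  "inner_Rn n w (\<lambda>i. u i - v i) = inner_Rn n w u - inner_Rn n w v"
  "inner_Rn n w (\<lambda>i. u i + v i) = inner_Rn n w u + inner_Rn n w v"
  "inner_Rn n w (\<lambda>i. c * u i) = c * inner_Rn n w u"
  using inner_Rn_linear_left by (metis inner_Rn_commute)+

lemma inner_Rn_cong:
  "(\<And>i. i < n \<Longrightarrow> u i = u' i) \<Longrightarrow> (\<And>i. i < n \<Longrightarrow> v i = v' i) \<Longrightarrow> inner_Rn n u v = inner_Rn n u' v'"
  by (simp add: inner_Rn_def)

lemma norm_Rn_cong: "(\<And>i. i < n \<Longrightarrow> u i = v i) \<Longrightarrow> norm_Rn n u = norm_Rn n v"
  by (rule L2_set_cong) auto

lemma norm_Rn_scale: "norm_Rn n (\<lambda>i. c * u i) = \<bar>c\<bar> * norm_Rn n u"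
proof -
  have "norm_Rn n (\<lambda>i. c * u i) = sqrt (c\<^sup>2 * (\<Sum>i<n. (u i)\<^sup>2))"
    by (simp add: L2_set_def power_mult_distrib sum_distrib_left)
  then show ?thesis by (simp add: L2_set_def real_sqrt_mult)
qed

lemma norm_Rn_diff_commute: "norm_Rn n (\<lambda>i. u i - v i) = norm_Rn n (\<lambda>i. v i - u i)"
  using norm_Rn_scale[where c="-1" and u="\<lambda>i. v i - u i"] by simp

lemma dist_Rn_triangle: "dist_Rn n x z \<le> dist_Rn n x y + dist_Rn n y z"
  using L2_set_triangle_ineq[of "\<lambda>i. x i - y i" "\<lambda>i. y i - z i" "{..<n}"] by simp

lemma dist_Rn_sq:
  "(dist_Rn n u v)\<^sup>2 = (norm_Rn n u)\<^sup>2 - 2 * inner_Rn n u v + (norm_Rn n v)\<^sup>2"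
  by (simp add: norm_Rn_sq inner_Rn_linear_left inner_Rn_linear_right inner_Rn_commute[of n v u])

lemma norm_Rn_le_dist_add: "norm_Rn n u \<le> dist_Rn n u v + norm_Rn n v"
  using L2_set_triangle_ineq[of "\<lambda>i. u i - v i" "\<lambda>i. v i" "{..<n}"] by simp

lemma norm_Rn_diff_le: "dist_Rn n u v \<le> norm_Rn n u + norm_Rn n v"
  using L2_set_triangle_ineq[of "\<lambda>i. u i" "\<lambda>i. - v i" "{..<n}"] norm_Rn_scale[where c="-1" and u=v] by simp

lemma dist_Rn_convex_combination:
  assumes "a \<ge> 0" "b \<ge> 0" "a + b > 0"
    and w: "\<And>i. i < n \<Longrightarrow> w i = (a * y i + b * z i) / (a + b)"
    and "dist_Rn n y c \<le> r" "dist_Rn n z c \<le> r"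
  shows "dist_Rn n w c \<le> r"
proof -
  have "dist_Rn n w c = norm_Rn n (\<lambda>i. a / (a + b) * (y i - c i) + b / (a + b) * (z i - c i))"
    using assms(3) by (intro norm_Rn_cong) (simp add: w divide_simps, simp add: algebra_simps)
  also have "\<dots> \<le> a / (a + b) * dist_Rn n y c + b / (a + b) * dist_Rn n z c"
    using L2_set_triangle_ineq[of "\<lambda>i. a / (a + b) * (y i - c i)"
        "\<lambda>i. b / (a + b) * (z i - c i)" "{..<n}"] assms(1-3)
    unfolding norm_Rn_scale by simp
  also have "\<dots> \<le> a / (a + b) * r + b / (a + b) * r"
    using assms by (intro add_mono mult_left_mono) auto
  also have "\<dots> = r"
    using assms(3) by (simp flip: distrib_right add_divide_distrib)
  finally show ?thesis .
qed

section \<open>Clipping\<close>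

lemma clip_scale:
  assumes "i < n" shows "clip n u lam i = min 1 (lam / norm_Rn n u) * u i"
  using assms by (simp add: clip_def)

lemma norm_clip_le:
  assumes "lam > 0" shows "norm_Rn n (clip n u lam) \<le> lam"
proof -
  have "norm_Rn n (clip n u lam) = norm_Rn n (\<lambda>i. min 1 (lam / norm_Rn n u) * u i)"
    by (intro norm_Rn_cong clip_scale)
  also have "\<dots> = min 1 (lam / norm_Rn n u) * norm_Rn n u"
    using assms by (simp add: norm_Rn_scale)
  also have "\<dots> \<le> lam"
  proof (cases "norm_Rn n u = 0")
    case False
    then have "norm_Rn n u > 0" using L2_set_nonneg[of u "{..<n}"] by linarith
    then show ?thesis by (simp add: min_def field_simps)
  qed (use assms in simp)
  finally show ?thesis .
qed

text \<open>Clipping is the metric projection onto the ball of radius \<open>lam\<close>, so it does not increase the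
  distance to a point of that ball.\<close>

lemma dist_clip_le:
  assumes "lam > 0" and v: "norm_Rn n v \<le> lam"
  shows "dist_Rn n (clip n u lam) v \<le> dist_Rn n u v"
proof (cases "norm_Rn n u \<le> lam")
  case True
  have "lam / norm_Rn n u \<ge> 1 \<or> norm_Rn n u = 0"
    using True by (cases "norm_Rn n u = 0") (auto simp: field_simps less_le)
  moreover have "u i = 0" if "norm_Rn n u = 0" "i < n" for i
    using that by (simp add: L2_set_eq_0_iff)
  ultimately have "clip n u lam i = u i" if "i < n" for i
    using that by (auto simp: clip_scale)
  then show ?thesis by (simp cong: norm_Rn_cong)
next
  case False
  define s where "s = lam / norm_Rn n u"
  have u: "norm_Rn n u > 0" using False assms(1) by linarith
  have s: "0 < s" "s < 1" using False assms(1) u by (auto simp: s_def field_simps)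
  have sn: "s * norm_Rn n u = lam" using u by (simp add: s_def)
  have "dist_Rn n (clip n u lam) v = dist_Rn n (\<lambda>i. s * u i) v"
    using s by (intro norm_Rn_cong) (simp add: clip_scale flip: s_def)
  moreover have "(dist_Rn n (\<lambda>i. s * u i) v)\<^sup>2 \<le> (dist_Rn n u v)\<^sup>2"
  proof -
    have "inner_Rn n u v \<le> norm_Rn n u * lam"
      using inner_Rn_le[of n u v] v u by (meson mult_left_mono order_trans L2_set_nonneg)
    also have "\<dots> = s * (norm_Rn n u)\<^sup>2" using sn by (simp add: power2_eq_square)
    finally have "(1 - s) * (2 * inner_Rn n u v) \<le> (1 - s) * ((1 + s) * (norm_Rn n u)\<^sup>2)"
    proof (intro mult_left_mono)
      assume "inner_Rn n u v \<le> s * (norm_Rn n u)\<^sup>2"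
      moreover have "2 * s * (norm_Rn n u)\<^sup>2 \<le> (1 + s) * (norm_Rn n u)\<^sup>2"
        using s by (intro mult_right_mono) auto
      ultimately show "2 * inner_Rn n u v \<le> (1 + s) * (norm_Rn n u)\<^sup>2" by linarith
    qed (use s in auto)
    then show ?thesis
      unfolding dist_Rn_sq norm_Rn_scale inner_Rn_scale_left power_mult_distrib
      using s by (simp add: algebra_simps power2_eq_square)
  qed
  ultimately show ?thesis using power2_le_imp_le by (metis L2_set_nonneg)
qed

text \<open>The bias of clipping is of second order in the noise: only vectors longer than \<open>lam\<close> are
  moved, and these are farther than \<open>lam / 2\<close> from \<open>v\<close>.\<close>

lemma dist_clip_self_le:
  assumes "lam > 0" and v: "norm_Rn n v \<le> lam / 2"
  shows "dist_Rn n (clip n u lam) u \<le> (dist_Rn n u v)\<^sup>2 / (2 * lam)"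
proof (cases "norm_Rn n u \<le> lam")
  case True
  have "lam / norm_Rn n u \<ge> 1 \<or> norm_Rn n u = 0"
    using True by (cases "norm_Rn n u = 0") (auto simp: field_simps less_le)
  moreover have "u i = 0" if "norm_Rn n u = 0" "i < n" for i
    using that by (simp add: L2_set_eq_0_iff)
  ultimately have "clip n u lam i = u i" if "i < n" for i
    using that by (auto simp: clip_scale)
  then have "dist_Rn n (clip n u lam) u = norm_Rn n (\<lambda>i. 0 * 0)"
    by (intro norm_Rn_cong) simp
  then show ?thesis using assms(1) by (simp only: norm_Rn_scale) simp
next
  case False
  have u: "norm_Rn n u > 0" using False assms(1) by linarith
  have "dist_Rn n (clip n u lam) u = norm_Rn n (\<lambda>i. (lam / norm_Rn n u - 1) * u i)"
    using False u by (intro norm_Rn_cong) (simp add: clip_scale min_def field_simps)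
  also have "\<dots> = (1 - lam / norm_Rn n u) * norm_Rn n u"
    using False u unfolding norm_Rn_scale by simp
  also have "\<dots> = norm_Rn n u - lam" using u by (simp add: field_simps)
  also have "\<dots> \<le> dist_Rn n u v - lam / 2" using norm_Rn_le_dist_add[of u n v] v by linarith
  also have "\<dots> \<le> (dist_Rn n u v)\<^sup>2 / (2 * lam)"
    using assms(1) zero_le_power2[of "dist_Rn n u v - lam"]
    by (simp add: field_simps power2_eq_square)
  finally show ?thesis .
qed

section \<open>One iteration\<close>

text \<open>The update for an arbitrary gradient estimate \<open>v\<close>. The analytic estimates concern this
  deterministic map; randomness enters only through \<open>v\<close>.\<close>

definition sstm_step ::
  "nat \<Rightarrow> rvec \<Rightarrow> rvec \<Rightarrow> real \<Rightarrow> real \<Rightarrow> rvec \<Rightarrow> rvec \<times> rvec" where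
  "sstm_step n y z A al v =
     (let z' = (\<lambda>i\<in>{..<n}. z i - al * v i)
      in ((\<lambda>i\<in>{..<n}. (A * y i + al * z' i) / (A + al)), z'))"

definition sstm_query :: "nat \<Rightarrow> rvec \<Rightarrow> rvec \<Rightarrow> real \<Rightarrow> real \<Rightarrow> rvec" where
  "sstm_query n y z A al = (\<lambda>i\<in>{..<n}. (A * y i + al * z i) / (A + al))"

text \<open>Since \<open>(A + al) x' = A y + al z\<close>, the convexity inequalities at \<open>x'\<close> with weights \<open>A\<close> and \<open>al\<close> add up to
  an inner product of the gradient with \<open>xs - z\<close> only, which is what the step of \<open>z\<close> controls. The
  terms quadratic in \<open>v\<close> leave \<open>al\<^sup>2 (\<langle>\<theta>, v\<rangle> - |v|\<^sup>2 / 4)\<close> once the remainder \<open>H\<close> has used up its quarter of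
  \<open>al\<^sup>2 |v|\<^sup>2\<close>, and this is at most \<open>al\<^sup>2 |\<theta>|\<^sup>2\<close>.\<close>

lemma descent_step:
  fixes f :: "rvec \<Rightarrow> real"
  assumes A: "A \<ge> 0" and al: "al > 0"
    and x': "x' = sstm_query n y z A al"
    and step: "(y', z') = sstm_step n y z A al v"
    and conv_y: "f y \<ge> f x' + inner_Rn n g (\<lambda>i. y i - x' i)"
    and conv_xs: "f xs \<ge> f x' + inner_Rn n g (\<lambda>i. xs i - x' i)"
    and smooth: "f y' \<le> f x' + inner_Rn n g (\<lambda>i. y' i - x' i) + H"
    and H: "(A + al) * H \<le> al\<^sup>2 / 4 * (norm_Rn n v)\<^sup>2 + \<delta>"
  defines "\<theta> \<equiv> (\<lambda>i. v i - g i)"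
  shows "(A + al) * (f y' - f xs) + (dist_Rn n z' xs)\<^sup>2 / 2 \<le>
    A * (f y - f xs) + (dist_Rn n z xs)\<^sup>2 / 2
      + al * inner_Rn n \<theta> (\<lambda>i. xs i - z i) + al\<^sup>2 * (norm_Rn n \<theta>)\<^sup>2 + \<delta>"
proof -
  have x'i: "(A + al) * x' i = A * y i + al * z i" if "i < n" for i
    using that A al by (simp add: x' sstm_query_def)
  have z'i: "z' i = z i - al * v i" if "i < n" for i
    using that step by (simp add: sstm_step_def)
  have y'i: "(A + al) * y' i = A * y i + al * z' i" if "i < n" for i
    using that step A al by (simp add: sstm_step_def Let_def)
  let ?I = "inner_Rn n"
  have "A * ?I g (\<lambda>i. y i - x' i) + al * ?I g (\<lambda>i. xs i - x' i)
      = ?I g (\<lambda>i. A * (y i - x' i) + al * (xs i - x' i))"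
    by (simp add: inner_Rn_linear_right)
  also have "\<dots> = ?I g (\<lambda>i. al * (xs i - z i))"
  proof (rule inner_Rn_cong[OF refl])
    fix i assume "i < n"
    with x'i[of i] show "A * (y i - x' i) + al * (xs i - x' i) = al * (xs i - z i)"
      by (simp add: algebra_simps)
  qed
  also have "\<dots> = al * ?I g (\<lambda>i. xs i - z i)" by (simp add: inner_Rn_linear_right)
  finally have comb: "A * ?I g (\<lambda>i. y i - x' i) + al * ?I g (\<lambda>i. xs i - x' i)
      = al * ?I g (\<lambda>i. xs i - z i)" .
  have 1: "(A + al) * f x' \<le> A * f y + al * f xs - al * ?I g (\<lambda>i. xs i - z i)"
    using mult_left_mono[OF conv_y A] mult_left_mono[OF conv_xs less_imp_le[OF al]] comb
    by (simp add: algebra_simps)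
  have "(A + al) * ?I g (\<lambda>i. y' i - x' i) = ?I g (\<lambda>i. (A + al) * (y' i - x' i))"
    by (simp only: inner_Rn_linear_right)
  also have "\<dots> = ?I g (\<lambda>i. (- (al\<^sup>2)) * v i)"
  proof (rule inner_Rn_cong[OF refl])
    fix i assume i: "i < n"
    have "(A + al) * (y' i - x' i) = al * (z' i - z i)"
      unfolding right_diff_distrib y'i[OF i] x'i[OF i] by simp
    then show "(A + al) * (y' i - x' i) = - (al\<^sup>2) * v i"
      by (simp add: z'i[OF i] power2_eq_square)
  qed
  also have "\<dots> = - (al\<^sup>2) * ?I g v" by (simp only: inner_Rn_linear_right)
  finally have 2: "(A + al) * ?I g (\<lambda>i. y' i - x' i) = - (al\<^sup>2) * ?I g v" .
  have 3: "(A + al) * f y' \<le> (A + al) * f x' - al\<^sup>2 * ?I g v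
      + al\<^sup>2 / 4 * (norm_Rn n v)\<^sup>2 + \<delta>"
    using mult_left_mono[OF smooth, of "A + al"] 2 H A al by (simp add: distrib_left)
  have "(dist_Rn n z' xs)\<^sup>2 = (dist_Rn n (\<lambda>i. z i - xs i) (\<lambda>i. al * v i))\<^sup>2"
    by (intro arg_cong[where f="\<lambda>x. x\<^sup>2"] norm_Rn_cong) (simp add: z'i)
  then have 4: "(dist_Rn n z' xs)\<^sup>2 = (dist_Rn n z xs)\<^sup>2 + 2 * al * ?I v (\<lambda>i. xs i - z i)
      + al\<^sup>2 * (norm_Rn n v)\<^sup>2"
    unfolding dist_Rn_sq[where u="\<lambda>i. z i - xs i"] norm_Rn_scale power_mult_distrib
    by (simp add: inner_Rn_linear_right inner_Rn_linear_left algebra_simps inner_Rn_commute)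
  have 5: "?I \<theta> (\<lambda>i. xs i - z i) = ?I v (\<lambda>i. xs i - z i) - ?I g (\<lambda>i. xs i - z i)"
    by (simp add: \<theta>_def inner_Rn_linear_left)
  have 6: "?I g v = (norm_Rn n v)\<^sup>2 - ?I \<theta> v"
    by (simp add: \<theta>_def inner_Rn_linear_left norm_Rn_sq)
  have "?I \<theta> v \<le> norm_Rn n \<theta> * norm_Rn n v" by (rule inner_Rn_le)
  also have "\<dots> \<le> (norm_Rn n \<theta>)\<^sup>2 + (norm_Rn n v)\<^sup>2 / 4"
    using zero_le_power2[of "norm_Rn n \<theta> - norm_Rn n v / 2"]
    by (simp add: power2_eq_square algebra_simps)
  finally have "al\<^sup>2 * ?I \<theta> v \<le> al\<^sup>2 * ((norm_Rn n \<theta>)\<^sup>2 + (norm_Rn n v)\<^sup>2 / 4)"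
    by (intro mult_left_mono) auto
  moreover have "al * ?I \<theta> (\<lambda>i. xs i - z i)
      = al * ?I v (\<lambda>i. xs i - z i) - al * ?I g (\<lambda>i. xs i - z i)"
    unfolding 5 by (simp add: right_diff_distrib)
  moreover have "al\<^sup>2 * ?I g v = al\<^sup>2 * (norm_Rn n v)\<^sup>2 - al\<^sup>2 * ?I \<theta> v"
    unfolding 6 by (simp add: right_diff_distrib)
  ultimately show ?thesis
    using 1 3 unfolding 4 by (simp add: algebra_simps add_divide_distrib)
qed

section \<open>Measurability of the objective\<close>

lemma space_borel_Rn: "space (borel_Rn n) = Rn n"
  by (simp add: space_PiM Rn_def)

lemma measurable_borel_Rn_component [measurable]:
  "i < n \<Longrightarrow> (\<lambda>y. y i) \<in> borel_measurable (borel_Rn n)"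
  by simp

lemma measurable_norm_Rn:
  assumes "\<And>i. i < n \<Longrightarrow> (\<lambda>w. h w i) \<in> borel_measurable M"
  shows "(\<lambda>w. norm_Rn n (h w)) \<in> borel_measurable M"
  unfolding L2_set_def using assms by measurable

lemma measurable_inner_Rn:
  assumes "\<And>i. i < n \<Longrightarrow> (\<lambda>w. h w i) \<in> borel_measurable M"
    and "\<And>i. i < n \<Longrightarrow> (\<lambda>w. h' w i) \<in> borel_measurable M"
  shows "(\<lambda>w. inner_Rn n (h w) (h' w)) \<in> borel_measurable M"
  unfolding inner_Rn_def using assms by measurable

lemma rational_point_nearby:
  assumes "y \<in> Rn n" "e > 0"
  obtains q where "q \<in> {..<n} \<rightarrow>\<^sub>E \<rat>" "dist_Rn n y q < e"
proof -
  have "\<exists>r\<in>\<rat>. \<bar>y i - r\<bar> < e / (real n + 1)" for i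
  proof -
    have "y i - e / (real n + 1) < y i + e / (real n + 1)" using assms(2) by (simp add: add_pos_nonneg)
    from Rats_dense_in_real[OF this] show ?thesis by (metis abs_diff_less_iff abs_minus_commute)
  qed
  then obtain r where r: "\<And>i. r i \<in> \<rat>" "\<And>i. \<bar>y i - r i\<bar> < e / (real n + 1)" by metis
  define q where "q = restrict r {..<n}"
  have "dist_Rn n y q \<le> (\<Sum>i<n. \<bar>y i - q i\<bar>)" by (rule L2_set_le_sum_abs)
  also have "\<dots> \<le> (\<Sum>i<n. e / (real n + 1))"
    using r(2) by (intro sum_mono) (simp add: q_def less_imp_le)
  also have "\<dots> < e" using assms(2) by (simp add: field_simps)
  finally show ?thesis using that[of q] r(1) by (auto simp: q_def)
qed

text \<open>A function with a subgradient everywhere is lower semicontinuous, and an open set is a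
  union of balls with rational centres and radii.\<close>

lemma borel_measurable_if_subgradients:
  assumes sub: "\<And>x. x \<in> Rn n \<Longrightarrow> is_subgradient n f (G x) x"
  shows "f \<in> borel_measurable (borel_Rn n)"
  unfolding borel_measurable_iff_greater
proof
  fix a :: real
  define S where "S = {w \<in> Rn n. a < f w}"
  define ball where "ball q k = {y \<in> Rn n. dist_Rn n y q < 1 / (real k + 1)}" for q k
  have "ball q k \<in> sets (borel_Rn n)" for q k
  proof -
    have "(\<lambda>y. dist_Rn n y q) \<in> borel_measurable (borel_Rn n)"
      by (rule measurable_norm_Rn) simp
    then have "{y \<in> space (borel_Rn n). dist_Rn n y q < 1 / (real k + 1)} \<in> sets (borel_Rn n)"
      by measurable
    then show ?thesis by (simp add: ball_def space_borel_Rn)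
  qed
  moreover have "countable ({..<n} \<rightarrow>\<^sub>E (\<rat>::real set))"
    by (intro countable_PiE) (auto simp: countable_rat)
  ultimately have "(\<Union>q\<in>{..<n} \<rightarrow>\<^sub>E \<rat>. \<Union>k\<in>{k. ball q k \<subseteq> S}. ball q k) \<in> sets (borel_Rn n)"
    by (intro sets.countable_UN') auto
  moreover have "S = (\<Union>q\<in>{..<n} \<rightarrow>\<^sub>E \<rat>. \<Union>k\<in>{k. ball q k \<subseteq> S}. ball q k)"
  proof
    show "S \<subseteq> (\<Union>q\<in>{..<n} \<rightarrow>\<^sub>E \<rat>. \<Union>k\<in>{k. ball q k \<subseteq> S}. ball q k)"
    proof
      fix y assume "y \<in> S"
      then have y: "y \<in> Rn n" "a < f y" by (auto simp: S_def)
      define K where "K = norm_Rn n (G y) + 1"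
      have K: "K > 0" using L2_set_nonneg[of "G y" "{..<n}"] by (simp only: K_def add_nonneg_pos zero_less_one)
      define e where "e = (f y - a) / K"
      have e: "e > 0" using K y by (simp add: e_def)
      have near: "w \<in> S" if "w \<in> Rn n" "dist_Rn n w y < e" for w
      proof -
        have "- inner_Rn n (G y) (\<lambda>i. w i - y i) \<le> norm_Rn n (G y) * dist_Rn n w y"
          using abs_inner_Rn_le[of n "G y" "\<lambda>i. w i - y i"] by linarith
        also have "\<dots> \<le> K * dist_Rn n w y"
          by (intro mult_right_mono) (auto simp: K_def)
        also have "\<dots> < K * e" using that(2) K by simp
        finally have "- inner_Rn n (G y) (\<lambda>i. w i - y i) < f y - a" using K by (simp add: e_def)
        moreover have "f w \<ge> f y + inner_Rn n (G y) (\<lambda>i. w i - y i)"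
          using sub[OF y(1)] that(1) by (simp add: is_subgradient_def)
        ultimately show ?thesis using that(1) by (simp add: S_def)
      qed
      obtain k where k: "1 / (real k + 1) < e / 2"
        using e reals_Archimedean[of "e / 2"] by (auto simp: inverse_eq_divide add.commute)
      obtain q where q: "q \<in> {..<n} \<rightarrow>\<^sub>E \<rat>" "dist_Rn n y q < 1 / (real k + 1)"
        using rational_point_nearby[OF y(1), of "1 / (real k + 1)"] by auto
      have "ball q k \<subseteq> S"
      proof
        fix w assume "w \<in> ball q k"
        then have w: "w \<in> Rn n" "dist_Rn n w q < 1 / (real k + 1)" by (auto simp: ball_def)
        have "dist_Rn n w y \<le> dist_Rn n w q + dist_Rn n y q"
          using dist_Rn_triangle[of w y n q] norm_Rn_diff_commute[of q y n] by linarith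
        then show "w \<in> S" using near w q(2) k by simp
      qed
      then show "y \<in> (\<Union>q\<in>{..<n} \<rightarrow>\<^sub>E \<rat>. \<Union>k\<in>{k. ball q k \<subseteq> S}. ball q k)"
        using q y(1) by (auto simp: ball_def)
    qed
  qed auto
  ultimately have "S \<in> sets (borel_Rn n)" by simp
  then show "{w \<in> space (borel_Rn n). a < f w} \<in> sets (borel_Rn n)"
    by (simp add: S_def space_borel_Rn)
qed

section \<open>Mini-batches\<close>

lemma exp_le_1_plus_quadratic:
  fixes x :: real assumes "x \<le> 1" shows "exp x \<le> 1 + x + x\<^sup>2"
proof (cases "x \<ge> 0")
  case True then show ?thesis using assms exp_bound by simp
next
  case False
  define t where "t = - x"
  have t: "t \<ge> 0" using False by (simp add: t_def)
  have pos: "1 - t + t\<^sup>2 \<ge> 0" using zero_le_power2[of "1 - t"] t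
    by (simp add: power2_eq_square algebra_simps)
  have "(1 - t + t\<^sup>2) * (1 + t + t\<^sup>2 / 2) = 1 + (t\<^sup>2 + t * t\<^sup>2 + t\<^sup>2 * t\<^sup>2) / 2"
    by (simp add: power2_eq_square field_simps)
  then have "1 \<le> (1 - t + t\<^sup>2) * (1 + t + t\<^sup>2 / 2)" using t by simp
  also have "\<dots> \<le> (1 - t + t\<^sup>2) * exp t"
    using pos t exp_lower_Taylor_quadratic by (intro mult_left_mono) auto
  finally show ?thesis by (simp add: t_def exp_minus field_simps)
qed

lemma integrable_PiM_component:
  assumes "prob_space P" "j \<in> K" "integrable P \<psi>"
  shows "integrable (PiM K (\<lambda>_. P)) (\<lambda>\<eta>. \<psi> (\<eta> j) :: real)"
    and "(\<integral>\<eta>. \<psi> (\<eta> j) \<partial>PiM K (\<lambda>_. P)) = (\<integral>x. \<psi> x \<partial>P)"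
proof -
  have d: "distr (PiM K (\<lambda>_. P)) P (\<lambda>\<eta>. \<eta> j) = P"
    using distr_PiM_component[of K "\<lambda>_. P" j] assms by simp
  have [measurable]: "\<psi> \<in> borel_measurable P" using assms(3) by simp
  show "integrable (PiM K (\<lambda>_. P)) (\<lambda>\<eta>. \<psi> (\<eta> j))"
    using assms integrable_distr_eq[of "\<lambda>\<eta>. \<eta> j" "PiM K (\<lambda>_. P)" P \<psi>] by (simp add: d)
  show "(\<integral>\<eta>. \<psi> (\<eta> j) \<partial>PiM K (\<lambda>_. P)) = (\<integral>x. \<psi> x \<partial>P)"
    using assms by (subst (2) d[symmetric], subst integral_distr) auto
qed

text \<open>The mixed terms of the square vanish because the samples are independent and centred.\<close>

lemma second_moment_sum_iid:
  fixes \<psi> :: "'x \<Rightarrow> real"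
  assumes P: "prob_space P" and K: "finite K"
    and meas: "\<psi> \<in> borel_measurable P" and sq: "integrable P (\<lambda>x. (\<psi> x)\<^sup>2)" and mean: "(\<integral>x. \<psi> x \<partial>P) = 0"
  shows "integrable (PiM K (\<lambda>_. P)) (\<lambda>\<eta>. (\<Sum>j\<in>K. \<psi> (\<eta> j))\<^sup>2)"
    and "(\<integral>\<eta>. (\<Sum>j\<in>K. \<psi> (\<eta> j))\<^sup>2 \<partial>PiM K (\<lambda>_. P)) = card K * (\<integral>x. (\<psi> x)\<^sup>2 \<partial>P)"
proof -
  interpret P: prob_space P by fact
  interpret prod: product_sigma_finite "\<lambda>_. P" ..
  have int: "integrable P \<psi>" using P.square_integrable_imp_integrable[OF meas sq] .
  have eq: "(\<Sum>j\<in>K. \<psi> (\<eta> j))\<^sup>2 = (\<Sum>i\<in>K. \<Sum>j\<in>K. \<psi> (\<eta> i) * \<psi> (\<eta> j))" for \<eta>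
    by (simp add: power2_eq_square sum_product)
  have cross: "integrable (PiM K (\<lambda>_. P)) (\<lambda>\<eta>. \<psi> (\<eta> i) * \<psi> (\<eta> j)) \<and>
      (\<integral>\<eta>. \<psi> (\<eta> i) * \<psi> (\<eta> j) \<partial>PiM K (\<lambda>_. P)) = (if i = j then \<integral>x. (\<psi> x)\<^sup>2 \<partial>P else 0)"
    if ij: "i \<in> K" "j \<in> K" for i j
  proof (cases "i = j")
    case True
    then show ?thesis using integrable_PiM_component[OF P ij(1) sq] by (simp add: power2_eq_square)
  next
    case False
    define h where "h l = (if l = i \<or> l = j then \<psi> else (\<lambda>_. 1))" for l
    have hint: "integrable P (h l)" for l by (simp add: h_def int)
    have prod_eq: "(\<Prod>l\<in>K. h l (\<eta> l)) = \<psi> (\<eta> i) * \<psi> (\<eta> j)" for \<eta>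
    proof -
      have "(\<Prod>l\<in>K. h l (\<eta> l)) = (\<Prod>l\<in>{i, j}. h l (\<eta> l))"
        using ij K by (intro prod.mono_neutral_right) (auto simp: h_def)
      then show ?thesis using False by (simp add: h_def)
    qed
    have "(\<integral>\<eta>. (\<Prod>l\<in>K. h l (\<eta> l)) \<partial>PiM K (\<lambda>_. P)) = (\<Prod>l\<in>K. integral\<^sup>L P (h l))"
      using K hint by (intro prod.product_integral_prod) auto
    also have "\<dots> = 0" using ij(1) K mean by (auto simp: h_def intro!: bexI[of _ i])
    finally show ?thesis
      using prod.product_integrable_prod[OF K, of h] hint False unfolding prod_eq by simp
  qed
  show "integrable (PiM K (\<lambda>_. P)) (\<lambda>\<eta>. (\<Sum>j\<in>K. \<psi> (\<eta> j))\<^sup>2)"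
    unfolding eq using cross by (intro Bochner_Integration.integrable_sum) simp
  have "(\<integral>\<eta>. (\<Sum>j\<in>K. \<psi> (\<eta> j))\<^sup>2 \<partial>PiM K (\<lambda>_. P))
      = (\<Sum>i\<in>K. \<Sum>j\<in>K. if i = j then \<integral>x. (\<psi> x)\<^sup>2 \<partial>P else 0)"
  proof -
    have "(\<integral>\<eta>. (\<Sum>j\<in>K. \<psi> (\<eta> j))\<^sup>2 \<partial>PiM K (\<lambda>_. P))
        = (\<Sum>i\<in>K. \<integral>\<eta>. (\<Sum>j\<in>K. \<psi> (\<eta> i) * \<psi> (\<eta> j)) \<partial>PiM K (\<lambda>_. P))"
      unfolding eq using cross
      by (intro Bochner_Integration.integral_sum Bochner_Integration.integrable_sum) simp
    also have "\<dots> = (\<Sum>i\<in>K. \<Sum>j\<in>K. \<integral>\<eta>. \<psi> (\<eta> i) * \<psi> (\<eta> j) \<partial>PiM K (\<lambda>_. P))"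
      using cross by (intro sum.cong refl Bochner_Integration.integral_sum) simp
    also have "\<dots> = (\<Sum>i\<in>K. \<Sum>j\<in>K. if i = j then \<integral>x. (\<psi> x)\<^sup>2 \<partial>P else 0)"
      using cross by (intro sum.cong refl) simp
    finally show ?thesis .
  qed
  then show "(\<integral>\<eta>. (\<Sum>j\<in>K. \<psi> (\<eta> j))\<^sup>2 \<partial>PiM K (\<lambda>_. P)) = card K * (\<integral>x. (\<psi> x)\<^sup>2 \<partial>P)"
    using K by simp
qed

text \<open>The noise assumption at one point, where \<open>h\<close> is the stochastic gradient and \<open>v\<close> the true one.\<close>

definition pointwise_oracle ::
  "nat \<Rightarrow> 'x measure \<Rightarrow> ('x \<Rightarrow> rvec) \<Rightarrow> rvec \<Rightarrow> real \<Rightarrow> bool" where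
  "pointwise_oracle n P h v \<sigma> \<longleftrightarrow>
     (\<forall>i<n. (\<lambda>\<xi>. h \<xi> i) \<in> borel_measurable P \<and> (\<integral>\<xi>. h \<xi> i \<partial>P) = v i) \<and>
     integrable P (\<lambda>\<xi>. (dist_Rn n (h \<xi>) v)\<^sup>2) \<and> (\<integral>\<xi>. (dist_Rn n (h \<xi>) v)\<^sup>2 \<partial>P) \<le> \<sigma>\<^sup>2"

lemma batch_gradient_moments:
  fixes g :: "rvec \<Rightarrow> 'x \<Rightarrow> rvec"
  assumes P: "prob_space P" and m: "m \<ge> 1" and orc: "pointwise_oracle n P (g x) v \<sigma>"
  defines "u \<equiv> batch_gradient n g x m" and "PP \<equiv> PiM {1..m} (\<lambda>_. P)"
  shows "integrable PP (\<lambda>\<eta>. (dist_Rn n (u \<eta>) v)\<^sup>2)"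
    and "(\<integral>\<eta>. (dist_Rn n (u \<eta>) v)\<^sup>2 \<partial>PP) \<le> \<sigma>\<^sup>2 / real m"
    and "integrable PP (\<lambda>\<eta>. inner_Rn n (\<lambda>i. u \<eta> i - v i) e)"
    and "(\<integral>\<eta>. inner_Rn n (\<lambda>i. u \<eta> i - v i) e \<partial>PP) = 0"
proof -
  interpret P: prob_space P by fact
  interpret PP: prob_space PP unfolding PP_def by (intro prob_space_PiM P)
  define \<psi> where "\<psi> i \<xi> = g x \<xi> i - v i" for i \<xi>
  have meas [measurable]: "\<psi> i \<in> borel_measurable P" if "i < n" for i
  proof -
    have [measurable]: "(\<lambda>\<xi>. g x \<xi> i) \<in> borel_measurable P"
      using orc that by (simp add: pointwise_oracle_def)
    have "(\<lambda>\<xi>. g x \<xi> i - v i) \<in> borel_measurable P" by measurable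
    then show ?thesis by (simp add: \<psi>_def[abs_def])
  qed
  have sq_sum: "(dist_Rn n (g x \<xi>) v)\<^sup>2 = (\<Sum>i<n. (\<psi> i \<xi>)\<^sup>2)" for \<xi>
    by (simp add: norm_Rn_sq_sum \<psi>_def)
  have sq: "integrable P (\<lambda>\<xi>. (\<psi> i \<xi>)\<^sup>2)" if "i < n" for i
  proof (rule Bochner_Integration.integrable_bound[where f="\<lambda>\<xi>. (dist_Rn n (g x \<xi>) v)\<^sup>2"])
    show "AE \<xi> in P. norm ((\<psi> i \<xi>)\<^sup>2) \<le> norm ((dist_Rn n (g x \<xi>) v)\<^sup>2)"
      unfolding sq_sum using that by (intro AE_I2) (auto simp: sum_nonneg intro!: member_le_sum)
  qed (use orc that in \<open>auto simp: pointwise_oracle_def\<close>)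
  have int: "integrable P (\<psi> i)" if "i < n" for i
    using P.square_integrable_imp_integrable[OF meas sq] that by simp
  have mean: "(\<integral>\<xi>. \<psi> i \<xi> \<partial>P) = 0" if "i < n" for i
  proof -
    have "integrable P (\<lambda>\<xi>. \<psi> i \<xi> + v i)" using int[OF that] by simp
    then have "integrable P (\<lambda>\<xi>. g x \<xi> i)" by (simp add: \<psi>_def)
    then show ?thesis using orc that P.prob_space by (simp add: \<psi>_def pointwise_oracle_def)
  qed
  have u: "u \<eta> i - v i = (\<Sum>j\<in>{1..m}. \<psi> i (\<eta> j)) / real m" if "i < n" for i \<eta>
  proof -
    have "(\<Sum>j\<in>{1..m}. \<psi> i (\<eta> j)) = (\<Sum>j=1..m. g x (\<eta> j) i) - real m * v i"
      by (simp add: \<psi>_def sum_subtractf)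
    then show ?thesis using that m by (simp add: u_def batch_gradient_def field_simps)
  qed
  have dist_u: "(dist_Rn n (u \<eta>) v)\<^sup>2 = (\<Sum>i<n. (\<Sum>j\<in>{1..m}. \<psi> i (\<eta> j))\<^sup>2 / (real m)\<^sup>2)" for \<eta>
    by (simp add: norm_Rn_sq_sum u power_divide)
  note moment = second_moment_sum_iid[OF P, of "{1..m}" "\<psi> _", OF _ meas sq mean, folded PP_def, simplified]
  show "integrable PP (\<lambda>\<eta>. (dist_Rn n (u \<eta>) v)\<^sup>2)"
    unfolding dist_u using moment(1) by auto
  have "(\<integral>\<eta>. (dist_Rn n (u \<eta>) v)\<^sup>2 \<partial>PP)
      = (\<Sum>i<n. (\<integral>\<eta>. (\<Sum>j\<in>{1..m}. \<psi> i (\<eta> j))\<^sup>2 / (real m)\<^sup>2 \<partial>PP))"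
    unfolding dist_u using moment(1) by (intro Bochner_Integration.integral_sum) auto
  also have "\<dots> = (\<Sum>i<n. (\<integral>\<xi>. (\<psi> i \<xi>)\<^sup>2 \<partial>P)) / real m"
    unfolding sum_divide_distrib
    using moment(2) m by (intro sum.cong) (auto simp: power2_eq_square)
  also have "(\<Sum>i<n. (\<integral>\<xi>. (\<psi> i \<xi>)\<^sup>2 \<partial>P)) = (\<integral>\<xi>. (dist_Rn n (g x \<xi>) v)\<^sup>2 \<partial>P)"
    unfolding sq_sum using sq by (intro Bochner_Integration.integral_sum[symmetric]) auto
  also have "\<dots> / real m \<le> \<sigma>\<^sup>2 / real m"
    using orc by (intro divide_right_mono) (auto simp: pointwise_oracle_def)
  finally show "(\<integral>\<eta>. (dist_Rn n (u \<eta>) v)\<^sup>2 \<partial>PP) \<le> \<sigma>\<^sup>2 / real m" .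
  have inner_u: "inner_Rn n (\<lambda>i. u \<eta> i - v i) e
      = (\<Sum>i<n. (\<Sum>j\<in>{1..m}. \<psi> i (\<eta> j)) / real m * e i)" for \<eta>
    by (simp add: inner_Rn_def u)
  note comp = integrable_PiM_component[OF P _ int, of _ "{1..m}", folded PP_def]
  have sint: "integrable PP (\<lambda>\<eta>. (\<Sum>j\<in>{1..m}. \<psi> i (\<eta> j)))" if "i < n" for i
    using that comp(1) by (intro Bochner_Integration.integrable_sum) auto
  have smean: "(\<integral>\<eta>. (\<Sum>j\<in>{1..m}. \<psi> i (\<eta> j)) \<partial>PP) = 0" if "i < n" for i
    using that comp mean by (subst Bochner_Integration.integral_sum) auto
  show "integrable PP (\<lambda>\<eta>. inner_Rn n (\<lambda>i. u \<eta> i - v i) e)"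
    unfolding inner_u using sint by auto
  have "(\<integral>\<eta>. inner_Rn n (\<lambda>i. u \<eta> i - v i) e \<partial>PP)
      = (\<Sum>i<n. (\<integral>\<eta>. (\<Sum>j\<in>{1..m}. \<psi> i (\<eta> j)) / real m * e i \<partial>PP))"
    unfolding inner_u using sint by (intro Bochner_Integration.integral_sum) auto
  also have "\<dots> = 0" using smean by (intro sum.neutral) auto
  finally show "(\<integral>\<eta>. inner_Rn n (\<lambda>i. u \<eta> i - v i) e \<partial>PP) = 0" .
qed

text \<open>The factor \<open>D / (2 B) + 1 + \<gamma> (D + 3 B / 2)\<^sup>2\<close> collects three contributions, each bounded by a
  multiple of the variance \<open>\<sigma>\<^sup>2 / m\<close> of the mini-batch: the bias of clipping paired with \<open>e\<close>, the term
  \<open>|\<theta>|\<^sup>2\<close>, and the square of the exponent from \<open>exp y \<le> 1 + y + y\<^sup>2\<close>. The latter applies because \<open>\<theta>\<close> is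
  bounded by \<open>3 / 2\<close> of the clipping level. The unclipped part of the inner product is centred and drops out.\<close>

lemma clipped_batch_exp_moment:
  fixes g :: "rvec \<Rightarrow> 'x \<Rightarrow> rvec"
  assumes P: "prob_space P" and m: "m \<ge> 1" and orc: "pointwise_oracle n P (g x) v \<sigma>"
    and al: "al > 0" and B: "B > 0" and v: "al * norm_Rn n v \<le> B / 2"
    and e: "norm_Rn n e \<le> D" and \<gamma>: "\<gamma> \<ge> 0"
    and small: "\<gamma> * (3 * B / 2 * (D + 3 * B / 2)) \<le> 1"
  defines "\<theta> \<equiv> (\<lambda>\<eta> i. clip n (batch_gradient n g x m \<eta>) (B / al) i - v i)"
  shows "(\<integral>\<^sup>+\<eta>. ennreal (exp (\<gamma> * (al * inner_Rn n (\<theta> \<eta>) e + al\<^sup>2 * (norm_Rn n (\<theta> \<eta>))\<^sup>2)))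
            \<partial>PiM {1..m} (\<lambda>_. P))
    \<le> ennreal (exp (\<gamma> * al\<^sup>2 * (\<sigma>\<^sup>2 / real m) * (D / (2 * B) + 1 + \<gamma> * (D + 3 * B / 2)\<^sup>2)))"
proof -
  define lam where "lam = B / al"
  have lam: "lam > 0" using al B by (simp add: lam_def)
  have v2: "norm_Rn n v \<le> lam / 2" using v al by (simp add: lam_def field_simps)
  have D: "D \<ge> 0" using e L2_set_nonneg[of e "{..<n}"] by linarith
  define PP where "PP = PiM {1..m} (\<lambda>_. P)"
  interpret PP: prob_space PP unfolding PP_def by (intro prob_space_PiM P)
  define u where "u = batch_gradient n g x m"
  define d where "d \<eta> = dist_Rn n (u \<eta>) v" for \<eta>
  note mom = batch_gradient_moments[where g=g and x=x, OF P m orc, folded PP_def u_def, folded d_def]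
  define c where "c = D / (2 * B) + 1 + \<gamma> * (D + 3 * B / 2)\<^sup>2"
  have c: "c \<ge> 0" using D B \<gamma> by (simp add: c_def)
  define U where "U \<eta> = 1 + \<gamma> * al * inner_Rn n (\<lambda>i. u \<eta> i - v i) e + \<gamma> * al\<^sup>2 * c * (d \<eta>)\<^sup>2" for \<eta>
  have bound: "exp (\<gamma> * (al * inner_Rn n (\<theta> \<eta>) e + al\<^sup>2 * (norm_Rn n (\<theta> \<eta>))\<^sup>2)) \<le> U \<eta>" for \<eta>
  proof -
    \<comment> \<open>\<open>u\<close> is the mini-batch gradient, \<open>w\<close> its clipped version, \<open>d\<close> the distance of \<open>u\<close> to the true gradient.\<close>
    define w where "w = clip n (u \<eta>) lam"
    define t where "t = norm_Rn n (\<theta> \<eta>)"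
    have \<theta>: "\<theta> \<eta> = (\<lambda>i. w i - v i)" by (simp add: \<theta>_def w_def u_def lam_def)
    have t0: "t \<ge> 0" by (simp add: t_def)
    have td: "t \<le> d \<eta>" unfolding t_def \<theta> d_def w_def
      using v2 lam by (intro dist_clip_le) auto
    have "t \<le> norm_Rn n w + norm_Rn n v" unfolding t_def \<theta> by (rule norm_Rn_diff_le)
    also have "\<dots> \<le> 3 / 2 * lam" using v2 norm_clip_le[OF lam, of n "u \<eta>"] by (simp add: w_def)
    finally have tB: "al * t \<le> 3 * B / 2" using al by (simp add: lam_def field_simps)
    define s where "s = al * inner_Rn n (\<theta> \<eta>) e + al\<^sup>2 * t\<^sup>2"
    have "\<bar>inner_Rn n (\<theta> \<eta>) e\<bar> \<le> t * D"
      using abs_inner_Rn_le[of n "\<theta> \<eta>" e] mult_left_mono[OF e t0]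
      unfolding t_def by linarith
    then have "\<bar>al * inner_Rn n (\<theta> \<eta>) e\<bar> \<le> al * (t * D)"
      using al by (simp add: abs_mult)
    moreover have "al\<^sup>2 * t\<^sup>2 \<ge> 0" by simp
    ultimately have "\<bar>s\<bar> \<le> al * (t * D) + al\<^sup>2 * t\<^sup>2" unfolding s_def by linarith
    also have "\<dots> = (al * t) * (D + al * t)" by (simp add: power2_eq_square algebra_simps)
    finally have s1: "\<bar>s\<bar> \<le> (al * t) * (D + al * t)" .
    also have "\<dots> \<le> (al * t) * (D + 3 * B / 2)"
      using tB t0 al by (intro mult_left_mono) auto
    finally have s2: "\<bar>s\<bar> \<le> (al * t) * (D + 3 * B / 2)" .
    also have "\<dots> \<le> 3 * B / 2 * (D + 3 * B / 2)"
      using tB D B by (intro mult_right_mono) auto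
    finally have "\<gamma> * s \<le> 1" using small \<gamma> by (meson abs_le_D1 mult_left_mono order_trans)
    then have "exp (\<gamma> * s) \<le> 1 + \<gamma> * s + (\<gamma> * s)\<^sup>2" by (rule exp_le_1_plus_quadratic)
    moreover have "(\<gamma> * s)\<^sup>2 \<le> \<gamma> * al\<^sup>2 * (\<gamma> * (D + 3 * B / 2)\<^sup>2) * (d \<eta>)\<^sup>2"
    proof -
      have "s\<^sup>2 \<le> ((al * d \<eta>) * (D + 3 * B / 2))\<^sup>2"
      proof (rule power2_le_iff_abs_le[THEN iffD2])
        show "\<bar>s\<bar> \<le> al * d \<eta> * (D + 3 * B / 2)"
          using s2 td al D B by (meson mult_left_mono mult_right_mono order_trans less_imp_le
              add_nonneg_nonneg divide_nonneg_pos zero_less_numeral mult_nonneg_nonneg zero_le_numeral)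
        show "0 \<le> al * d \<eta> * (D + 3 * B / 2)" using al D B by (simp add: d_def)
      qed
      then have "\<gamma>\<^sup>2 * s\<^sup>2 \<le> \<gamma>\<^sup>2 * ((al * d \<eta>) * (D + 3 * B / 2))\<^sup>2"
        by (intro mult_left_mono) auto
      then show ?thesis by (simp add: power_mult_distrib power2_eq_square mult_ac)
    qed
    moreover have "\<gamma> * s \<le> \<gamma> * al * inner_Rn n (\<lambda>i. u \<eta> i - v i) e
        + \<gamma> * al\<^sup>2 * (D / (2 * B) + 1) * (d \<eta>)\<^sup>2"
    proof -
      have "inner_Rn n (\<theta> \<eta>) e = inner_Rn n (\<lambda>i. w i - u \<eta> i) e + inner_Rn n (\<lambda>i. u \<eta> i - v i) e"
        unfolding \<theta> by (simp add: inner_Rn_diff_left)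
      moreover have "inner_Rn n (\<lambda>i. w i - u \<eta> i) e \<le> (d \<eta>)\<^sup>2 / (2 * lam) * D"
      proof -
        have "inner_Rn n (\<lambda>i. w i - u \<eta> i) e \<le> dist_Rn n w (u \<eta>) * norm_Rn n e"
          by (rule inner_Rn_le)
        also have "\<dots> \<le> (d \<eta>)\<^sup>2 / (2 * lam) * D"
          unfolding d_def w_def using lam v2 e by (intro mult_mono dist_clip_self_le) auto
        finally show ?thesis .
      qed
      ultimately have "al * inner_Rn n (\<theta> \<eta>) e
          \<le> al * (inner_Rn n (\<lambda>i. u \<eta> i - v i) e + (d \<eta>)\<^sup>2 / (2 * lam) * D)"
        using al by (intro mult_left_mono) auto
      moreover have "al * ((d \<eta>)\<^sup>2 / (2 * lam) * D) = al\<^sup>2 * (D / (2 * B)) * (d \<eta>)\<^sup>2"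
        using al B by (simp add: lam_def field_simps power2_eq_square)
      moreover have "al\<^sup>2 * t\<^sup>2 \<le> al\<^sup>2 * (d \<eta>)\<^sup>2"
        using td t0 by (intro mult_left_mono power_mono) auto
      ultimately have "s \<le> al * inner_Rn n (\<lambda>i. u \<eta> i - v i) e + al\<^sup>2 * (D / (2 * B) + 1) * (d \<eta>)\<^sup>2"
        unfolding s_def by (simp add: algebra_simps)
      from mult_left_mono[OF this \<gamma>] show ?thesis by (simp add: algebra_simps)
    qed
    moreover have "\<gamma> * al\<^sup>2 * c * (d \<eta>)\<^sup>2 = \<gamma> * al\<^sup>2 * (D / (2 * B) + 1) * (d \<eta>)\<^sup>2
        + \<gamma> * al\<^sup>2 * (\<gamma> * (D + 3 * B / 2)\<^sup>2) * (d \<eta>)\<^sup>2"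
      by (simp add: c_def algebra_simps)
    ultimately show ?thesis unfolding U_def s_def t_def by linarith
  qed
  have Uint: "integrable PP U" unfolding U_def
    using mom(1) mom(3)[of e] by simp
  have "integral\<^sup>L PP U = 1 + \<gamma> * al\<^sup>2 * c * (\<integral>\<eta>. (d \<eta>)\<^sup>2 \<partial>PP)"
    unfolding U_def using mom(1) mom(3,4)[of e] PP.prob_space by simp
  also have "\<dots> \<le> 1 + \<gamma> * al\<^sup>2 * c * (\<sigma>\<^sup>2 / real m)"
    using mom(2) \<gamma> c by (intro add_left_mono mult_left_mono) auto
  also have "\<dots> \<le> exp (\<gamma> * al\<^sup>2 * c * (\<sigma>\<^sup>2 / real m))" by (rule exp_ge_add_one_self)
  finally have Ule: "integral\<^sup>L PP U \<le> exp (\<gamma> * al\<^sup>2 * (\<sigma>\<^sup>2 / real m) * c)" by (simp add: mult_ac)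
  have "(\<integral>\<^sup>+\<eta>. ennreal (exp (\<gamma> * (al * inner_Rn n (\<theta> \<eta>) e + al\<^sup>2 * (norm_Rn n (\<theta> \<eta>))\<^sup>2))) \<partial>PP)
      \<le> (\<integral>\<^sup>+\<eta>. ennreal (U \<eta>) \<partial>PP)"
    using bound by (intro nn_integral_mono ennreal_leI)
  also have "\<dots> = ennreal (integral\<^sup>L PP U)"
    using bound by (intro nn_integral_eq_integral Uint AE_I2) (meson exp_ge_zero order_trans)
  also have "\<dots> \<le> ennreal (exp (\<gamma> * al\<^sup>2 * (\<sigma>\<^sup>2 / real m) * c))" using Ule by (rule ennreal_leI)
  finally show ?thesis unfolding PP_def c_def .
qed

section \<open>Step sizes\<close>

text \<open>Most exponents below are linear in this number, see \<open>sstm_q_identities\<close>.\<close>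

definition sstm_q :: "real \<Rightarrow> real" where
  "sstm_q \<nu> = 2 * \<nu> / (1 + \<nu>)"

lemma sstm_q_bounds:
  assumes "0 \<le> \<nu>" "\<nu> \<le> 1"
  shows "0 \<le> sstm_q \<nu>" "sstm_q \<nu> \<le> 1" "\<nu> \<le> sstm_q \<nu>"
proof -
  have "\<nu> * \<nu> \<le> 1 * \<nu>" using assms by (intro mult_right_mono) auto
  then show "0 \<le> sstm_q \<nu>" "sstm_q \<nu> \<le> 1" "\<nu> \<le> sstm_q \<nu>"
    using assms by (auto simp: sstm_q_def field_simps)
qed

lemma sstm_q_identities:
  assumes "0 \<le> \<nu>"
  shows "1 / (1 + \<nu>) = 1 - sstm_q \<nu> / 2" "\<nu> / (1 + \<nu>) = sstm_q \<nu> / 2"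
    "2 / (1 + \<nu>) = 2 - sstm_q \<nu>" "(1 - \<nu>) / (1 + \<nu>) = 1 - sstm_q \<nu>"
    "(1 + \<nu>) * sstm_q \<nu> = 2 * \<nu>"
  using assms by (auto simp: sstm_q_def divide_simps)

lemma sstm_\<alpha>_Suc: "sstm_\<alpha> \<nu> a (Suc k) = a * real (Suc k) powr sstm_q \<nu>"
  by (simp add: sstm_q_def add.commute)

lemma sstm_A_nonneg: "a \<ge> 0 \<Longrightarrow> sstm_A \<nu> a k \<ge> 0"
  by (induction k) auto

lemma sstm_A_upper:
  assumes "a \<ge> 0" "0 \<le> \<nu>" "\<nu> \<le> 1"
  shows "sstm_A \<nu> a k \<le> a * real k powr (1 + sstm_q \<nu>)"
proof (induction k)
  case (Suc k)
  let ?q = "sstm_q \<nu>"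
  have "real k powr (1 + ?q) = real k * real k powr ?q" by (cases "k = 0") (auto simp: powr_add)
  also have "\<dots> \<le> real k * real (Suc k) powr ?q"
    using sstm_q_bounds[OF assms(2,3)] by (intro mult_left_mono powr_mono2) auto
  finally have "a * real k powr (1 + ?q) + a * real (Suc k) powr ?q
      \<le> a * (real k * real (Suc k) powr ?q) + a * real (Suc k) powr ?q"
    using assms by (intro add_mono mult_left_mono) auto
  also have "\<dots> = a * real (Suc k) powr (1 + ?q)" by (simp add: powr_add algebra_simps)
  finally show ?case using Suc by (simp add: sstm_\<alpha>_Suc del: sstm_\<alpha>.simps)
qed simp

text \<open>The step from \<open>k\<close> to \<open>k + 1\<close> amounts to \<open>(k - 1) (k + 1)\<^sup>q \<le> k\<^sup>1\<^sup>+\<^sup>q\<close>, which follows from \<open>q \<le> 1\<close> and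
  \<open>(k - 1) (k + 1) \<le> k\<^sup>2\<close>.\<close>

lemma sstm_A_lower:
  assumes "a \<ge> 0" "0 \<le> \<nu>" "\<nu> \<le> 1"
  shows "a * real k powr (1 + sstm_q \<nu>) / 2 \<le> sstm_A \<nu> a k"
proof (induction k)
  case (Suc k)
  let ?q = "sstm_q \<nu>"
  have *: "real (Suc k) powr (1 + ?q) \<le> real k powr (1 + ?q) + 2 * real (Suc k) powr ?q"
  proof (cases "k = 0")
    case False
    define x where "x = real k"
    have x: "x \<ge> 1" using False by (simp add: x_def)
    have "((x + 1) / x) powr ?q \<le> ((x + 1) / x) powr 1"
      using x sstm_q_bounds[OF assms(2,3)] by (intro powr_mono) auto
    then have "(x + 1) powr ?q \<le> x powr ?q * ((x + 1) / x)"
      using x by (simp add: powr_divide field_simps)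
    then have "(x - 1) * (x + 1) powr ?q \<le> (x - 1) * (x powr ?q * ((x + 1) / x))"
      using x by (intro mult_left_mono) auto
    also have "\<dots> = x powr ?q * ((x - 1) * (x + 1) / x)" using x by (simp add: field_simps)
    also have "\<dots> \<le> x powr ?q * x" using x by (intro mult_left_mono) (auto simp: field_simps)
    finally show ?thesis using x by (simp add: x_def powr_add algebra_simps)
  qed simp
  have "a * real (Suc k) powr (1 + ?q) / 2
      \<le> a * (real k powr (1 + ?q) + 2 * real (Suc k) powr ?q) / 2"
    using mult_left_mono[OF * assms(1)] by simp
  also have "\<dots> = a * real k powr (1 + ?q) / 2 + a * real (Suc k) powr ?q"
    by (simp add: algebra_simps)
  finally show ?case using Suc by (simp add: sstm_\<alpha>_Suc del: sstm_\<alpha>.simps)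
qed simp

text \<open>The constant in the bound of the gradient by the gap of the objective, with its limit at \<open>\<nu> = 0\<close>.\<close>

definition gradient_const :: "real \<Rightarrow> real" where
  "gradient_const \<nu> = (if \<nu> = 0 then 1 else ((1 + \<nu>) / \<nu>) powr (\<nu> / (1 + \<nu>)))"

lemma gradient_const_pos: "0 \<le> \<nu> \<Longrightarrow> gradient_const \<nu> > 0"
  by (auto simp: gradient_const_def)

lemma le_if_ln_le: "(0::real) < x \<Longrightarrow> 0 < y \<Longrightarrow> ln x \<le> ln y \<Longrightarrow> x \<le> y"
  by simp

text \<open>The parameters of one run: \<open>R\<close> bounds the initial distance to the minimizer, \<open>e\<close> is the target
  accuracy and \<open>exp (- l)\<close> the admitted failure probability. The step size makes \<open>A\<^sub>N \<ge> 2 R\<^sup>2 / e\<close>. The three lower bounds on \<open>N\<close> are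
  what the Hoelder remainder (\<open>smoothness_budget\<close>) and the two parts of the gradient at the query
  point (\<open>gradient_budget_hoelder\<close>, \<open>gradient_budget_gap\<close>) require.\<close>

locale sstm_schedule =
  fixes \<nu> M R e l a B :: real and N :: nat
  assumes \<nu>: "0 \<le> \<nu>" "\<nu> \<le> 1" and M: "M > 0" and R: "R > 0" and e: "e > 0" and l: "l \<ge> 1"
    and N1: "N \<ge> 1"
    and N_smooth: "256 * (M * R powr (1 + \<nu>) / e) powr (2 / (1 + \<nu>)) \<le> real N powr (1 + sstm_q \<nu>)"
    and N_grad1: "1920 * (M * R powr (1 + \<nu>) / e) * l \<le> real N powr (1 + \<nu>)"
    and N_grad2: "768 * gradient_const \<nu> * (M * R powr (1 + \<nu>) / e) powr (1 / (1 + \<nu>)) * l \<le> real N"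
    and a_def: "a = 4 * R\<^sup>2 / (e * real N powr (1 + sstm_q \<nu>))"
    and B_def: "B = R / (12 * l)"
begin

abbreviation "q \<equiv> sstm_q \<nu>"

lemma q: "0 \<le> q" "q \<le> 1" "\<nu> \<le> q" using sstm_q_bounds \<nu> by auto

lemma N_pos: "real N > 0" using N1 by simp

lemma a_pos: "a > 0" using R e N_pos by (simp add: a_def)

lemma B_pos: "B > 0" using R l by (simp add: B_def)

lemma ln_a: "ln a = ln 4 + 2 * ln R - ln e - (1 + q) * ln N"
  using R e N_pos by (simp add: a_def ln_mult ln_div ln_powr ln_realpow)

lemma ln_X: "ln (M * R powr (1 + \<nu>) / e) = ln M + (1 + \<nu>) * ln R - ln e"
  using M R e by (simp add: ln_mult ln_div ln_powr)

lemma X_pos: "M * R powr (1 + \<nu>) / e > 0" using M R e by simp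

lemma A_final: "2 * R\<^sup>2 / e \<le> sstm_A \<nu> a N"
proof -
  have "2 * R\<^sup>2 / e = a * real N powr (1 + q) / 2" using e N_pos by (simp add: a_def)
  then show ?thesis using sstm_A_lower[of a \<nu> N] \<nu> a_pos by simp
qed

lemma A_pos: "k \<ge> 1 \<Longrightarrow> sstm_A \<nu> a k > 0"
  by (rule less_le_trans[OF _ sstm_A_lower[of a \<nu> k]]) (use \<nu> a_pos in auto)

text \<open>A form of Young's inequality: below \<open>s0\<close> the first summand suffices, above \<open>s0\<close> the second.\<close>

lemma powr_le_square_plus:
  assumes "s \<ge> 0" "s0 > 0"
  shows "s powr (1 + \<nu>) \<le> s0 powr (1 + \<nu>) + s0 powr (\<nu> - 1) * s\<^sup>2"
proof (cases "s \<le> s0")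
  case True
  then have "s powr (1 + \<nu>) \<le> s0 powr (1 + \<nu>)" using assms \<nu> by (intro powr_mono2) auto
  then show ?thesis by (simp add: add_increasing2)
next
  case False
  then have "s powr (1 + \<nu>) = s powr (\<nu> - 1) * s\<^sup>2"
    using assms powr_add[of s "\<nu> - 1" 2] by (simp add: add.commute)
  also have "\<dots> \<le> s0 powr (\<nu> - 1) * s\<^sup>2"
    using False assms \<nu> by (intro mult_right_mono powr_mono2') auto
  finally show ?thesis by (simp add: add_increasing)
qed

text \<open>The Hoelder remainder of an iteration with clipped gradient of norm \<open>w\<close> is paid by the quarter of
  the quadratic term that \<open>descent_step\<close> leaves for it and by an error that adds up to \<open>R\<^sup>2 / 2\<close> over the
  run. This is the inexact-smoothness argument for Hoelder continuous gradients.\<close>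

lemma smoothness_budget:
  assumes K: "1 \<le> K" "K \<le> N" and w: "w \<ge> 0"
  shows "sstm_A \<nu> a K * (M * ((sstm_\<alpha> \<nu> a K)\<^sup>2 / sstm_A \<nu> a K * w) powr (1 + \<nu>))
      \<le> (sstm_\<alpha> \<nu> a K)\<^sup>2 / 4 * w\<^sup>2 + R\<^sup>2 / (2 * real N)"
proof -
  define al where "al = sstm_\<alpha> \<nu> a K"
  define A where "A = sstm_A \<nu> a K"
  have al: "al = a * real K powr q" using K sstm_\<alpha>_Suc[of \<nu> a "K - 1"] by (simp add: al_def)
  have K0: "real K > 0" using K by simp
  have al0: "al > 0" using al a_pos K0 by simp
  have A: "a * real K powr (1 + q) / 2 \<le> A" "A \<le> a * real K powr (1 + q)"
    using sstm_A_lower[of a \<nu> K] sstm_A_upper[of a \<nu> K] \<nu> a_pos by (auto simp: A_def)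
  have A0: "A > 0" using A_pos K by (simp add: A_def)
  \<comment> \<open>The threshold for which the constant summand costs at most \<open>R\<^sup>2 / (2 N)\<close>, by \<open>A\<^sub>K \<le> a K\<^sup>1\<^sup>+\<^sup>q\<close>.\<close>
  define s0 where "s0 = (e * real N powr q / (8 * M * real K powr (1 + q))) powr (1 / (1 + \<nu>))"
  have s0: "s0 > 0" using e N_pos M K0 by (simp add: s0_def)
  have "s0 powr (1 + \<nu>) = e * real N powr q / (8 * M * real K powr (1 + q))"
    using e N_pos M K0 \<nu> by (simp add: s0_def powr_powr)
  then have "A * (M * s0 powr (1 + \<nu>))
      \<le> a * real K powr (1 + q) * (M * (e * real N powr q / (8 * M * real K powr (1 + q))))"
    using A M e by (intro mult_mono) auto
  also have "\<dots> = a * e * real N powr q / 8" using M K0 by (simp add: field_simps)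
  also have "\<dots> = R\<^sup>2 / (2 * real N)"
    using e N_pos by (simp add: a_def powr_add field_simps)
  finally have 1: "A * (M * s0 powr (1 + \<nu>)) \<le> R\<^sup>2 / (2 * real N)" .
  have ln_s0: "ln s0 = (1 / (1 + \<nu>)) * (ln e + q * ln N - ln 8 - ln M - (1 + q) * ln K)"
    using e N_pos M K0 by (simp add: s0_def ln_powr ln_mult ln_div)
  have "(\<nu> - 1) * (1 / (1 + \<nu>)) = q - 1" using sstm_q_identities(4) \<nu> by (simp add: field_simps)
  then have ln_s0': "(\<nu> - 1) * ln s0 = (q - 1) * (ln e + q * ln N - ln 8 - ln M - (1 + q) * ln K)"
    unfolding ln_s0 by (simp only: mult.assoc[symmetric])
  have lnK: "ln K \<le> ln N" using K by simp
  \<comment> \<open>In logarithms this is the bound on \<open>N\<close>, up to the nonnegative term \<open>q (1 - q) (ln N - ln K)\<close>.\<close>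
  have "4 * (M * s0 powr (\<nu> - 1) * (2 * a * real K powr (q - 1))) \<le> 1"
  proof (rule le_if_ln_le)
    have "ln (4 * (M * s0 powr (\<nu> - 1) * (2 * a * real K powr (q - 1))))
        = ln 4 + ln M + (\<nu> - 1) * ln s0 + ln 2 + ln a + (q - 1) * ln K"
    proof -
      have "ln (8::real) = ln 4 + ln 2" using ln_mult[of 4 "2::real"] by simp
      then show ?thesis using M s0 a_pos K0 by (simp add: ln_mult ln_powr)
    qed
    also have "\<dots> = (ln 4 + ln 4 + ln 2 + (1 - q) * ln 8) + (2 - q) * (ln M - ln e) + 2 * ln R
        - (1 + q) * ln N - q * (1 - q) * (ln N - ln K)"
      unfolding ln_s0' ln_a by (simp add: algebra_simps)
    also have "\<dots> \<le> ln 256 + (2 - q) * (ln M - ln e) + 2 * ln R - (1 + q) * ln N"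
    proof -
      have "(1 - q) * ln 8 \<le> ln (8::real)" using q by (simp add: mult_le_cancel_right1)
      moreover have "q * (1 - q) * (ln N - ln K) \<ge> 0" using q lnK by simp
      moreover have "ln (256::real) = ln 4 + ln 4 + ln 2 + ln 8"
        using ln_mult[of 4 "4::real"] ln_mult[of 16 "2::real"] ln_mult[of 32 "8::real"] by simp
      ultimately show ?thesis by linarith
    qed
    also have "\<dots> \<le> 0"
    proof -
      have "ln (256 * (M * R powr (1 + \<nu>) / e) powr (2 / (1 + \<nu>))) \<le> ln (real N powr (1 + q))"
        by (intro ln_le_cancel_iff[THEN iffD2] N_smooth mult_pos_pos) (use X_pos N_pos in auto)
      moreover have "ln (256 * Y powr (2 / (1 + \<nu>))) = ln 256 + (2 - q) * ln Y" if "Y > 0" for Y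
        using that sstm_q_identities(3)[of \<nu>] \<nu> by (simp add: ln_mult ln_powr)
      note this[OF X_pos]
      ultimately have "ln 256 + (2 - q) * (ln M + (1 + \<nu>) * ln R - ln e) \<le> (1 + q) * ln N"
        using N_pos by (simp add: ln_powr flip: ln_X)
      moreover have "(2 - q) * (1 + \<nu>) = 2"
        using sstm_q_identities(5)[of \<nu>] \<nu> by (simp add: algebra_simps)
      then have "(2 - q) * ((1 + \<nu>) * ln R) = 2 * ln R" by (simp flip: mult.assoc)
      ultimately show ?thesis by (simp add: algebra_simps)
    qed
    finally show "ln (4 * (M * s0 powr (\<nu> - 1) * (2 * a * real K powr (q - 1)))) \<le> ln 1" by simp
  qed (use M s0 a_pos K0 in auto)
  moreover have "al\<^sup>2 / A \<le> 2 * a * real K powr (q - 1)"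
  proof -
    have "al\<^sup>2 / A \<le> al\<^sup>2 / (a * real K powr (1 + q) / 2)"
      using A a_pos K0 A0 by (intro divide_left_mono) auto
    also have "\<dots> = 2 * a * (real K powr q * real K powr q / real K powr (1 + q))"
      using a_pos by (simp add: al power2_eq_square field_simps)
    also have "real K powr q * real K powr q / real K powr (1 + q) = real K powr (q - 1)"
      by (simp flip: powr_add powr_diff)
    finally show ?thesis .
  qed
  then have "M * s0 powr (\<nu> - 1) * (al\<^sup>2 / A) \<le> M * s0 powr (\<nu> - 1) * (2 * a * real K powr (q - 1))"
    using M by (intro mult_left_mono) auto
  ultimately have "M * s0 powr (\<nu> - 1) * (al\<^sup>2 / A) \<le> 1 / 4" by linarith
  then have "al\<^sup>2 * w\<^sup>2 * (M * s0 powr (\<nu> - 1) * (al\<^sup>2 / A)) \<le> al\<^sup>2 * w\<^sup>2 * (1 / 4)"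
    by (intro mult_left_mono) auto
  moreover have "A * (M * (s0 powr (\<nu> - 1) * (al\<^sup>2 / A * w)\<^sup>2)) = al\<^sup>2 * w\<^sup>2 * (M * s0 powr (\<nu> - 1) * (al\<^sup>2 / A))"
    using A0 by (simp add: power2_eq_square field_simps)
  ultimately have 2: "A * (M * (s0 powr (\<nu> - 1) * (al\<^sup>2 / A * w)\<^sup>2)) \<le> al\<^sup>2 / 4 * w\<^sup>2" by simp
  have "A * (M * (al\<^sup>2 / A * w) powr (1 + \<nu>))
      \<le> A * (M * (s0 powr (1 + \<nu>) + s0 powr (\<nu> - 1) * (al\<^sup>2 / A * w)\<^sup>2))"
    using A0 M w s0 by (intro mult_left_mono powr_le_square_plus) auto
  then show ?thesis using 1 2 unfolding al_def[symmetric] A_def[symmetric] by (simp add: distrib_left)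
qed

lemma step_ratio:
  assumes "1 \<le> K"
  shows "sstm_\<alpha> \<nu> a K / sstm_A \<nu> a K \<le> 2 / real K"
proof -
  have K0: "real K > 0" using assms by simp
  have "sstm_\<alpha> \<nu> a K / sstm_A \<nu> a K \<le> a * real K powr q / (a * real K powr (1 + q) / 2)"
    using sstm_\<alpha>_Suc[of \<nu> a "K - 1"] assms sstm_A_lower[of a \<nu> K] \<nu> a_pos A_pos[OF assms]
    by (intro frac_le) auto
  also have "\<dots> = 2 / real K" using a_pos K0 by (simp add: powr_add field_simps)
  finally show ?thesis .
qed

text \<open>The gradient at the query point is compared with the gradient at \<open>y\<^sup>k\<close>, which is at distance at most
  \<open>10 R / K\<close> for \<open>K = k + 1\<close>. The left-hand side is of order \<open>K\<^bsup>q - \<nu>\<^esup>\<close>, so \<open>\<nu> \<le> q\<close>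
  makes \<open>K = N\<close> the worst case.\<close>

lemma gradient_budget_hoelder:
  assumes K: "1 \<le> K" "K \<le> N"
  shows "sstm_\<alpha> \<nu> a K * (M * (10 * R / real K) powr \<nu>) \<le> B / 4"
proof (rule le_if_ln_le)
  have K0: "real K > 0" using K by simp
  have al: "sstm_\<alpha> \<nu> a K = a * real K powr q" using K sstm_\<alpha>_Suc[of \<nu> a "K - 1"] by simp
  show "0 < sstm_\<alpha> \<nu> a K * (M * (10 * R / real K) powr \<nu>)" using al a_pos M R K0 by simp
  show "0 < B / 4" using B_pos by simp
  have lnK: "ln K \<le> ln N" using K by simp
  have "ln (sstm_\<alpha> \<nu> a K * (M * (10 * R / real K) powr \<nu>))
      = ln a + q * ln K + ln M + \<nu> * (ln 10 + ln R - ln K)"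
    using a_pos M R K0 by (simp add: al ln_mult ln_div ln_powr)
  also have "\<dots> = ln 4 + \<nu> * ln 10 + ln R + (ln M + (1 + \<nu>) * ln R - ln e) - (1 + \<nu>) * ln N
      - (q - \<nu>) * (ln N - ln K)"
    unfolding ln_a by (simp add: algebra_simps)
  also have "\<dots> \<le> ln 4 + ln 10 + ln R + (ln M + (1 + \<nu>) * ln R - ln e) - (1 + \<nu>) * ln N"
  proof -
    have "\<nu> * ln 10 \<le> ln (10::real)" using \<nu> by (simp add: mult_le_cancel_right1)
    moreover have "(q - \<nu>) * (ln N - ln K) \<ge> 0" using q lnK by simp
    ultimately show ?thesis by linarith
  qed
  also have "\<dots> \<le> ln R - ln 48 - ln l"
  proof -
    have "ln (1920 * (M * R powr (1 + \<nu>) / e) * l) \<le> ln (real N powr (1 + \<nu>))"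
      by (intro ln_le_cancel_iff[THEN iffD2] N_grad1 mult_pos_pos X_pos) (use N_pos l in auto)
    moreover have "ln (1920 * (M * R powr (1 + \<nu>) / e) * l)
        = ln 1920 + (ln M + (1 + \<nu>) * ln R - ln e) + ln l"
    proof -
      have "ln (1920 * X * l) = ln 1920 + ln X + ln l" if "X > 0" for X
        using that l by (simp add: ln_mult)
      from this[OF X_pos] show ?thesis by (simp only: ln_X)
    qed
    moreover have "ln (1920::real) = ln 4 + ln 10 + ln 48"
      using ln_mult[of 4 "10::real"] ln_mult[of 40 "48::real"] by simp
    ultimately show ?thesis using N_pos by (simp add: ln_powr)
  qed
  also have "\<dots> = ln (B / 4)"
  proof -
    have "B / 4 = R / (48 * l)" by (simp add: B_def)
    then show ?thesis using R l by (simp add: ln_div ln_mult)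
  qed
  finally show "ln (sstm_\<alpha> \<nu> a K * (M * (10 * R / real K) powr \<nu>)) \<le> ln (B / 4)" .
qed

text \<open>The gradient at \<open>y\<^sup>k\<close> is bounded through the gap of the objective there, which is at most
  \<open>16 R\<^sup>2 / (a K\<^sup>1\<^sup>+\<^sup>q)\<close> while the Lyapunov function is at most \<open>2 R\<^sup>2\<close>.\<close>

lemma gradient_budget_gap:
  assumes K: "1 \<le> K" "K \<le> N"
  shows "sstm_\<alpha> \<nu> a K * (gradient_const \<nu> * M powr (1 / (1 + \<nu>))
      * (16 * R\<^sup>2 / (a * real K powr (1 + q))) powr (\<nu> / (1 + \<nu>))) \<le> B / 4"
proof (rule le_if_ln_le)
  let ?C = "gradient_const \<nu>"
  have C: "?C > 0" using gradient_const_pos \<nu> by simp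
  have K0: "real K > 0" using K by simp
  have al: "sstm_\<alpha> \<nu> a K = a * real K powr q" using K sstm_\<alpha>_Suc[of \<nu> a "K - 1"] by simp
  show "0 < sstm_\<alpha> \<nu> a K * (?C * M powr (1 / (1 + \<nu>))
      * (16 * R\<^sup>2 / (a * real K powr (1 + q))) powr (\<nu> / (1 + \<nu>)))"
    using al a_pos M R K0 C by simp
  show "0 < B / 4" using B_pos by simp
  have lnK: "ln K \<le> ln N" using K by simp
  have "ln (sstm_\<alpha> \<nu> a K * (?C * M powr (1 / (1 + \<nu>))
      * (16 * R\<^sup>2 / (a * real K powr (1 + q))) powr (\<nu> / (1 + \<nu>))))
      = ln a + q * ln K + ln ?C + (1 - q / 2) * ln M
        + (q / 2) * (ln 16 + 2 * ln R - ln a - (1 + q) * ln K)"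
    unfolding sstm_q_identities(1,2)[OF \<nu>(1)]
    using a_pos M R K0 C by (simp add: al ln_mult ln_div ln_powr ln_realpow)
  also have "\<dots> = (1 - q / 2) * ln 4 + (q / 2) * ln 16 + ln ?C + ln R
      + (1 - q / 2) * (ln M - ln e) + ln R - ln N - q * (1 - q) / 2 * (ln N - ln K)"
    unfolding ln_a by (simp add: field_simps)
  also have "\<dots> \<le> ln 16 + ln ?C + ln R + (1 - q / 2) * (ln M - ln e) + ln R - ln N"
  proof -
    have "q * (1 - q) / 2 * (ln N - ln K) \<ge> 0" using q lnK by simp
    moreover have "(1 - q / 2) * ln 4 \<le> (1 - q / 2) * ln (16::real)"
      using q by (intro mult_left_mono) auto
    then have "(1 - q / 2) * ln 4 \<le> ln (16::real) - q / 2 * ln 16" by (simp add: left_diff_distrib)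
    ultimately show ?thesis by linarith
  qed
  also have "\<dots> \<le> ln R - ln 48 - ln l"
  proof -
    have "ln (768 * ?C * (M * R powr (1 + \<nu>) / e) powr (1 / (1 + \<nu>)) * l) \<le> ln (real N)"
      by (intro ln_le_cancel_iff[THEN iffD2] N_grad2 mult_pos_pos X_pos)
        (use N_pos l C X_pos in auto)
    moreover have "ln (768 * ?C * (M * R powr (1 + \<nu>) / e) powr (1 / (1 + \<nu>)) * l)
        = ln 768 + ln ?C + (1 / (1 + \<nu>)) * (ln M + (1 + \<nu>) * ln R - ln e) + ln l"
    proof -
      have "ln ((M * R powr (1 + \<nu>) / e) powr (1 / (1 + \<nu>)))
          = (1 / (1 + \<nu>)) * (ln M + (1 + \<nu>) * ln R - ln e)"
        unfolding ln_X[symmetric] using X_pos by (intro ln_powr) 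
      moreover have "ln (768 * ?C * Y * l) = ln 768 + ln ?C + ln Y + ln l" if "Y > 0" for Y
        using that l C by (simp add: ln_mult)
      moreover have "(M * R powr (1 + \<nu>) / e) powr (1 / (1 + \<nu>)) > 0" using M R e by simp
      ultimately show ?thesis by metis
    qed
    moreover have "(1 / (1 + \<nu>)) * (ln M + (1 + \<nu>) * ln R - ln e) = (1 / (1 + \<nu>)) * (ln M - ln e) + ln R"
      using \<nu> by (simp add: field_simps)
    moreover have "ln (768::real) = ln 16 + ln 48" using ln_mult[of 16 "48::real"] by simp
    ultimately show ?thesis using sstm_q_identities(1)[OF \<nu>(1)] by simp
  qed
  also have "\<dots> = ln (B / 4)"
  proof -
    have "B / 4 = R / (48 * l)" by (simp add: B_def)
    then show ?thesis using R l by (simp add: ln_div ln_mult)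
  qed
  finally show "ln (sstm_\<alpha> \<nu> a K * (?C * M powr (1 / (1 + \<nu>))
      * (16 * R\<^sup>2 / (a * real K powr (1 + q))) powr (\<nu> / (1 + \<nu>)))) \<le> ln (B / 4)" .
qed

end

section \<open>One run of clipped-SSTM\<close>

lemma measurable_clip:
  assumes "\<And>i. i < n \<Longrightarrow> (\<lambda>w. h w i) \<in> borel_measurable M" "i < n"
  shows "(\<lambda>w. clip n (h w) lam i) \<in> borel_measurable M"
proof -
  have [measurable]: "(\<lambda>w. norm_Rn n (h w)) \<in> borel_measurable M"
    using assms(1) by (rule measurable_norm_Rn)
  have [measurable]: "(\<lambda>w. h w i) \<in> borel_measurable M" using assms by simp
  show ?thesis using assms(2) by (simp add: clip_scale)
qed

lemma measurable_batch_gradient_pointwise: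
  assumes "pointwise_oracle n P (g x) v \<sigma>" "i < n"
  shows "(\<lambda>\<eta>. batch_gradient n g x m \<eta> i) \<in> borel_measurable (PiM {1..m} (\<lambda>_. P))"
proof -
  have [measurable]: "(\<lambda>\<xi>. g x \<xi> i) \<in> borel_measurable P"
    using assms by (simp add: pointwise_oracle_def)
  show ?thesis using assms(2) unfolding batch_gradient_def by simp
qed

text \<open>The properties of the objective that a single run needs. In \<open>gradient_gap\<close> the gap is bounded by a
  positive number \<open>h\<close>, which makes the power meaningful also for \<open>\<nu> = 0\<close>.\<close>

locale sstm_problem =
  fixes n :: nat and \<nu> M :: real and f :: "rvec \<Rightarrow> real" and G :: "rvec \<Rightarrow> rvec" and xs :: rvec
    and rad :: real and P :: "'x measure" and g :: "rvec \<Rightarrow> 'x \<Rightarrow> rvec" and \<sigma> :: real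
  assumes P: "prob_space P"
    and nu: "0 \<le> \<nu>" "\<nu> \<le> 1" and Mpos: "M > 0"
    and subgradient: "\<And>x. x \<in> Rn n \<Longrightarrow> is_subgradient n f (G x) x"
    and xs: "xs \<in> Rn n" and minimal: "\<And>x. x \<in> Rn n \<Longrightarrow> f xs \<le> f x"
    and noise: "stochastic_oracle n P g G (cball_Rn n xs rad) \<sigma>"
    and hoelder: "\<And>x y. x \<in> cball_Rn n xs rad \<Longrightarrow> y \<in> cball_Rn n xs rad \<Longrightarrow>
      dist_Rn n (G x) (G y) \<le> M * dist_Rn n x y powr \<nu>"
    and gradient_gap: "\<And>x h. x \<in> cball_Rn n xs rad \<Longrightarrow> h > 0 \<Longrightarrow> f x - f xs \<le> h \<Longrightarrow>
      norm_Rn n (G x) \<le> gradient_const \<nu> * M powr (1 / (1 + \<nu>)) * h powr (\<nu> / (1 + \<nu>))"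
    and gradient_xs: "norm_Rn n (G xs) = 0"
begin

lemma subgradient_ineq:
  "x \<in> Rn n \<Longrightarrow> y \<in> Rn n \<Longrightarrow> f y \<ge> f x + inner_Rn n (G x) (\<lambda>i. y i - x i)"
  using subgradient[of x] by (simp add: is_subgradient_def)

lemma f_measurable [measurable]: "f \<in> borel_measurable (borel_Rn n)"
  using subgradient by (rule borel_measurable_if_subgradients)

text \<open>Convexity at \<open>y\<close> replaces the integral of the gradient along the segment. This loses the
  factor \<open>1 / (1 + \<nu>)\<close> but works verbatim for subgradients.\<close>

lemma hoelder_upper_bound:
  assumes x: "x \<in> cball_Rn n xs rad" and y: "y \<in> cball_Rn n xs rad"
  shows "f y \<le> f x + inner_Rn n (G x) (\<lambda>i. y i - x i) + M * dist_Rn n y x powr (1 + \<nu>)"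
proof -
  let ?d = "dist_Rn n y x"
  have "f y \<le> f x - inner_Rn n (G y) (\<lambda>i. x i - y i)"
    using subgradient_ineq[of y x] x y by (simp add: cball_Rn_def)
  also have "\<dots> = f x + inner_Rn n (G x) (\<lambda>i. y i - x i)
      + inner_Rn n (\<lambda>i. G y i - G x i) (\<lambda>i. y i - x i)"
    by (simp add: inner_Rn_linear_left inner_Rn_linear_right)
  also have "inner_Rn n (\<lambda>i. G y i - G x i) (\<lambda>i. y i - x i) \<le> dist_Rn n (G y) (G x) * ?d"
    by (rule inner_Rn_le)
  also have "\<dots> \<le> M * ?d powr \<nu> * ?d"
    using hoelder[OF y x] by (intro mult_right_mono) auto
  also have "\<dots> = M * ?d powr (1 + \<nu>)" by (cases "?d = 0") (auto simp: powr_add less_le)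
  finally show ?thesis by simp
qed

lemma pointwise_oracle_at:
  assumes x: "x \<in> cball_Rn n xs rad"
  shows "pointwise_oracle n P (g x) (G x) \<sigma>"
proof -
  have xR: "x \<in> space (borel_Rn n)" using x by (simp add: cball_Rn_def space_borel_Rn)
  have "(\<lambda>(x, \<xi>). g x \<xi>) \<in> (borel_Rn n \<Otimes>\<^sub>M P) \<rightarrow>\<^sub>M borel_Rn n"
    using noise by (simp add: stochastic_oracle_def)
  from measurable_compose[OF measurable_Pair1'[OF xR] this]
  have "(\<lambda>\<xi>. g x \<xi>) \<in> P \<rightarrow>\<^sub>M borel_Rn n" by simp
  then have "(\<lambda>\<xi>. g x \<xi> i) \<in> borel_measurable P" if "i < n" for i
    using that by (intro measurable_compose[OF _ measurable_borel_Rn_component])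
  then show ?thesis
    using noise x by (auto simp: pointwise_oracle_def stochastic_oracle_def cball_Rn_def)
qed

end

text \<open>Separating the samples of an iteration from the state turns the algorithm into a sequence of moves
  of the kind considered in \<open>fresh_block\<close>.\<close>

definition sstm_next ::
  "nat \<Rightarrow> real \<Rightarrow> (rvec \<Rightarrow> 'x \<Rightarrow> rvec) \<Rightarrow> nat \<Rightarrow> real \<Rightarrow> real \<Rightarrow> nat \<Rightarrow>
   (nat \<Rightarrow> 'x) \<Rightarrow> rvec \<times> rvec \<Rightarrow> rvec \<times> rvec" where
  "sstm_next n \<nu> g m a B k \<eta> s =
     (let A = sstm_A \<nu> a k; al = sstm_\<alpha> \<nu> a (Suc k); x = sstm_query n (fst s) (snd s) A al
      in sstm_step n (fst s) (snd s) A al (clip n (batch_gradient n g x m \<eta>) (B / al)))"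

lemma sstm_state_Suc:
  "sstm_state n \<nu> g x0 m a B \<xi> (Suc k)
     = sstm_next n \<nu> g (m k) a B k (\<xi> k) (sstm_state n \<nu> g x0 m a B \<xi> k)"
  by (simp add: sstm_next_def sstm_step_def sstm_query_def Let_def split_beta)

lemma sstm_step_in_Rn: "sstm_step n y z A al v \<in> Rn n \<times> Rn n"
  by (simp add: sstm_step_def Let_def Rn_def)

lemma sstm_query_in_Rn: "sstm_query n y z A al \<in> Rn n"
  by (simp add: sstm_query_def Rn_def)

text \<open>The factor \<open>78\<close> makes the conditional exponential moment of an iteration at most \<open>exp (l / N)\<close>, see
  \<open>exp_moment_step\<close>.\<close>

locale sstm_run = sstm_problem n \<nu> M f G xs rad P g \<sigma> + sstm_schedule \<nu> M R e l a B N
  for n \<nu> M f G xs rad and P :: "'x measure" and g \<sigma> R e l a B N +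
  fixes m :: "nat \<Rightarrow> nat"
  assumes R_rad: "3 * R \<le> rad"
    and batch_pos: "\<And>k. k < N \<Longrightarrow> m k \<ge> 1"
    and batch_size: "\<And>k. k < N \<Longrightarrow>
      78 * real N * (sstm_\<alpha> \<nu> a (Suc k))\<^sup>2 * \<sigma>\<^sup>2 * l / R\<^sup>2 \<le> real (m k)"
begin

definition lyapunov :: "nat \<Rightarrow> rvec \<times> rvec \<Rightarrow> real" where
  "lyapunov k s = sstm_A \<nu> a k * (f (fst s) - f xs) + (dist_Rn n (snd s) xs)\<^sup>2 / 2"

lemma lyapunov_bounds:
  assumes s: "fst s \<in> Rn n" and le: "lyapunov k s \<le> 2 * R\<^sup>2"
  shows "dist_Rn n (snd s) xs \<le> 2 * R"
    and "k \<ge> 1 \<Longrightarrow> f (fst s) - f xs \<le> 2 * R\<^sup>2 / sstm_A \<nu> a k"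
proof -
  have "sstm_A \<nu> a k * (f (fst s) - f xs) \<ge> 0"
    using minimal[OF s] sstm_A_nonneg[of a \<nu> k] a_pos by simp
  then have "(dist_Rn n (snd s) xs)\<^sup>2 \<le> (2 * R)\<^sup>2"
    using le by (simp add: lyapunov_def power_mult_distrib)
  then show "dist_Rn n (snd s) xs \<le> 2 * R" by (rule power2_le_imp_le) (use R in simp)
next
  assume k: "k \<ge> 1"
  have "sstm_A \<nu> a k * (f (fst s) - f xs) \<le> 2 * R\<^sup>2"
    using le zero_le_power2[of "dist_Rn n (snd s) xs"] unfolding lyapunov_def by linarith
  then have "(f (fst s) - f xs) * sstm_A \<nu> a k \<le> 2 * R\<^sup>2" by (simp only: mult.commute)
  then show "f (fst s) - f xs \<le> 2 * R\<^sup>2 / sstm_A \<nu> a k"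
    using A_pos[OF k] by (simp only: pos_le_divide_eq)
qed

text \<open>In the first iteration the query point is \<open>z\<close> itself and the gradient is compared with the one at
  the minimizer, because \<open>A\<^sub>0 = 0\<close> gives no information on \<open>y\<close>. Later it is compared with the gradient at \<open>y\<close>.
  The point \<open>y\<close> is only known to lie in the ball of radius \<open>3 R\<close>, while \<open>z\<close> lies in the one of radius
  \<open>2 R\<close>; hence the factor \<open>5 R\<close> for their distance.\<close>

lemma query_gradient_bound:
  assumes k: "k < N" and y: "y \<in> Rn n" "dist_Rn n y xs \<le> 3 * R" and z: "z \<in> Rn n"
    and le: "lyapunov k (y, z) \<le> 2 * R\<^sup>2"
  defines "x \<equiv> sstm_query n y z (sstm_A \<nu> a k) (sstm_\<alpha> \<nu> a (Suc k))"
  shows "dist_Rn n x xs \<le> 3 * R" and "sstm_\<alpha> \<nu> a (Suc k) * norm_Rn n (G x) \<le> B / 2"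
proof -
  define K where "K = Suc k"
  have K: "1 \<le> K" "K \<le> N" using k by (auto simp: K_def)
  have K0: "real K > 0" using K by simp
  define A where "A = sstm_A \<nu> a k"
  define al where "al = sstm_\<alpha> \<nu> a K"
  have al: "al = a * real K powr q" by (simp add: al_def K_def sstm_\<alpha>_Suc del: sstm_\<alpha>.simps)
  have al0: "al > 0" using al a_pos K0 by simp
  have A0: "A \<ge> 0" using sstm_A_nonneg[of a \<nu> k] a_pos by (simp add: A_def)
  have AA: "sstm_A \<nu> a K = A + al" by (simp add: K_def A_def al_def)
  have x: "x = sstm_query n y z A al" by (simp add: x_def A_def al_def K_def)
  have xi: "x i = (A * y i + al * z i) / (A + al)" if "i < n" for i
    using that by (simp add: x sstm_query_def)
  have z2: "dist_Rn n z xs \<le> 2 * R" using lyapunov_bounds(1)[OF _ le] y by simp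
  show x3: "dist_Rn n x xs \<le> 3 * R"
    using A0 al0 xi y(2) z2 R by (intro dist_Rn_convex_combination[of A al n x y z]) auto
  have xQ: "x \<in> cball_Rn n xs rad"
    using x3 R_rad sstm_query_in_Rn by (simp add: cball_Rn_def x)
  have xsQ: "xs \<in> cball_Rn n xs rad" using xs R R_rad by (simp add: cball_Rn_def L2_set_def)
  have "al * norm_Rn n (G x) \<le> B / 2"
  proof (cases "k = 0")
    case True
    then have K1: "K = 1" and A_0: "A = 0" by (auto simp: K_def A_def)
    have "dist_Rn n x xs = dist_Rn n z xs"
      using al0 by (intro norm_Rn_cong) (simp add: xi A_0)
    then have d: "dist_Rn n x xs \<le> 10 * R / real K" using z2 R K1 by simp
    have "norm_Rn n (G x) \<le> dist_Rn n (G x) (G xs)"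
      using norm_Rn_le_dist_add[of "G x" n "G xs"] gradient_xs by simp
    also have "\<dots> \<le> M * dist_Rn n x xs powr \<nu>" using hoelder[OF xQ xsQ] .
    also have "\<dots> \<le> M * (10 * R / real K) powr \<nu>"
      using d M \<nu> by (intro mult_left_mono powr_mono2) auto
    finally have "al * norm_Rn n (G x) \<le> al * (M * (10 * R / real K) powr \<nu>)"
      using al0 by (intro mult_left_mono) auto
    also have "\<dots> \<le> B / 4" using gradient_budget_hoelder[OF K] by (simp add: al_def)
    finally show ?thesis using B_pos by simp
  next
    case False
    have yQ: "y \<in> cball_Rn n xs rad" using y R_rad by (simp add: cball_Rn_def)
    have "dist_Rn n x y = norm_Rn n (\<lambda>i. al / (A + al) * (z i - y i))"
    proof (rule norm_Rn_cong)
      fix i assume "i < n"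
      then show "x i - y i = al / (A + al) * (z i - y i)"
        using A0 al0 xi[of i] by (simp add: divide_simps) (simp add: algebra_simps)
    qed
    also have "\<dots> = al / (A + al) * dist_Rn n z y" using A0 al0 unfolding norm_Rn_scale by simp
    also have "\<dots> \<le> 2 / real K * (5 * R)"
    proof (intro mult_mono)
      show "al / (A + al) \<le> 2 / real K" using step_ratio[OF K(1)] by (simp add: al_def[symmetric] AA)
      show "dist_Rn n z y \<le> 5 * R"
        using dist_Rn_triangle[of z y n xs] norm_Rn_diff_commute[of y xs n] z2 y(2) by linarith
    qed auto
    finally have d: "dist_Rn n x y \<le> 10 * R / real K" by simp
    define h where "h = 16 * R\<^sup>2 / (a * real K powr (1 + q))"
    have h0: "h > 0" using R a_pos K0 by (simp add: h_def)
    have "f y - f xs \<le> 2 * R\<^sup>2 / A" using lyapunov_bounds(2)[OF _ le] y False by (simp add: A_def)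
    also have "\<dots> \<le> 2 * R\<^sup>2 / (a * real K powr (1 + q) / 8)"
    proof (intro divide_left_mono)
      have "real K powr (1 + q) \<le> (2 * real k) powr (1 + q)"
        using q False by (intro powr_mono2) (auto simp: K_def)
      also have "\<dots> = 2 powr (1 + q) * real k powr (1 + q)" by (simp add: powr_mult)
      also have "\<dots> \<le> 2 powr 2 * real k powr (1 + q)"
        using q by (intro mult_right_mono powr_mono) auto
      finally have "a * (real K powr (1 + q) / 8) \<le> a * (real k powr (1 + q) / 2)"
        using a_pos by (intro mult_left_mono) auto
      moreover have "a * real k powr (1 + q) / 2 \<le> A"
        using sstm_A_lower[of a \<nu> k] \<nu> a_pos by (simp add: A_def)
      ultimately show "a * real K powr (1 + q) / 8 \<le> A" by linarith
      show "0 < A * (a * real K powr (1 + q) / 8)"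
        using A_pos[of k] False a_pos K0 by (simp add: A_def)
    qed simp
    also have "\<dots> = h" by (simp add: h_def)
    finally have gap: "f y - f xs \<le> h" .
    have "norm_Rn n (G x) \<le> dist_Rn n (G x) (G y) + norm_Rn n (G y)" by (rule norm_Rn_le_dist_add)
    also have "\<dots> \<le> M * dist_Rn n x y powr \<nu>
        + gradient_const \<nu> * M powr (1 / (1 + \<nu>)) * h powr (\<nu> / (1 + \<nu>))"
      using hoelder[OF xQ yQ] gradient_gap[OF yQ h0 gap] by simp
    also have "M * dist_Rn n x y powr \<nu> \<le> M * (10 * R / real K) powr \<nu>"
      using d M \<nu> by (intro mult_left_mono powr_mono2) auto
    finally have "al * norm_Rn n (G x) \<le> al * (M * (10 * R / real K) powr \<nu>)
        + al * (gradient_const \<nu> * M powr (1 / (1 + \<nu>)) * h powr (\<nu> / (1 + \<nu>)))"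
      using al0 by (simp flip: distrib_left)
    also have "\<dots> \<le> B / 4 + B / 4"
      using gradient_budget_hoelder[OF K] gradient_budget_gap[OF K]
      unfolding al_def[symmetric] h_def[symmetric] by (rule add_mono)
    finally show ?thesis by simp
  qed
  then show "sstm_\<alpha> \<nu> a (Suc k) * norm_Rn n (G x) \<le> B / 2" by (simp only: al_def K_def)
qed

text \<open>A step of \<open>z\<close> has length at most \<open>B \<le> R\<close> because of clipping, so the new points stay in the ball of
  radius \<open>3 R\<close>, where the smoothness conditions hold, whatever the samples are.\<close>

lemma lyapunov_step:
  assumes k: "k < N" and y: "y \<in> Rn n" "dist_Rn n y xs \<le> 3 * R" and z: "z \<in> Rn n"
    and le: "lyapunov k (y, z) \<le> 2 * R\<^sup>2"
  defines "al \<equiv> sstm_\<alpha> \<nu> a (Suc k)"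
  defines "x \<equiv> sstm_query n y z (sstm_A \<nu> a k) al"
  assumes v: "norm_Rn n v \<le> B / al" and step: "(y', z') = sstm_step n y z (sstm_A \<nu> a k) al v"
  defines "\<theta> \<equiv> (\<lambda>i. v i - G x i)"
  shows "dist_Rn n y' xs \<le> 3 * R"
    and "lyapunov (Suc k) (y', z') \<le> lyapunov k (y, z)
      + (al * inner_Rn n \<theta> (\<lambda>i. xs i - z i) + al\<^sup>2 * (norm_Rn n \<theta>)\<^sup>2) + R\<^sup>2 / (2 * real N)"
proof -
  define A where "A = sstm_A \<nu> a k"
  have al0: "al > 0" using a_pos by (simp add: al_def)
  have A0: "A \<ge> 0" using sstm_A_nonneg[of a \<nu> k] a_pos by (simp add: A_def)
  have AA: "sstm_A \<nu> a (Suc k) = A + al" by (simp add: A_def al_def)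
  have xR: "x \<in> Rn n" by (simp add: x_def sstm_query_in_Rn)
  have xQ: "x \<in> cball_Rn n xs rad"
    using query_gradient_bound(1)[OF k y z le] R_rad xR
    unfolding x_def al_def by (simp add: cball_Rn_def)
  have xi: "(A + al) * x i = A * y i + al * z i" if "i < n" for i
    using that A0 al0 by (simp add: x_def sstm_query_def A_def[symmetric])
  have z'i: "z' i = z i - al * v i" if "i < n" for i
    using that step by (simp add: sstm_step_def)
  have y'i: "y' i = (A * y i + al * z' i) / (A + al)" if "i < n" for i
    using that step by (simp add: sstm_step_def Let_def A_def)
  have in_Rn: "y' \<in> Rn n" "z' \<in> Rn n" using sstm_step_in_Rn[of n y z] step by (metis SigmaE2)+
  have z2: "dist_Rn n z xs \<le> 2 * R" using lyapunov_bounds(1)[OF _ le] y by simp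
  have "dist_Rn n z' xs \<le> dist_Rn n z xs + norm_Rn n (\<lambda>i. al * v i)"
  proof -
    have "dist_Rn n z' xs = norm_Rn n (\<lambda>i. (z i - xs i) - al * v i)"
      by (intro norm_Rn_cong) (simp add: z'i)
    then show ?thesis using norm_Rn_diff_le[where u="\<lambda>i. z i - xs i" and v="\<lambda>i. al * v i"] by simp
  qed
  also have "norm_Rn n (\<lambda>i. al * v i) = al * norm_Rn n v" using al0 unfolding norm_Rn_scale by simp
  also have "\<dots> \<le> B" using v al0 by (simp add: field_simps)
  also have "B \<le> R" using R l by (simp add: B_def field_simps)
  finally have z3: "dist_Rn n z' xs \<le> 3 * R" using z2 by simp
  show y3: "dist_Rn n y' xs \<le> 3 * R"
    using A0 al0 y'i y(2) z3 by (intro dist_Rn_convex_combination[of A al n y' y z']) auto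
  have y'Q: "y' \<in> cball_Rn n xs rad" using y3 R_rad in_Rn by (simp add: cball_Rn_def)
  have "dist_Rn n y' x = norm_Rn n (\<lambda>i. (- (al\<^sup>2 / (A + al))) * v i)"
  proof (rule norm_Rn_cong)
    fix i assume i: "i < n"
    have "(A + al) * (y' i - x i) = al * (z' i - z i)"
      using A0 al0 xi[OF i] y'i[OF i] by (simp add: right_diff_distrib)
    also have "\<dots> = - (al\<^sup>2) * v i" by (simp add: z'i[OF i] power2_eq_square)
    finally show "y' i - x i = - (al\<^sup>2 / (A + al)) * v i"
      using A0 al0 by (simp add: divide_simps mult.commute)
  qed
  also have "\<dots> = al\<^sup>2 / (A + al) * norm_Rn n v" using A0 al0 unfolding norm_Rn_scale by simp
  finally have d: "dist_Rn n y' x = al\<^sup>2 / (A + al) * norm_Rn n v" .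
  have "(A + al) * (f y' - f xs) + (dist_Rn n z' xs)\<^sup>2 / 2
    \<le> A * (f y - f xs) + (dist_Rn n z xs)\<^sup>2 / 2
      + al * inner_Rn n \<theta> (\<lambda>i. xs i - z i) + al\<^sup>2 * (norm_Rn n \<theta>)\<^sup>2 + R\<^sup>2 / (2 * real N)"
    unfolding \<theta>_def
  proof (rule descent_step[OF A0 al0])
    show "x = sstm_query n y z A al" by (simp add: x_def A_def)
    show "(y', z') = sstm_step n y z A al v" using step by (simp add: A_def)
    show "f y \<ge> f x + inner_Rn n (G x) (\<lambda>i. y i - x i)" using subgradient_ineq[OF xR y(1)] .
    show "f xs \<ge> f x + inner_Rn n (G x) (\<lambda>i. xs i - x i)" using subgradient_ineq[OF xR xs] .
    show "f y' \<le> f x + inner_Rn n (G x) (\<lambda>i. y' i - x i) + M * dist_Rn n y' x powr (1 + \<nu>)"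
      using hoelder_upper_bound[OF xQ y'Q] .
    show "(A + al) * (M * dist_Rn n y' x powr (1 + \<nu>))
        \<le> al\<^sup>2 / 4 * (norm_Rn n v)\<^sup>2 + R\<^sup>2 / (2 * real N)"
      using smoothness_budget[of "Suc k" "norm_Rn n v"] k unfolding d AA al_def[symmetric] by simp
  qed
  then show "lyapunov (Suc k) (y', z') \<le> lyapunov k (y, z)
      + (al * inner_Rn n \<theta> (\<lambda>i. xs i - z i) + al\<^sup>2 * (norm_Rn n \<theta>)\<^sup>2) + R\<^sup>2 / (2 * real N)"
    unfolding lyapunov_def AA by (simp add: A_def)
qed

text \<open>An upper bound on the conditional probability that the run fails, given its state after \<open>k\<close>
  iterations. The term \<open>2 l (1 - k / N)\<close> pays for the remaining iterations: each costs \<open>l / N\<close> for the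
  error \<open>R\<^sup>2 / (2 N)\<close> of the Lyapunov function and \<open>l / N\<close> for the exponential moment of the noise.\<close>

definition failure_bound :: "nat \<Rightarrow> rvec \<times> rvec \<Rightarrow> real" where
  "failure_bound k s = (if dist_Rn n (fst s) xs \<le> 3 * R
     then min 1 (exp (2 * l / R\<^sup>2 * (lyapunov k s - 2 * R\<^sup>2) + 2 * l * (1 - real k / real N))) else 1)"

lemma failure_bound_range: "0 \<le> failure_bound k s" "failure_bound k s \<le> 1"
  by (auto simp: failure_bound_def)

lemma exp_moment_step:
  assumes k: "k < N" and y: "y \<in> Rn n" "dist_Rn n y xs \<le> 3 * R" and z: "z \<in> Rn n"
    and le: "lyapunov k (y, z) \<le> 2 * R\<^sup>2"
  defines "al \<equiv> sstm_\<alpha> \<nu> a (Suc k)"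
  defines "x \<equiv> sstm_query n y z (sstm_A \<nu> a k) al"
  defines "\<theta> \<equiv> (\<lambda>\<eta> i. clip n (batch_gradient n g x (m k) \<eta>) (B / al) i - G x i)"
  shows "(\<integral>\<^sup>+\<eta>. ennreal (exp (2 * l / R\<^sup>2 * (al * inner_Rn n (\<theta> \<eta>) (\<lambda>i. xs i - z i)
      + al\<^sup>2 * (norm_Rn n (\<theta> \<eta>))\<^sup>2))) \<partial>PiM {1..m k} (\<lambda>_. P)) \<le> ennreal (exp (l / real N))"
proof -
  define \<gamma> where "\<gamma> = 2 * l / R\<^sup>2"
  have \<gamma>0: "\<gamma> > 0" using l R by (simp add: \<gamma>_def)
  have al0: "al > 0" using a_pos by (simp add: al_def)
  note qb = query_gradient_bound[OF k y z le, folded al_def, folded x_def]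
  have xQ: "x \<in> cball_Rn n xs rad"
    using qb(1) R_rad sstm_query_in_Rn by (simp add: cball_Rn_def x_def)
  have z2: "norm_Rn n (\<lambda>i. xs i - z i) \<le> 2 * R"
    using lyapunov_bounds(1)[OF _ le] y norm_Rn_diff_commute[of xs z n] by simp
  have B: "B \<le> R / 12" using R l by (simp add: B_def field_simps)
  have small: "\<gamma> * (3 * B / 2 * (2 * R + 3 * B / 2)) \<le> 1"
  proof -
    have "3 * B / 2 * (2 * R + 3 * B / 2) \<le> 3 * B / 2 * (4 * R)"
      using B R B_pos by (intro mult_left_mono) auto
    also have "\<dots> = R\<^sup>2 / (2 * l)" using l by (simp add: B_def power2_eq_square)
    finally have "\<gamma> * (3 * B / 2 * (2 * R + 3 * B / 2)) \<le> \<gamma> * (R\<^sup>2 / (2 * l))"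
      using \<gamma>0 by (intro mult_left_mono) auto
    also have "\<dots> = 1" using l R by (simp add: \<gamma>_def)
    finally show ?thesis .
  qed
  define c where "c = 2 * R / (2 * B) + 1 + \<gamma> * (2 * R + 3 * B / 2)\<^sup>2"
  have c: "c \<le> 39 * l"
  proof -
    have "2 * R / (2 * B) = 12 * l" using R l by (simp add: B_def)
    moreover have "\<gamma> * (2 * R + 3 * B / 2)\<^sup>2 \<le> 26 * l"
    proof -
      have "2 * R + 3 * B / 2 \<le> 5 / 2 * R" using B R by simp
      then have "(2 * R + 3 * B / 2)\<^sup>2 \<le> (5 / 2 * R)\<^sup>2" using R B_pos by (intro power_mono) auto
      also have "\<dots> \<le> 13 * R\<^sup>2" by (simp add: power2_eq_square)
      finally have "\<gamma> * (2 * R + 3 * B / 2)\<^sup>2 \<le> \<gamma> * (13 * R\<^sup>2)"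
        using \<gamma>0 by (intro mult_left_mono) auto
      also have "\<dots> = 26 * l" using R by (simp add: \<gamma>_def)
      finally show ?thesis .
    qed
    ultimately show ?thesis using l by (simp add: c_def)
  qed
  have "(\<integral>\<^sup>+\<eta>. ennreal (exp (\<gamma> * (al * inner_Rn n (\<theta> \<eta>) (\<lambda>i. xs i - z i)
      + al\<^sup>2 * (norm_Rn n (\<theta> \<eta>))\<^sup>2))) \<partial>PiM {1..m k} (\<lambda>_. P))
    \<le> ennreal (exp (\<gamma> * al\<^sup>2 * (\<sigma>\<^sup>2 / real (m k)) * c))"
    unfolding \<theta>_def c_def
    using batch_pos[OF k] al0 B_pos qb(2) z2 \<gamma>0 small
    by (intro clipped_batch_exp_moment[where g=g and x=x, OF P _ pointwise_oracle_at[OF xQ]]) auto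
  also have "\<dots> \<le> ennreal (exp (l / real N))"
  proof (intro ennreal_leI, subst exp_le_cancel_iff)
    have m0: "real (m k) > 0" using batch_pos[OF k] by simp
    have "\<gamma> * al\<^sup>2 * (\<sigma>\<^sup>2 / real (m k)) * c \<le> \<gamma> * al\<^sup>2 * (\<sigma>\<^sup>2 / real (m k)) * (39 * l)"
      using c \<gamma>0 by (intro mult_left_mono) auto
    also have "\<dots> = (l / real N) * (78 * real N * al\<^sup>2 * \<sigma>\<^sup>2 * l / R\<^sup>2) / real (m k)"
      using N_pos R by (simp add: \<gamma>_def)
    also have "\<dots> \<le> (l / real N) * real (m k) / real (m k)"
      using batch_size[OF k] l N_pos m0
      unfolding al_def by (intro divide_right_mono mult_left_mono) auto
    also have "\<dots> = l / real N" using m0 by simp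
    finally show "\<gamma> * al\<^sup>2 * (\<sigma>\<^sup>2 / real (m k)) * c \<le> l / real N" .
  qed
  finally show ?thesis unfolding \<gamma>_def .
qed

text \<open>If the state is already bad, the bound is \<open>1\<close> and there is nothing to show; otherwise the iteration
  is covered by \<open>lyapunov_step\<close> and \<open>exp_moment_step\<close>.\<close>

lemma failure_bound_supermartingale:
  assumes k: "k < N" and s: "s \<in> Rn n \<times> Rn n"
  shows "(\<integral>\<^sup>+\<eta>. ennreal (failure_bound (Suc k) (sstm_next n \<nu> g (m k) a B k \<eta> s))
      \<partial>PiM {1..m k} (\<lambda>_. P)) \<le> ennreal (failure_bound k s)"
proof -
  obtain y z where s_eq: "s = (y, z)" and y: "y \<in> Rn n" and z: "z \<in> Rn n" using s by auto
  interpret PP: prob_space "PiM {1..m k} (\<lambda>_. P)" by (intro prob_space_PiM P)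
  define \<gamma> where "\<gamma> = 2 * l / R\<^sup>2"
  have \<gamma>0: "\<gamma> > 0" using l R by (simp add: \<gamma>_def)
  have triv: "(\<integral>\<^sup>+\<eta>. ennreal (failure_bound (Suc k) (sstm_next n \<nu> g (m k) a B k \<eta> s))
      \<partial>PiM {1..m k} (\<lambda>_. P)) \<le> 1"
  proof -
    have "(\<integral>\<^sup>+\<eta>. ennreal (failure_bound (Suc k) (sstm_next n \<nu> g (m k) a B k \<eta> s))
        \<partial>PiM {1..m k} (\<lambda>_. P)) \<le> (\<integral>\<^sup>+\<eta>. 1 \<partial>PiM {1..m k} (\<lambda>_. P))"
      using failure_bound_range by (intro nn_integral_mono) (simp add: ennreal_le_1)
    then show ?thesis by (simp only: nn_integral_const PP.emeasure_space_1 mult_1)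
  qed
  show ?thesis
  proof (cases "dist_Rn n y xs \<le> 3 * R \<and> lyapunov k (y, z) \<le> 2 * R\<^sup>2")
    case False
    have "failure_bound k s = 1"
    proof (cases "dist_Rn n y xs \<le> 3 * R")
      case True
      then have "lyapunov k (y, z) - 2 * R\<^sup>2 \<ge> 0" using False by simp
      then have "\<gamma> * (lyapunov k (y, z) - 2 * R\<^sup>2) \<ge> 0" using \<gamma>0 by simp
      moreover have "2 * l * (1 - real k / real N) \<ge> 0" using k l by simp
      ultimately show ?thesis by (simp add: failure_bound_def s_eq \<gamma>_def)
    qed (simp add: failure_bound_def s_eq)
    then show ?thesis using triv by simp
  next
    case True
    then have y3: "dist_Rn n y xs \<le> 3 * R" and le: "lyapunov k (y, z) \<le> 2 * R\<^sup>2" by auto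
    define al where "al = sstm_\<alpha> \<nu> a (Suc k)"
    define x where "x = sstm_query n y z (sstm_A \<nu> a k) al"
    define \<theta> where "\<theta> \<eta> i = clip n (batch_gradient n g x (m k) \<eta>) (B / al) i - G x i" for \<eta> i
    define Y where "Y \<eta> = al * inner_Rn n (\<theta> \<eta>) (\<lambda>i. xs i - z i) + al\<^sup>2 * (norm_Rn n (\<theta> \<eta>))\<^sup>2" for \<eta>
    have al0: "al > 0" using a_pos by (simp add: al_def)
    have xQ: "x \<in> cball_Rn n xs rad"
      using query_gradient_bound(1)[OF k y y3 z le] R_rad sstm_query_in_Rn
      by (simp add: cball_Rn_def x_def al_def)
    define w where "w = \<gamma> * (lyapunov k (y, z) - 2 * R\<^sup>2) + 2 * l * (1 - real k / real N)"
    have pt: "failure_bound (Suc k) (sstm_next n \<nu> g (m k) a B k \<eta> s)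
        \<le> exp (w - l / real N) * exp (\<gamma> * Y \<eta>)" for \<eta>
    proof -
      define v where "v = clip n (batch_gradient n g x (m k) \<eta>) (B / al)"
      obtain y' z' where yz': "(y', z') = sstm_step n y z (sstm_A \<nu> a k) al v"
        by (metis surj_pair)
      have nxt: "sstm_next n \<nu> g (m k) a B k \<eta> s = (y', z')"
        unfolding yz' v_def x_def al_def s_eq by (simp add: sstm_next_def Let_def)
      have v: "norm_Rn n v \<le> B / al" unfolding v_def using B_pos al0 by (intro norm_clip_le) simp
      note step = lyapunov_step[OF k y y3 z le, folded al_def, folded x_def, OF v yz']
      have "\<gamma> * lyapunov (Suc k) (y', z') \<le> \<gamma> * (lyapunov k (y, z) + Y \<eta> + R\<^sup>2 / (2 * real N))"
        using step(2) \<gamma>0 unfolding Y_def \<theta>_def[abs_def] v_def by (intro mult_left_mono) auto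
      moreover have "\<gamma> * (R\<^sup>2 / (2 * real N)) = l / real N" using R by (simp add: \<gamma>_def)
      ultimately have "\<gamma> * (lyapunov (Suc k) (y', z') - 2 * R\<^sup>2) + 2 * l * (1 - real (Suc k) / real N)
          \<le> w - l / real N + \<gamma> * Y \<eta>"
        unfolding w_def using N_pos by (simp add: algebra_simps add_divide_distrib)
      then have "exp (\<gamma> * (lyapunov (Suc k) (y', z') - 2 * R\<^sup>2) + 2 * l * (1 - real (Suc k) / real N))
          \<le> exp (w - l / real N) * exp (\<gamma> * Y \<eta>)"
        by (simp only: exp_add[symmetric] exp_le_cancel_iff)
      then show ?thesis using step(1) unfolding nxt failure_bound_def \<gamma>_def by simp
    qed
    have "(\<integral>\<^sup>+\<eta>. ennreal (failure_bound (Suc k) (sstm_next n \<nu> g (m k) a B k \<eta> s))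
        \<partial>PiM {1..m k} (\<lambda>_. P))
      \<le> (\<integral>\<^sup>+\<eta>. ennreal (exp (w - l / real N)) * ennreal (exp (\<gamma> * Y \<eta>)) \<partial>PiM {1..m k} (\<lambda>_. P))"
      using pt by (intro nn_integral_mono) (simp flip: ennreal_mult')
    also have "\<dots> \<le> ennreal (exp (w - l / real N)) * (\<integral>\<^sup>+\<eta>. ennreal (exp (\<gamma> * Y \<eta>)) \<partial>PiM {1..m k} (\<lambda>_. P))"
    proof (subst nn_integral_cmult)
      have clip_meas: "(\<lambda>\<eta>. clip n (batch_gradient n g x (m k) \<eta>) (B / al) i)
          \<in> borel_measurable (PiM {1..m k} (\<lambda>_. P))" if "i < n" for i
        using that
        by (intro measurable_clip measurable_batch_gradient_pointwise[where g=g and x=x, OF pointwise_oracle_at[OF xQ]])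
      have \<theta>_meas: "(\<lambda>\<eta>. \<theta> \<eta> i) \<in> borel_measurable (PiM {1..m k} (\<lambda>_. P))" if "i < n" for i
        using clip_meas[OF that] unfolding \<theta>_def by measurable
      have [measurable]: "(\<lambda>\<eta>. inner_Rn n (\<theta> \<eta>) (\<lambda>i. xs i - z i)) \<in> borel_measurable (PiM {1..m k} (\<lambda>_. P))"
        "(\<lambda>\<eta>. norm_Rn n (\<theta> \<eta>)) \<in> borel_measurable (PiM {1..m k} (\<lambda>_. P))"
        by (intro measurable_inner_Rn measurable_norm_Rn borel_measurable_const \<theta>_meas; assumption)+
      show "(\<lambda>\<eta>. ennreal (exp (\<gamma> * Y \<eta>))) \<in> borel_measurable (PiM {1..m k} (\<lambda>_. P))"
        unfolding Y_def by measurable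
    qed simp
    also have "\<dots> \<le> ennreal (exp (w - l / real N)) * ennreal (exp (l / real N))"
      using exp_moment_step[OF k y y3 z le]
      unfolding Y_def \<theta>_def[abs_def] x_def al_def \<gamma>_def by (intro mult_left_mono) auto
    also have "\<dots> = ennreal (exp w)" by (simp flip: ennreal_mult' exp_add)
    finally have "(\<integral>\<^sup>+\<eta>. ennreal (failure_bound (Suc k) (sstm_next n \<nu> g (m k) a B k \<eta> s))
        \<partial>PiM {1..m k} (\<lambda>_. P)) \<le> min 1 (ennreal (exp w))" using triv by simp
    also have "\<dots> = ennreal (min 1 (exp w))" by (simp add: min_def ennreal_le_1 ennreal_ge_1)
    finally show ?thesis using y3 by (simp add: failure_bound_def s_eq w_def \<gamma>_def)
  qed
qed

lemma measurable_failure_bound [measurable]: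
  "failure_bound k \<in> borel_measurable (borel_Rn n \<Otimes>\<^sub>M borel_Rn n)"
proof -
  have [measurable]: "(\<lambda>s. dist_Rn n (fst s) xs) \<in> borel_measurable (borel_Rn n \<Otimes>\<^sub>M borel_Rn n)"
    "(\<lambda>s. dist_Rn n (snd s) xs) \<in> borel_measurable (borel_Rn n \<Otimes>\<^sub>M borel_Rn n)"
    by (intro measurable_norm_Rn; simp)+
  have [measurable]: "(\<lambda>s. lyapunov k s) \<in> borel_measurable (borel_Rn n \<Otimes>\<^sub>M borel_Rn n)"
    unfolding lyapunov_def by measurable
  show ?thesis unfolding failure_bound_def[abs_def] by measurable
qed

text \<open>The exponent is at most \<open>2 l / R\<^sup>2 (R\<^sup>2 / 2 - 2 R\<^sup>2) + 2 l = - l\<close>.\<close>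

lemma failure_bound_start:
  assumes "x0 \<in> Rn n" "dist_Rn n x0 xs \<le> R"
  shows "failure_bound 0 (x0, x0) \<le> exp (- l)"
proof -
  have sq: "(dist_Rn n x0 xs)\<^sup>2 \<le> R\<^sup>2" using assms by (intro power_mono) auto
  have "(dist_Rn n x0 xs)\<^sup>2 / 2 - 2 * R\<^sup>2 \<le> R\<^sup>2 / 2 - 2 * R\<^sup>2" using sq by linarith
  then have "2 * l / R\<^sup>2 * ((dist_Rn n x0 xs)\<^sup>2 / 2 - 2 * R\<^sup>2) \<le> 2 * l / R\<^sup>2 * (R\<^sup>2 / 2 - 2 * R\<^sup>2)"
    using l by (intro mult_left_mono) (assumption, simp)
  also have "\<dots> = - 3 * l" using R by (simp add: field_simps)
  finally have "2 * l / R\<^sup>2 * (lyapunov 0 (x0, x0) - 2 * R\<^sup>2) + 2 * l * (1 - real 0 / real N) \<le> - l"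
    by (simp add: lyapunov_def)
  then show ?thesis using assms R unfolding failure_bound_def
    by (simp add: min.coboundedI2)
qed

lemma failure_bound_end:
  assumes s: "fst s \<in> Rn n" and fail: "f (fst s) - f xs > e"
  shows "failure_bound N s = 1"
proof -
  have "2 * R\<^sup>2 \<le> sstm_A \<nu> a N * e" using A_final e by (simp add: field_simps)
  also have "\<dots> \<le> sstm_A \<nu> a N * (f (fst s) - f xs)"
    using fail A_pos[OF N1] by (intro mult_left_mono) auto
  also have "\<dots> \<le> lyapunov N s" by (simp add: lyapunov_def)
  finally have "2 * l / R\<^sup>2 * (lyapunov N s - 2 * R\<^sup>2) \<ge> 0" using l R by simp
  then show ?thesis using N_pos by (simp add: failure_bound_def)
qed

end

section \<open>Fresh samples\<close>

lemma measurable_sstm_next: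
  assumes g: "(\<lambda>(x, \<xi>). g x \<xi>) \<in> (borel_Rn n \<Otimes>\<^sub>M P) \<rightarrow>\<^sub>M borel_Rn n"
  shows "(\<lambda>(s, \<eta>). sstm_next n \<nu> g m a B k \<eta> s)
    \<in> ((borel_Rn n \<Otimes>\<^sub>M borel_Rn n) \<Otimes>\<^sub>M PiM {1..m} (\<lambda>_. P)) \<rightarrow>\<^sub>M (borel_Rn n \<Otimes>\<^sub>M borel_Rn n)"
proof -
  let ?S = "(borel_Rn n \<Otimes>\<^sub>M borel_Rn n) \<Otimes>\<^sub>M PiM {1..m} (\<lambda>_. P)"
  define A where "A = sstm_A \<nu> a k"
  define al where "al = sstm_\<alpha> \<nu> a (Suc k)"
  have y [measurable]: "(\<lambda>w. fst (fst w) i) \<in> borel_measurable ?S"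
    and z [measurable]: "(\<lambda>w. snd (fst w) i) \<in> borel_measurable ?S" if "i < n" for i
    using that by (auto intro!: measurable_compose[OF _ measurable_borel_Rn_component])
  define x where "x w = sstm_query n (fst (fst w)) (snd (fst w)) A al" for w :: "(rvec \<times> rvec) \<times> (nat \<Rightarrow> 'a)"
  have x [measurable]: "x \<in> ?S \<rightarrow>\<^sub>M borel_Rn n"
    unfolding x_def[abs_def] sstm_query_def by (rule measurable_restrict) simp
  have gj: "(\<lambda>w. g (x w) (snd w j) i) \<in> borel_measurable ?S" if "i < n" "j \<in> {1..m}" for i j
  proof -
    have "(\<lambda>w. snd w j) \<in> ?S \<rightarrow>\<^sub>M P"
      by (rule measurable_compose[OF measurable_snd measurable_component_singleton[OF that(2)]])
    then have "(\<lambda>w. (x w, snd w j)) \<in> ?S \<rightarrow>\<^sub>M (borel_Rn n \<Otimes>\<^sub>M P)" by (intro measurable_Pair x)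
    from measurable_compose[OF this g] have "(\<lambda>w. g (x w) (snd w j)) \<in> ?S \<rightarrow>\<^sub>M borel_Rn n" by simp
    then show ?thesis using that by (intro measurable_compose[OF _ measurable_borel_Rn_component])
  qed
  define v where "v w = clip n (batch_gradient n g (x w) m (snd w)) (B / al)" for w
  have v: "(\<lambda>w. v w i) \<in> borel_measurable ?S" if "i < n" for i
    unfolding v_def
  proof (rule measurable_clip[OF _ that])
    fix i assume i: "i < n"
    have "(\<lambda>w. (\<Sum>j=1..m. g (x w) (snd w j) i) / real m) \<in> borel_measurable ?S"
      using gj[OF i] by (intro borel_measurable_divide borel_measurable_sum measurable_const) auto
    then show "(\<lambda>w. batch_gradient n g (x w) m (snd w) i) \<in> borel_measurable ?S"
      using i by (simp add: batch_gradient_def)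
  qed
  define z' where "z' w = (\<lambda>i\<in>{..<n}. snd (fst w) i - al * v w i)" for w
  have z': "z' \<in> ?S \<rightarrow>\<^sub>M borel_Rn n"
    unfolding z'_def[abs_def] using v by (intro measurable_restrict) simp
  have z'i [measurable]: "(\<lambda>w. z' w i) \<in> borel_measurable ?S" if "i < n" for i
    using measurable_compose[OF z' measurable_borel_Rn_component[OF that]] .
  have "(\<lambda>w. \<lambda>i\<in>{..<n}. (A * fst (fst w) i + al * z' w i) / (A + al)) \<in> ?S \<rightarrow>\<^sub>M borel_Rn n"
    using y z'i
    by (intro measurable_restrict borel_measurable_divide borel_measurable_add borel_measurable_times
        borel_measurable_const) auto
  note pair = measurable_Pair[OF this z']
  have "(\<lambda>(s, \<eta>). sstm_next n \<nu> g m a B k \<eta> s)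
      = (\<lambda>w. (\<lambda>i\<in>{..<n}. (A * fst (fst w) i + al * z' w i) / (A + al), z' w))"
  proof
    fix w :: "(rvec \<times> rvec) \<times> (nat \<Rightarrow> 'a)"
    obtain s \<eta> where w: "w = (s, \<eta>)" by fastforce
    show "(case w of (s, \<eta>) \<Rightarrow> sstm_next n \<nu> g m a B k \<eta> s)
        = (\<lambda>i\<in>{..<n}. (A * fst (fst w) i + al * z' w i) / (A + al), z' w)"
      by (simp only: w prod.case fst_conv snd_conv sstm_next_def sstm_step_def Let_def
          z'_def v_def x_def A_def al_def)
  qed
  then show ?thesis using pair by (simp only:)
qed

text \<open>The state after some iterations is a function of all samples that ignores those not yet drawn.\<close>

definition depends_on :: "'i set \<Rightarrow> (('i \<Rightarrow> 'x) \<Rightarrow> 's) \<Rightarrow> bool" where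
  "depends_on J F \<longleftrightarrow> (\<forall>\<omega> \<omega>'. (\<forall>i\<in>J. \<omega> i = \<omega>' i) \<longrightarrow> F \<omega> = F \<omega>')"

lemma depends_onD: "depends_on J F \<Longrightarrow> (\<And>i. i \<in> J \<Longrightarrow> \<omega> i = \<omega>' i) \<Longrightarrow> F \<omega> = F \<omega>'"
  by (simp add: depends_on_def)

lemma depends_on_sstm_next: "depends_on {1..m} (\<lambda>\<eta>. sstm_next n \<nu> g m a B k \<eta> s)"
  unfolding depends_on_def
proof (intro allI impI)
  fix \<eta> \<eta>' :: "nat \<Rightarrow> 'a" assume *: "\<forall>j\<in>{1..m}. \<eta> j = \<eta>' j"
  have "batch_gradient n g x m \<eta> = batch_gradient n g x m \<eta>'" for x
    unfolding batch_gradient_def using *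
    by (intro restrict_ext arg_cong2[where f="(/)"] sum.cong) auto
  then show "sstm_next n \<nu> g m a B k \<eta> s = sstm_next n \<nu> g m a B k \<eta>' s"
    by (simp only: sstm_next_def)
qed

text \<open>Adding one independent block of samples: if \<open>V'\<close> after the move has conditional expectation at most
  \<open>V\<close>, then integrating over all samples drawn so far preserves the inequality. This is Fubini's theorem,
  and it stands in for conditional expectations. The indices \<open>\<phi> j\<close> name the samples of the block.\<close>

lemma fresh_block:
  fixes F :: "('i \<Rightarrow> 'x) \<Rightarrow> 's" and \<phi> :: "nat \<Rightarrow> 'i"
  assumes P: "prob_space P" and J: "finite J" and \<phi>: "inj_on \<phi> {1..m}" "J \<inter> \<phi> ` {1..m} = {}"
    and F_dep: "depends_on J F"
    and F_meas: "F \<in> PiM J (\<lambda>_. P) \<rightarrow>\<^sub>M S"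
    and move_dep: "\<And>s. depends_on {1..m} (\<lambda>\<eta>. move \<eta> s)"
    and move_meas: "(\<lambda>(s, \<eta>). move \<eta> s) \<in> (S \<Otimes>\<^sub>M PiM {1..m} (\<lambda>_. P)) \<rightarrow>\<^sub>M S'"
    and V'_meas: "V' \<in> borel_measurable S'"
    and le: "\<And>s. s \<in> space S \<Longrightarrow> (\<integral>\<^sup>+\<eta>. V' (move \<eta> s) \<partial>PiM {1..m} (\<lambda>_. P)) \<le> V s"
  defines "K \<equiv> \<phi> ` {1..m}"
  shows "depends_on (J \<union> K) (\<lambda>\<omega>. move (\<lambda>j. \<omega> (\<phi> j)) (F \<omega>))"
    and "(\<lambda>\<omega>. move (\<lambda>j. \<omega> (\<phi> j)) (F \<omega>)) \<in> PiM (J \<union> K) (\<lambda>_. P) \<rightarrow>\<^sub>M S'"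
    and "(\<integral>\<^sup>+\<omega>. V' (move (\<lambda>j. \<omega> (\<phi> j)) (F \<omega>)) \<partial>PiM (J \<union> K) (\<lambda>_. P)) \<le> (\<integral>\<^sup>+\<omega>. V (F \<omega>) \<partial>PiM J (\<lambda>_. P))"
proof -
  interpret P: prob_space P by fact
  interpret prod: product_sigma_finite "\<lambda>_::'i. P" ..
  show "depends_on (J \<union> K) (\<lambda>\<omega>. move (\<lambda>j. \<omega> (\<phi> j)) (F \<omega>))"
    unfolding depends_on_def
  proof (intro allI impI)
    fix \<omega> \<omega>' :: "'i \<Rightarrow> 'x" assume *: "\<forall>i\<in>J \<union> K. \<omega> i = \<omega>' i"
    have "F \<omega> = F \<omega>'" using * by (intro depends_onD[OF F_dep]) simp
    moreover have "move (\<lambda>j. \<omega> (\<phi> j)) s = move (\<lambda>j. \<omega>' (\<phi> j)) s" for s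
      using * by (intro depends_onD[OF move_dep]) (simp add: K_def)
    ultimately show "move (\<lambda>j. \<omega> (\<phi> j)) (F \<omega>) = move (\<lambda>j. \<omega>' (\<phi> j)) (F \<omega>')" by simp
  qed
  define block where "block \<omega> = (\<lambda>j\<in>{1..m}. \<omega> (\<phi> j))" for \<omega> :: "'i \<Rightarrow> 'x"
  have block_move: "move (\<lambda>j. \<omega> (\<phi> j)) s = move (block \<omega>) s" for \<omega> s
    by (rule depends_onD[OF move_dep]) (simp add: block_def)
  have block_meas: "block \<in> PiM L (\<lambda>_. P) \<rightarrow>\<^sub>M PiM {1..m} (\<lambda>_. P)" if "K \<subseteq> L" for L
    unfolding block_def[abs_def] using that
    by (intro measurable_restrict measurable_component_singleton) (auto simp: K_def)
  have F_meas': "F \<in> PiM (J \<union> K) (\<lambda>_. P) \<rightarrow>\<^sub>M S"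
  proof -
    have "(\<lambda>\<omega>. F (restrict \<omega> J)) \<in> PiM (J \<union> K) (\<lambda>_. P) \<rightarrow>\<^sub>M S"
      by (rule measurable_compose[OF measurable_restrict_subset F_meas]) simp
    moreover have "F (restrict \<omega> J) = F \<omega>" for \<omega> by (rule depends_onD[OF F_dep]) simp
    ultimately show ?thesis by simp
  qed
  have "(\<lambda>\<omega>. (F \<omega>, block \<omega>)) \<in> PiM (J \<union> K) (\<lambda>_. P) \<rightarrow>\<^sub>M (S \<Otimes>\<^sub>M PiM {1..m} (\<lambda>_. P))"
    by (intro measurable_Pair F_meas' block_meas) simp
  from measurable_compose[OF this move_meas]
  show meas: "(\<lambda>\<omega>. move (\<lambda>j. \<omega> (\<phi> j)) (F \<omega>)) \<in> PiM (J \<union> K) (\<lambda>_. P) \<rightarrow>\<^sub>M S'"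
    by (simp add: block_move)
  have "(\<integral>\<^sup>+\<omega>. V' (move (\<lambda>j. \<omega> (\<phi> j)) (F \<omega>)) \<partial>PiM (J \<union> K) (\<lambda>_. P))
      = (\<integral>\<^sup>+\<omega>. \<integral>\<^sup>+\<zeta>. V' (move (\<lambda>j. merge J K (\<omega>, \<zeta>) (\<phi> j)) (F (merge J K (\<omega>, \<zeta>))))
           \<partial>PiM K (\<lambda>_. P) \<partial>PiM J (\<lambda>_. P))"
    using \<phi>(2) J measurable_compose[OF meas V'_meas]
    by (intro prod.product_nn_integral_fold) (auto simp: K_def)
  also have "\<dots> \<le> (\<integral>\<^sup>+\<omega>. V (F \<omega>) \<partial>PiM J (\<lambda>_. P))"
  proof (rule nn_integral_mono)
    fix \<omega> assume \<omega>: "\<omega> \<in> space (PiM J (\<lambda>_. P))"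
    have s: "F \<omega> \<in> space S" using measurable_space[OF F_meas \<omega>] .
    have F_merge: "F (merge J K (\<omega>, \<zeta>)) = F \<omega>" for \<zeta>
      by (rule depends_onD[OF F_dep]) (simp add: merge_def)
    have move_merge: "move (\<lambda>j. merge J K (\<omega>, \<zeta>) (\<phi> j)) s = move (block \<zeta>) s" for \<zeta> s
      using \<phi>(2) by (intro depends_onD[OF move_dep]) (auto simp: merge_def block_def K_def)
    have V_move: "(\<lambda>\<eta>. V' (move \<eta> (F \<omega>))) \<in> borel_measurable (PiM {1..m} (\<lambda>_. P))"
      using measurable_compose[OF measurable_Pair1'[OF s] measurable_compose[OF move_meas V'_meas]]
      by simp
    have distr: "distr (PiM K (\<lambda>_. P)) (PiM {1..m} (\<lambda>_. P)) block = PiM {1..m} (\<lambda>_. P)"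
      using distr_PiM_reindex[of K "\<lambda>_. P" \<phi> "{1..m}"] P \<phi>(1)
      unfolding block_def[abs_def] by (auto simp: K_def)
    have "(\<integral>\<^sup>+\<zeta>. V' (move (\<lambda>j. merge J K (\<omega>, \<zeta>) (\<phi> j)) (F (merge J K (\<omega>, \<zeta>)))) \<partial>PiM K (\<lambda>_. P))
        = (\<integral>\<^sup>+\<zeta>. V' (move (block \<zeta>) (F \<omega>)) \<partial>PiM K (\<lambda>_. P))"
      by (simp add: F_merge move_merge)
    also have "\<dots> = (\<integral>\<^sup>+\<eta>. V' (move \<eta> (F \<omega>)) \<partial>distr (PiM K (\<lambda>_. P)) (PiM {1..m} (\<lambda>_. P)) block)"
      by (rule nn_integral_distr[symmetric, OF block_meas[OF order_refl]])
        (use V_move in \<open>simp only: distr\<close>)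
    also have "\<dots> = (\<integral>\<^sup>+\<eta>. V' (move \<eta> (F \<omega>)) \<partial>PiM {1..m} (\<lambda>_. P))" by (simp only: distr)
    also have "\<dots> \<le> V (F \<omega>)" using le[OF s] .
    finally show "(\<integral>\<^sup>+\<zeta>. V' (move (\<lambda>j. merge J K (\<omega>, \<zeta>) (\<phi> j)) (F (merge J K (\<omega>, \<zeta>)))) \<partial>PiM K (\<lambda>_. P))
        \<le> V (F \<omega>)" .
  qed
  finally show "(\<integral>\<^sup>+\<omega>. V' (move (\<lambda>j. \<omega> (\<phi> j)) (F \<omega>)) \<partial>PiM (J \<union> K) (\<lambda>_. P))
      \<le> (\<integral>\<^sup>+\<omega>. V (F \<omega>) \<partial>PiM J (\<lambda>_. P))" .
qed

section \<open>Restarts\<close>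

text \<open>The indices of the samples drawn before iteration \<open>k\<close> of run \<open>t\<close>.\<close>

definition used_samples ::
  "(nat \<Rightarrow> nat) \<Rightarrow> (nat \<Rightarrow> nat \<Rightarrow> nat) \<Rightarrow> nat \<Rightarrow> nat \<Rightarrow> (nat \<times> nat \<times> nat) set" where
  "used_samples Ns ms t k = (SIGMA t':{1..t}. SIGMA k':{..<if t' = t then k else Ns t'}. {1..ms t' k'})"

lemma finite_used_samples: "finite (used_samples Ns ms t k)"
  by (simp add: used_samples_def)

lemma used_samples_Suc:
  assumes "t \<ge> 1"
  shows "used_samples Ns ms t (Suc k) = used_samples Ns ms t k \<union> (\<lambda>j. (t, k, j)) ` {1..ms t k}"
  using assms unfolding used_samples_def by (force split: if_splits simp: less_Suc_eq)

lemma used_samples_next_restart: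
  "used_samples Ns ms (Suc t) 0 = used_samples Ns ms t (Ns t)"
  unfolding used_samples_def by (auto split: if_splits simp: le_Suc_eq)

text \<open>Success of run \<open>t\<close> brings its output into the ball in which run \<open>t + 1\<close> has to start.\<close>

locale restarted_sstm = sstm_problem n \<nu> M f G xs rad P g \<sigma>
  for n \<nu> M f G xs rad and P :: "'x measure" and g \<sigma> +
  fixes x0 :: rvec and \<tau> :: nat and Ns :: "nat \<Rightarrow> nat" and ms :: "nat \<Rightarrow> nat \<Rightarrow> nat"
    and as Bs Rs es :: "nat \<Rightarrow> real" and l :: real
  assumes x0: "x0 \<in> Rn n" "dist_Rn n x0 xs \<le> Rs 1"
    and run: "\<And>t. t \<in> {1..\<tau>} \<Longrightarrow>
      sstm_run n \<nu> M f G xs rad P g \<sigma> (Rs t) (es t) l (as t) (Bs t) (Ns t) (ms t)"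
    and contraction: "\<And>t y. t \<in> {1..<\<tau>} \<Longrightarrow> y \<in> Rn n \<Longrightarrow> f y - f xs \<le> es t \<Longrightarrow>
      dist_Rn n y xs \<le> Rs (Suc t)"
begin

definition restart_point :: "nat \<Rightarrow> (nat \<times> nat \<times> nat \<Rightarrow> 'x) \<Rightarrow> rvec" where
  "restart_point t \<omega> = R_clipped_SSTM n \<nu> g x0 Ns ms as Bs (\<lambda>t k j. \<omega> (t, k, j)) t"

definition run_state :: "nat \<Rightarrow> nat \<Rightarrow> (nat \<times> nat \<times> nat \<Rightarrow> 'x) \<Rightarrow> rvec \<times> rvec" where
  "run_state t k \<omega> = sstm_state n \<nu> g (restart_point t \<omega>) (ms (Suc t)) (as (Suc t)) (Bs (Suc t))
     (\<lambda>k j. \<omega> (Suc t, k, j)) k"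

lemma restart_point_Suc: "restart_point (Suc t) \<omega> = fst (run_state t (Ns (Suc t)) \<omega>)"
  by (simp add: restart_point_def run_state_def clipped_SSTM_def)

lemma run_state_Suc:
  "run_state t (Suc k) \<omega> = sstm_next n \<nu> g (ms (Suc t) k) (as (Suc t)) (Bs (Suc t)) k
     (\<lambda>j. \<omega> (Suc t, k, j)) (run_state t k \<omega>)"
  by (simp only: run_state_def sstm_state_Suc)

lemma run_state_0: "run_state t 0 \<omega> = (restart_point t \<omega>, restart_point t \<omega>)"
  by (simp add: run_state_def)

text \<open>There is no run \<open>0\<close>; the starting point is always good.\<close>

definition bad :: "nat \<Rightarrow> rvec set" where
  "bad t = (if t = 0 then {} else {y. f y - f xs > es t})"

abbreviation law :: "nat \<Rightarrow> nat \<Rightarrow> (nat \<times> nat \<times> nat \<Rightarrow> 'x) measure" where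
  "law t k \<equiv> PiM (used_samples Ns ms t k) (\<lambda>_. P)"

text \<open>Each run either starts at a bad point, or its failure bound starts below \<open>exp (- l)\<close>; the bound is
  then carried through the run by \<open>fresh_block\<close>, so every run adds \<open>exp (- l)\<close>.\<close>

lemma restart_failure_probability:
  assumes "t \<le> \<tau>"
  shows "depends_on (used_samples Ns ms (Suc t) 0) (restart_point t) \<and>
    restart_point t \<in> law (Suc t) 0 \<rightarrow>\<^sub>M borel_Rn n \<and>
    (\<integral>\<^sup>+\<omega>. indicator (bad t) (restart_point t \<omega>) \<partial>law (Suc t) 0) \<le> ennreal (real t * exp (- l))"
  using assms
proof (induction t)
  case 0
  have "x0 \<in> space (borel_Rn n)" using x0 by (simp add: space_borel_Rn)
  then show ?case by (simp add: restart_point_def[abs_def] bad_def depends_on_def)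
next
  case (Suc t)
  then have IH_dep: "depends_on (used_samples Ns ms (Suc t) 0) (restart_point t)"
    and IH_meas [measurable]: "restart_point t \<in> law (Suc t) 0 \<rightarrow>\<^sub>M borel_Rn n"
    and IH_le: "(\<integral>\<^sup>+\<omega>. indicator (bad t) (restart_point t \<omega>) \<partial>law (Suc t) 0) \<le> ennreal (real t * exp (- l))"
    by auto
  define T where "T = Suc t"
  have T: "T \<in> {1..\<tau>}" using Suc.prems by (simp add: T_def)
  interpret run: sstm_run n \<nu> M f G xs rad P g \<sigma> "Rs T" "es T" l "as T" "Bs T" "Ns T" "ms T"
    using run[OF T] .
  have g: "(\<lambda>(x, \<xi>). g x \<xi>) \<in> (borel_Rn n \<Otimes>\<^sub>M P) \<rightarrow>\<^sub>M borel_Rn n"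
    using noise by (simp add: stochastic_oracle_def)
  have state: "depends_on (used_samples Ns ms T k) (run_state t k) \<and>
    run_state t k \<in> law T k \<rightarrow>\<^sub>M (borel_Rn n \<Otimes>\<^sub>M borel_Rn n) \<and>
    (\<integral>\<^sup>+\<omega>. ennreal (run.failure_bound k (run_state t k \<omega>)) \<partial>law T k) \<le> ennreal (real T * exp (- l))"
    if "k \<le> Ns T" for k
    using that
  proof (induction k)
    case 0
    interpret law: prob_space "law T 0" by (intro prob_space_PiM P)
    have pt: "ennreal (run.failure_bound 0 (run_state t 0 \<omega>))
        \<le> ennreal (exp (- l)) + indicator (bad t) (restart_point t \<omega>)" if "\<omega> \<in> space (law T 0)" for \<omega>
    proof (cases "restart_point t \<omega> \<in> bad t")
      case True
      then show ?thesis using run.failure_bound_range(2)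
        by (auto simp: ennreal_le_1 add_increasing)
    next
      case False
      have in_Rn: "restart_point t \<omega> \<in> Rn n"
        using measurable_space[OF IH_meas] that by (simp add: space_borel_Rn T_def)
      have "dist_Rn n (restart_point t \<omega>) xs \<le> Rs T"
      proof (cases "t = 0")
        case True
        then show ?thesis using x0 by (simp add: restart_point_def T_def)
      next
        case t: False
        then show ?thesis
          using contraction[of t] in_Rn False Suc.prems by (simp add: bad_def T_def)
      qed
      then show ?thesis
        using run.failure_bound_start[OF in_Rn] False by (simp add: run_state_0 ennreal_leI)
    qed
    have "(\<integral>\<^sup>+\<omega>. ennreal (run.failure_bound 0 (run_state t 0 \<omega>)) \<partial>law T 0)
        \<le> (\<integral>\<^sup>+\<omega>. ennreal (exp (- l)) + indicator (bad t) (restart_point t \<omega>) \<partial>law T 0)"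
      using pt by (rule nn_integral_mono)
    also have "\<dots> = ennreal (exp (- l)) + (\<integral>\<^sup>+\<omega>. indicator (bad t) (restart_point t \<omega>) \<partial>law T 0)"
    proof -
      have "bad t \<inter> space (borel_Rn n) \<in> sets (borel_Rn n)"
      proof (cases "t = 0")
        case False
        have "{y \<in> space (borel_Rn n). f y - f xs > es t} \<in> sets (borel_Rn n)" by measurable
        then show ?thesis using False by (simp add: bad_def Int_def conj_commute)
      qed (simp add: bad_def)
      then have "(indicator (bad t) :: rvec \<Rightarrow> ennreal) \<in> borel_measurable (borel_Rn n)"
        by (simp only: borel_measurable_indicator_iff)
      then have "(\<lambda>\<omega>. indicator (bad t) (restart_point t \<omega>) :: ennreal) \<in> borel_measurable (law T 0)"
        unfolding T_def by (rule measurable_compose[OF IH_meas])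
      then show ?thesis by (simp add: nn_integral_add law.emeasure_space_1)
    qed
    also have "\<dots> \<le> ennreal (exp (- l)) + ennreal (real t * exp (- l))"
      using IH_le by (intro add_left_mono) (simp add: T_def)
    also have "\<dots> = ennreal (real T * exp (- l))"
      by (simp add: T_def distrib_right flip: ennreal_plus)
    finally have le: "(\<integral>\<^sup>+\<omega>. ennreal (run.failure_bound 0 (run_state t 0 \<omega>)) \<partial>law T 0) \<le> ennreal (real T * exp (- l))" .
    have meas: "run_state t 0 \<in> law T 0 \<rightarrow>\<^sub>M (borel_Rn n \<Otimes>\<^sub>M borel_Rn n)"
      unfolding run_state_0[abs_def] T_def by measurable
    have "depends_on (used_samples Ns ms T 0) (run_state t 0)"
      using depends_onD[OF IH_dep] unfolding depends_on_def run_state_0 T_def by blast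
    then show ?case using le meas by blast
  next
    case (Suc k)
    then have k: "k < Ns T" and
      dep: "depends_on (used_samples Ns ms T k) (run_state t k)" and
      meas: "run_state t k \<in> law T k \<rightarrow>\<^sub>M (borel_Rn n \<Otimes>\<^sub>M borel_Rn n)" and
      le: "(\<integral>\<^sup>+\<omega>. ennreal (run.failure_bound k (run_state t k \<omega>)) \<partial>law T k) \<le> ennreal (real T * exp (- l))"
      by auto
    let ?move = "sstm_next n \<nu> g (ms T k) (as T) (Bs T) k"
    have eq: "run_state t (Suc k) = (\<lambda>\<omega>. ?move (\<lambda>j. \<omega> (T, k, j)) (run_state t k \<omega>))"
      by (simp add: fun_eq_iff run_state_Suc T_def)
    have used: "used_samples Ns ms T (Suc k) = used_samples Ns ms T k \<union> (\<lambda>j. (T, k, j)) ` {1..ms T k}"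
      using used_samples_Suc T by simp
    have disj: "used_samples Ns ms T k \<inter> (\<lambda>j. (T, k, j)) ` {1..ms T k} = {}"
      by (auto simp: used_samples_def)
    have inj: "inj_on (\<lambda>j. (T, k, j)) {1..ms T k}" by (simp add: inj_on_def)
    have V'_meas: "(\<lambda>s. ennreal (run.failure_bound (Suc k) s))
        \<in> borel_measurable (borel_Rn n \<Otimes>\<^sub>M borel_Rn n)" by measurable
    have V'_le: "(\<integral>\<^sup>+\<eta>. ennreal (run.failure_bound (Suc k) (?move \<eta> s)) \<partial>PiM {1..ms T k} (\<lambda>_. P))
        \<le> ennreal (run.failure_bound k s)" if "s \<in> space (borel_Rn n \<Otimes>\<^sub>M borel_Rn n)" for s
      using run.failure_bound_supermartingale[OF k] that
      by (simp add: space_pair_measure space_borel_Rn)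
    note block = fresh_block[where move="?move" and V="\<lambda>s. ennreal (run.failure_bound k s)",
        OF P finite_used_samples inj disj dep meas depends_on_sstm_next measurable_sstm_next[OF g]
          V'_meas V'_le, folded used]
    show ?case using block(1,2) order_trans[OF block(3) le] unfolding eq by blast
  qed
  have used: "used_samples Ns ms (Suc T) 0 = used_samples Ns ms T (Ns T)"
    by (rule used_samples_next_restart)
  note final = state[OF order_refl]
  have point: "restart_point T = (\<lambda>\<omega>. fst (run_state t (Ns T) \<omega>))"
    by (simp add: fun_eq_iff restart_point_Suc T_def)
  have meas: "restart_point T \<in> law T (Ns T) \<rightarrow>\<^sub>M borel_Rn n"
    unfolding point using final by (intro measurable_compose[OF _ measurable_fst]) blast
  have "(\<integral>\<^sup>+\<omega>. indicator (bad T) (restart_point T \<omega>) \<partial>law T (Ns T))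
      \<le> (\<integral>\<^sup>+\<omega>. ennreal (run.failure_bound (Ns T) (run_state t (Ns T) \<omega>)) \<partial>law T (Ns T))"
  proof (rule nn_integral_mono)
    fix \<omega> assume \<omega>: "\<omega> \<in> space (law T (Ns T))"
    have in_Rn: "fst (run_state t (Ns T) \<omega>) \<in> Rn n"
      using measurable_space[OF meas \<omega>] by (simp add: point space_borel_Rn)
    show "indicator (bad T) (restart_point T \<omega>) \<le> ennreal (run.failure_bound (Ns T) (run_state t (Ns T) \<omega>))"
    proof (cases "restart_point T \<omega> \<in> bad T")
      case True
      moreover have "T \<noteq> 0" by (simp add: T_def)
      ultimately have "f (fst (run_state t (Ns T) \<omega>)) - f xs > es T" by (simp add: point bad_def)
      from run.failure_bound_end[OF in_Rn this] show ?thesis by (simp add: indicator_def)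
    qed simp
  qed
  also have "\<dots> \<le> ennreal (real T * exp (- l))" using final by blast
  finally have "(\<integral>\<^sup>+\<omega>. indicator (bad T) (restart_point T \<omega>) \<partial>law T (Ns T)) \<le> ennreal (real T * exp (- l))" .
  moreover have "depends_on (used_samples Ns ms T (Ns T)) (restart_point T)"
  proof -
    have "depends_on (used_samples Ns ms T (Ns T)) (run_state t (Ns T))" using final by blast
    then show ?thesis unfolding point depends_on_def by metis
  qed
  ultimately show ?case unfolding T_def[symmetric] used using meas by (intro conjI)
qed

text \<open>The samples on the probability space \<open>W\<close> have the product law for which
  \<open>restart_failure_probability\<close> is stated, by independence.\<close>

lemma restarted_success_probability:
  fixes W :: "'w measure"
  assumes \<tau>: "\<tau> \<ge> 1" and W: "prob_space W" and fresh: "fresh_samples W P \<tau> Ns ms X"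
  shows "measure W {\<omega> \<in> space W.
      f (R_clipped_SSTM n \<nu> g x0 Ns ms as Bs (\<lambda>t k j. X t k j \<omega>) \<tau>) - f xs \<le> es \<tau>}
    \<ge> 1 - real \<tau> * exp (- l)"
proof -
  interpret W: prob_space W by fact
  define I where "I = used_samples Ns ms \<tau> (Ns \<tau>)"
  define XX where "XX = (\<lambda>(t, k, j). X t k j)"
  have I: "I = {(t, k, j). t \<in> {1..\<tau>} \<and> k < Ns t \<and> j \<in> {1..ms t k}}"
    using \<tau> by (auto simp: I_def used_samples_def split: if_splits)
  have indep: "W.indep_vars (\<lambda>_. P) XX I" and same_law: "\<And>i. i \<in> I \<Longrightarrow> distr W P (XX i) = P"
    using fresh unfolding fresh_samples_def Let_def I[symmetric] XX_def by auto
  have X_meas: "XX i \<in> W \<rightarrow>\<^sub>M P" if "i \<in> I" for i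
    using indep that unfolding W.indep_vars_def by auto
  have "I \<noteq> {}"
  proof -
    interpret run: sstm_run n \<nu> M f G xs rad P g \<sigma> "Rs 1" "es 1" l "as 1" "Bs 1" "Ns 1" "ms 1"
      using run[of 1] \<tau> by simp
    have "(1, 0, 1) \<in> I" using \<tau> run.N1 run.batch_pos[of 0] by (simp add: I)
    then show ?thesis by blast
  qed
  define Y where "Y \<omega> = (\<lambda>i\<in>I. XX i \<omega>)" for \<omega>
  have Y_meas: "Y \<in> W \<rightarrow>\<^sub>M PiM I (\<lambda>_. P)"
    unfolding Y_def[abs_def] by (intro measurable_restrict X_meas)
  have "distr W (PiM I (\<lambda>_. P)) Y = PiM I (\<lambda>i. distr W P (XX i))"
    using W.indep_vars_iff_distr_eq_PiM'[OF \<open>I \<noteq> {}\<close>, where M'="\<lambda>_. P" and X=XX] X_meas indep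
    unfolding Y_def[abs_def] by simp
  also have "\<dots> = PiM I (\<lambda>_. P)" by (rule PiM_cong) (auto simp: same_law)
  finally have Y_law: "distr W (PiM I (\<lambda>_. P)) Y = PiM I (\<lambda>_. P)" .
  have I': "used_samples Ns ms (Suc \<tau>) 0 = I" by (simp add: I_def used_samples_next_restart)
  have dep: "depends_on I (restart_point \<tau>)"
    and meas: "restart_point \<tau> \<in> PiM I (\<lambda>_. P) \<rightarrow>\<^sub>M borel_Rn n"
    and le: "(\<integral>\<^sup>+\<omega>. indicator (bad \<tau>) (restart_point \<tau> \<omega>) \<partial>PiM I (\<lambda>_. P)) \<le> ennreal (real \<tau> * exp (- l))"
    using restart_failure_probability[OF order_refl] unfolding I' by auto
  define out where "out \<omega> = restart_point \<tau> (Y \<omega>)" for \<omega>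
  have out: "R_clipped_SSTM n \<nu> g x0 Ns ms as Bs (\<lambda>t k j. X t k j \<omega>) \<tau> = out \<omega>" for \<omega>
  proof -
    have "restart_point \<tau> (\<lambda>i. XX i \<omega>) = restart_point \<tau> (Y \<omega>)"
      by (rule depends_onD[OF dep]) (simp add: Y_def)
    then show ?thesis by (simp add: out_def restart_point_def XX_def)
  qed
  have out_meas [measurable]: "out \<in> W \<rightarrow>\<^sub>M borel_Rn n"
    unfolding out_def[abs_def] by (rule measurable_compose[OF Y_meas meas])
  define F where "F = {\<omega> \<in> space W. f (out \<omega>) - f xs > es \<tau>}"
  have F: "F \<in> sets W" unfolding F_def by measurable
  have bad_meas: "(\<lambda>y. indicator (bad \<tau>) y :: ennreal) \<in> borel_measurable (borel_Rn n)"
  proof -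
    have "{y \<in> space (borel_Rn n). f y - f xs > es \<tau>} \<in> sets (borel_Rn n)" by measurable
    then have "bad \<tau> \<inter> space (borel_Rn n) \<in> sets (borel_Rn n)"
      using \<tau> by (simp add: bad_def Int_def conj_commute)
    then show ?thesis by (simp only: borel_measurable_indicator_iff)
  qed
  have "emeasure W F = (\<integral>\<^sup>+\<omega>. indicator F \<omega> \<partial>W)" using F by simp
  also have "\<dots> = (\<integral>\<^sup>+\<omega>. indicator (bad \<tau>) (out \<omega>) \<partial>W)"
    using \<tau> by (intro nn_integral_cong) (auto simp: F_def bad_def indicator_def)
  also have "\<dots> = (\<integral>\<^sup>+\<omega>. indicator (bad \<tau>) (restart_point \<tau> \<omega>) \<partial>distr W (PiM I (\<lambda>_. P)) Y)"
    unfolding out_def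
    by (rule nn_integral_distr[symmetric, OF Y_meas])
      (use measurable_compose[OF meas bad_meas] in simp)
  also have "\<dots> \<le> ennreal (real \<tau> * exp (- l))" using le by (simp only: Y_law)
  finally have "measure W F \<le> real \<tau> * exp (- l)" by (simp add: W.emeasure_eq_measure)
  moreover have "{\<omega> \<in> space W. f (R_clipped_SSTM n \<nu> g x0 Ns ms as Bs (\<lambda>t k j. X t k j \<omega>) \<tau>) - f xs \<le> es \<tau>}
      = space W - F"
    by (auto simp: out F_def)
  ultimately show ?thesis using W.prob_compl[OF F] by simp
qed

end

section \<open>Choice of the parameters\<close>

definition iteration_const :: "real \<Rightarrow> real" where
  "iteration_const \<nu> = max 1920 (768 * gradient_const \<nu>)"

text \<open>The required orders of \<open>N\<close> are \<open>X\<^bsup>2/(1+3\<nu>)\<^esup>\<close> for the smoothness budget and \<open>X\<^bsup>1/(1+\<nu>)\<^esup> l\<close> for the gradient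
  budgets. Since \<open>1 / (1 + \<nu>) \<le> 2 / (1 + 3 \<nu>)\<close> and the exponent of \<open>l\<close> is at least \<open>1\<close>, the stated order covers both.\<close>

lemma iteration_number_suffices:
  assumes \<nu>: "0 \<le> \<nu>" "\<nu> \<le> 1" and X: "X \<ge> 1" and l: "l \<ge> 1"
    and N: "iteration_const \<nu> * (X powr (2 / (1 + 3 * \<nu>)) * l powr (2 * (1 + \<nu>) / (1 + 3 * \<nu>))) \<le> N"
  shows "256 * X powr (2 / (1 + \<nu>)) \<le> N powr (1 + sstm_q \<nu>)"
    and "1920 * X * l \<le> N powr (1 + \<nu>)"
    and "768 * gradient_const \<nu> * X powr (1 / (1 + \<nu>)) * l \<le> N"
proof -
  let ?s = "2 / (1 + 3 * \<nu>)" and ?p = "2 * (1 + \<nu>) / (1 + 3 * \<nu>)" and ?c = "iteration_const \<nu>"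
  have c: "?c \<ge> 1920" "?c \<ge> 768 * gradient_const \<nu>" by (auto simp: iteration_const_def)
  have p1: "1 \<le> ?p" using \<nu> by (simp add: field_simps)
  have s1: "1 / (1 + \<nu>) \<le> ?s" using \<nu> by (simp add: field_simps)
  define Y where "Y = X powr (1 / (1 + \<nu>)) * l"
  have Y0: "Y > 0" using X l by (simp add: Y_def)
  have lp: "l \<le> l powr ?p" using powr_mono[OF p1 l] l by simp
  have "Y \<le> X powr ?s * l powr ?p"
    unfolding Y_def using X l s1 lp by (intro mult_mono powr_mono) auto
  then have "?c * Y \<le> ?c * (X powr ?s * l powr ?p)" using c by (intro mult_left_mono) auto
  then have NY: "?c * Y \<le> N" using N by linarith
  have "768 * gradient_const \<nu> * Y \<le> ?c * Y" using c Y0 by (intro mult_right_mono) auto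
  then show "768 * gradient_const \<nu> * X powr (1 / (1 + \<nu>)) * l \<le> N"
    using NY by (simp add: Y_def mult.assoc)
  have "1920 * X * l \<le> ?c powr (1 + \<nu>) * X * l powr (1 + \<nu>)"
  proof (intro mult_mono)
    have "?c \<le> ?c powr (1 + \<nu>)" using c powr_mono[of 1 "1 + \<nu>" ?c] \<nu> by simp
    then show "1920 \<le> ?c powr (1 + \<nu>)" using c by linarith
    show "l \<le> l powr (1 + \<nu>)" using l powr_mono[of 1 "1 + \<nu>" l] \<nu> by simp
  qed (use X l in auto)
  also have "\<dots> = (?c * Y) powr (1 + \<nu>)"
    using \<nu> X l c by (simp add: Y_def powr_mult powr_powr)
  also have "\<dots> \<le> N powr (1 + \<nu>)" using NY \<nu> c Y0 by (intro powr_mono2) auto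
  finally show "1920 * X * l \<le> N powr (1 + \<nu>)" .
  have q: "0 \<le> sstm_q \<nu>" using sstm_q_bounds \<nu> by auto
  have "1 + sstm_q \<nu> = (1 + 3 * \<nu>) / (1 + \<nu>)" using \<nu> by (simp add: sstm_q_def field_simps)
  moreover have "1 + 3 * \<nu> \<noteq> 0" using \<nu> by simp
  moreover have "2 / x * (x / y) = 2 / y" if "x \<noteq> 0" for x y :: real using that by simp
  ultimately have sq: "?s * (1 + sstm_q \<nu>) = 2 / (1 + \<nu>)" by metis
  have "?c powr 1 \<le> ?c powr (1 + sstm_q \<nu>)" using c q by (intro powr_mono) auto
  then have "256 \<le> ?c powr (1 + sstm_q \<nu>)" using c by simp
  then have "256 * X powr (2 / (1 + \<nu>)) \<le> ?c powr (1 + sstm_q \<nu>) * X powr (2 / (1 + \<nu>))"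
    by (intro mult_right_mono) auto
  also have "\<dots> = (?c * X powr ?s) powr (1 + sstm_q \<nu>)"
    using c X by (simp only: powr_mult powr_powr sq)
  finally have "256 * X powr (2 / (1 + \<nu>)) \<le> (?c * X powr ?s) powr (1 + sstm_q \<nu>)" .
  also have "\<dots> \<le> N powr (1 + sstm_q \<nu>)"
  proof (intro powr_mono2)
    have "?c * (X powr ?s * 1) \<le> ?c * (X powr ?s * l powr ?p)"
      using c l lp by (intro mult_left_mono) auto
    then show "?c * X powr ?s \<le> N" using N by simp
  qed (use q c in auto)
  finally show "256 * X powr (2 / (1 + \<nu>)) \<le> N powr (1 + sstm_q \<nu>)" .
qed

lemma sq_powr: "(x::real) > 0 \<Longrightarrow> (x\<^sup>2) powr y = x powr (2 * y)"
  by (simp add: powr_powr flip: powr_numeral)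

lemma half_powr_sq: "((x::real) powr (y / 2))\<^sup>2 = x powr y"
  by (simp add: power2_eq_square flip: powr_add)

text \<open>For \<open>\<nu> < 1\<close> the sum of the geometric series of the iteration numbers; for \<open>\<nu> = 1\<close> these numbers
  are of the same order, and the number of runs is bounded by the logarithm in \<open>D\<close> instead.\<close>

definition geometric_const :: "real \<Rightarrow> real" where
  "geometric_const \<nu> = (if \<nu> = 1 then 2 else 1 / (1 - 2 powr (- ((1 - \<nu>) / (1 + 3 * \<nu>)))))"

text \<open>The parameters of the restarted algorithm when something has to be done. The first of the last two conditions
  holds for every problem in question (\<open>strong_convexity_constant_le\<close>), the second says that the
  starting point is possibly no solution.\<close>

locale restart_choice =
  fixes \<nu> M R0 \<sigma> \<mu> \<epsilon> \<beta> :: real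
  assumes \<nu>: "0 \<le> \<nu>" "\<nu> \<le> 1" and M: "M > 0" and R0: "R0 > 0" and \<sigma>: "\<sigma> > 0" and \<mu>: "\<mu> > 0"
    and \<epsilon>: "\<epsilon> > 0" and \<beta>: "0 < \<beta>" "\<beta> < 1"
    and conditioned: "\<mu> * R0 powr (1 - \<nu>) \<le> M"
    and far: "\<epsilon> < M * R0 powr (1 + \<nu>)"
begin

text \<open>If the previous runs succeed, run \<open>t\<close> starts within distance \<open>Rs t\<close> of the minimizer; it aims at accuracy \<open>es t\<close>. The ratio \<open>X t\<close> of the
  Hoelder bound on the initial gap to this target determines its number of iterations, with exponents
  \<open>s\<close> and \<open>p\<close>. Expressed by the target alone, \<open>X t powr s\<close> is at most of
  order \<open>D2 (\<epsilon> / es t) powr r\<close>, where \<open>D2\<close> is the second term of \<open>D\<close>.\<close>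

definition "s = 2 / (1 + 3 * \<nu>)"
definition "p = 2 * (1 + \<nu>) / (1 + 3 * \<nu>)"
definition "r = (1 - \<nu>) / (1 + 3 * \<nu>)"
definition "D = complexity_D \<nu> M R0 \<mu> \<epsilon>"
definition "D2 = (M\<^sup>2 / (\<mu> powr (1 + \<nu>) * \<epsilon> powr (1 - \<nu>))) powr (1 / (1 + 3 * \<nu>))"
definition "L = log_factor D \<beta>"
definition "l = 2 * L"
definition "\<tau> = 1 + nat \<lceil>log 2 (\<mu> * R0\<^sup>2 / (4 * \<epsilon>))\<rceil>"
definition "Rs t = R0 / sqrt (2 ^ (t - 1))" for t :: nat
definition "es t = max \<epsilon> (\<mu> * (Rs t)\<^sup>2 / 4)" for t :: nat
definition "X t = M * Rs t powr (1 + \<nu>) / es t" for t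
definition "Ns t = nat \<lceil>iteration_const \<nu> * (X t powr s * l powr p)\<rceil>" for t
definition "as t = 4 * (Rs t)\<^sup>2 / (es t * real (Ns t) powr (1 + sstm_q \<nu>))" for t
definition "Bs t = Rs t / (12 * l)" for t
definition "ms t k = nat \<lceil>78 * real (Ns t) * (sstm_\<alpha> \<nu> (as t) (Suc k))\<^sup>2 * \<sigma>\<^sup>2 * l / (Rs t)\<^sup>2\<rceil>" for t k

lemma exponents: "0 < s" "s \<le> 2" "1 \<le> p" "p \<le> 2" "0 \<le> r" "r \<le> 1" "(1 - \<nu>) / 2 * s = r"
    "\<nu> < 1 \<Longrightarrow> r > 0"
  using \<nu> by (auto simp: s_def p_def r_def field_simps)

lemma L: "L \<ge> 1" by (simp add: L_def log_factor_def)
lemma l: "l \<ge> 1" using L by (simp add: l_def)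

lemma Rs_pos: "Rs t > 0" using R0 by (simp add: Rs_def)

lemma Rs_sq: "(Rs t)\<^sup>2 = R0\<^sup>2 / 2 ^ (t - 1)"
  by (simp add: Rs_def power_divide)

lemma Rs_le: "Rs t \<le> R0"
proof -
  have "1 \<le> sqrt (2 ^ (t - 1))" by simp
  then show ?thesis using R0 by (simp add: Rs_def field_simps mult_le_cancel_left1)
qed

lemma es_pos: "es t > 0" using \<epsilon> by (simp add: es_def)

lemma Rs_sq_le: "(Rs t)\<^sup>2 \<le> 4 * es t / \<mu>"
  using \<mu> by (simp add: es_def field_simps max_def)

lemma es_final: "es \<tau> = \<epsilon>"
proof -
  have "log 2 (\<mu> * R0\<^sup>2 / (4 * \<epsilon>)) \<le> real (\<tau> - 1)" unfolding \<tau>_def by simp linarith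
  then have "\<mu> * R0\<^sup>2 / (4 * \<epsilon>) \<le> 2 powr real (\<tau> - 1)"
    using \<mu> R0 \<epsilon> by (simp add: log_le_iff)
  then have "\<mu> * R0\<^sup>2 / (4 * \<epsilon>) \<le> 2 ^ (\<tau> - 1)" by (simp add: powr_realpow)
  then show ?thesis using \<epsilon> by (simp add: es_def Rs_sq field_simps max_def)
qed

lemma es_before: "t \<in> {1..<\<tau>} \<Longrightarrow> \<epsilon> < \<mu> * (Rs t)\<^sup>2 / 4"
proof -
  assume "t \<in> {1..<\<tau>}"
  then have "t - 1 < nat \<lceil>log 2 (\<mu> * R0\<^sup>2 / (4 * \<epsilon>))\<rceil>" by (auto simp: \<tau>_def)
  then have "real (t - 1) < log 2 (\<mu> * R0\<^sup>2 / (4 * \<epsilon>))" by linarith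
  then have "2 powr real (t - 1) < \<mu> * R0\<^sup>2 / (4 * \<epsilon>)"
    using \<mu> R0 \<epsilon> by (simp add: less_log_iff)
  then have "2 ^ (t - 1) < \<mu> * R0\<^sup>2 / (4 * \<epsilon>)" by (simp add: powr_realpow)
  then show ?thesis using \<epsilon> by (simp add: Rs_sq field_simps)
qed

text \<open>Before the last run the targets halve and stay above \<open>\<epsilon>\<close>. The last target is \<open>\<epsilon>\<close> itself and need
  not be half of the previous one, which costs the factor \<open>2\<close>.\<close>

lemma es_growth:
  assumes "t \<in> {1..\<tau>}"
  shows "\<epsilon> * 2 ^ (\<tau> - t) / 2 \<le> es t"
proof (cases "t = \<tau>")
  case False
  then have t: "t \<in> {1..<\<tau>}" using assms by auto
  then have t1: "\<tau> - 1 \<in> {1..<\<tau>}" by auto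
  have "(2::real) ^ (\<tau> - 1 - 1) = 2 ^ (\<tau> - t - 1) * 2 ^ (t - 1)"
    using t by (simp flip: power_add)
  then have "\<mu> * (Rs t)\<^sup>2 / 4 = 2 ^ (\<tau> - t - 1) * (\<mu> * (Rs (\<tau> - 1))\<^sup>2 / 4)"
    by (simp add: Rs_sq)
  also have "\<dots> \<ge> 2 ^ (\<tau> - t - 1) * \<epsilon>" using es_before[OF t1] by (intro mult_left_mono) auto
  finally have "2 ^ (\<tau> - t - 1) * \<epsilon> \<le> es t" by (simp add: es_def)
  moreover have "(2::real) ^ (\<tau> - t) = 2 * 2 ^ (\<tau> - t - 1)"
    using t power_eq_if[of "2::real" "\<tau> - t"] by simp
  ultimately show ?thesis by (simp add: mult.commute)
qed (use es_final \<epsilon> in simp)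

text \<open>For \<open>\<epsilon> \<le> \<mu> R\<^sub>0\<^sup>2\<close> this follows from the condition number being at least \<open>1\<close>, for larger \<open>\<epsilon>\<close> from the
  starting point not being known as a solution.\<close>

lemma D2_ge_1: "D2 \<ge> 1"
proof -
  have "\<mu> powr (1 + \<nu>) * \<epsilon> powr (1 - \<nu>) \<le> M\<^sup>2"
  proof (cases "\<epsilon> \<le> \<mu> * R0\<^sup>2")
    case True
    have "\<mu> powr (1 + \<nu>) * \<epsilon> powr (1 - \<nu>) \<le> \<mu> powr (1 + \<nu>) * (\<mu> * R0\<^sup>2) powr (1 - \<nu>)"
      using True \<nu> \<epsilon> by (intro mult_left_mono powr_mono2) auto
    also have "\<dots> = (\<mu> * R0 powr (1 - \<nu>))\<^sup>2"
    proof -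
      have "\<mu> powr (1 + \<nu>) * \<mu> powr (1 - \<nu>) = \<mu>\<^sup>2" using \<mu> by (simp flip: powr_add)
      moreover have "(R0\<^sup>2) powr (1 - \<nu>) = (R0 powr (1 - \<nu>))\<^sup>2"
        using R0 by (simp add: power2_eq_square powr_mult)
      ultimately show ?thesis using \<mu> R0 by (simp add: powr_mult power_mult_distrib)
    qed
    also have "\<dots> \<le> M\<^sup>2" using conditioned \<mu> by (intro power_mono) auto
    finally show ?thesis .
  next
    case False
    have "\<mu> powr (1 + \<nu>) * \<epsilon> powr (1 - \<nu>) \<le> (\<epsilon> / R0\<^sup>2) powr (1 + \<nu>) * \<epsilon> powr (1 - \<nu>)"
      using False \<mu> \<nu> R0 by (intro mult_right_mono powr_mono2) (auto simp: field_simps)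
    also have "\<dots> = (\<epsilon> / R0 powr (1 + \<nu>))\<^sup>2"
    proof -
      have "\<epsilon> powr (1 + \<nu>) * \<epsilon> powr (1 - \<nu>) = \<epsilon>\<^sup>2" using \<epsilon> by (simp flip: powr_add)
      moreover have "(R0\<^sup>2) powr (1 + \<nu>) = (R0 powr (1 + \<nu>))\<^sup>2"
        using R0 by (simp add: power2_eq_square powr_mult)
      ultimately show ?thesis using \<epsilon> R0 by (simp add: powr_divide power_divide)
    qed
    also have "\<dots> \<le> M\<^sup>2" using far R0 \<epsilon> by (intro power_mono) (auto simp: field_simps)
    finally show ?thesis .
  qed
  then have "1 \<le> M\<^sup>2 / (\<mu> powr (1 + \<nu>) * \<epsilon> powr (1 - \<nu>))" using \<mu> \<epsilon> by (simp add: field_simps)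
  then show ?thesis unfolding D2_def using \<nu> by (intro ge_one_powr_ge_zero) auto
qed

lemma D_ge: "D2 \<le> D" "(M / (\<mu> * R0 powr (1 - \<nu>))) powr s * ln (\<mu> * R0\<^sup>2 / \<epsilon>) \<le> D"
  by (auto simp: D_def D2_def complexity_D_def s_def)

lemma D_ge_1: "D \<ge> 1" using D2_ge_1 D_ge by linarith

text \<open>The first run and the rounding add \<open>2\<close> to the logarithm, which \<open>log 2 4 = 2\<close> compensates.\<close>

lemma restarts_le_log:
  assumes "\<tau> \<noteq> 1" shows "real \<tau> \<le> 2 * ln (\<mu> * R0\<^sup>2 / \<epsilon>)"
proof -
  let ?x = "\<mu> * R0\<^sup>2 / \<epsilon>"
  have x0: "?x > 0" using \<mu> R0 \<epsilon> by simp
  have "log 2 (y / 4) = log 2 y - 2" if "y > 0" for y :: real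
    using that ln_realpow[of 2 2] by (simp add: log_def ln_div diff_divide_distrib)
  from this[OF x0] have eq: "log 2 (\<mu> * R0\<^sup>2 / (4 * \<epsilon>)) = log 2 ?x - 2"
    by (simp add: mult.commute)
  have "real \<tau> \<le> log 2 ?x" using assms unfolding \<tau>_def eq by linarith
  moreover have "log 2 ?x \<ge> 0"
    using assms unfolding \<tau>_def eq by linarith
  then have "ln ?x \<ge> 0" by (simp add: log_def zero_le_divide_iff)
  moreover have "ln (2::real) \<ge> 1 / 2" using ln2_ge_two_thirds by simp
  then have "ln ?x / ln 2 \<le> ln ?x / (1 / 2)"
    using \<open>ln ?x \<ge> 0\<close> by (intro divide_left_mono) auto
  ultimately show ?thesis by (simp add: log_def)
qed

lemma kappa: "M / (\<mu> * R0 powr (1 - \<nu>)) \<ge> 1"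
  using conditioned \<mu> R0 by (simp add: field_simps)

lemma restarts_le: "real \<tau> \<le> 2 * D"
proof (cases "\<tau> = 1")
  case False
  have "1 * ln (\<mu> * R0\<^sup>2 / \<epsilon>) \<le> (M / (\<mu> * R0 powr (1 - \<nu>))) powr s * ln (\<mu> * R0\<^sup>2 / \<epsilon>)"
    using restarts_le_log[OF False] kappa exponents
    by (intro mult_right_mono ge_one_powr_ge_zero) auto
  then show ?thesis using restarts_le_log[OF False] D_ge(2) by linarith
qed (use D_ge_1 in simp)

text \<open>The factor \<open>2\<close> in \<open>l = 2 L\<close> absorbs the \<open>ln 2\<close> from \<open>\<tau> \<le> 2 D\<close>.\<close>

lemma failure_budget: "real \<tau> * exp (- l) \<le> \<beta>"
proof -
  have "ln (2 * D / \<beta>) = ln 2 + ln (D / \<beta>)" using D_ge_1 \<beta> by (simp add: ln_div ln_mult)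
  also have "\<dots> \<le> 1 + L" using ln_2_less_1 by (simp add: L_def log_factor_def)
  also have "\<dots> \<le> l" using L by (simp add: l_def)
  finally have "2 * D / \<beta> \<le> exp l" using D_ge_1 \<beta> by (metis exp_le_cancel_iff exp_ln divide_pos_pos mult_pos_pos
        less_le_trans zero_less_numeral zero_less_one)
  then have "2 * D * exp (- l) \<le> \<beta>" using \<beta> by (simp add: exp_minus field_simps)
  moreover have "real \<tau> * exp (- l) \<le> 2 * D * exp (- l)" using restarts_le by (intro mult_right_mono) auto
  ultimately show ?thesis by linarith
qed

text \<open>If the target is at most \<open>\<mu> R\<^sub>t\<^sup>2\<close>, this is the bound on the condition number. A larger target occurs only
  in the first run, and then it is \<open>\<epsilon>\<close>.\<close>

lemma X_ge_1:
  assumes t: "t \<in> {1..\<tau>}" shows "X t \<ge> 1"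
proof -
  have "es t \<le> M * Rs t powr (1 + \<nu>)"
  proof (cases "es t \<le> \<mu> * (Rs t)\<^sup>2")
    case True
    have "\<mu> * (Rs t)\<^sup>2 = \<mu> * Rs t powr (1 - \<nu>) * Rs t powr (1 + \<nu>)"
      using Rs_pos[of t] by (simp flip: powr_add)
    also have "\<dots> \<le> \<mu> * R0 powr (1 - \<nu>) * Rs t powr (1 + \<nu>)"
      using Rs_le[of t] Rs_pos[of t] \<mu> \<nu> by (intro mult_right_mono mult_left_mono powr_mono2) auto
    also have "\<dots> \<le> M * Rs t powr (1 + \<nu>)" using conditioned by (intro mult_right_mono) auto
    finally show ?thesis using True by simp
  next
    case False
    have "t = 1"
    proof (rule ccontr)
      assume "t \<noteq> 1"
      then have "t - 1 \<in> {1..<\<tau>}" using t by auto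
      from es_before[OF this] have "\<epsilon> < \<mu> * (Rs (t - 1))\<^sup>2 / 4" .
      moreover have "(Rs (t - 1))\<^sup>2 = 2 * (Rs t)\<^sup>2"
      proof -
        have "(2::real) ^ (t - 1) = 2 * 2 ^ (t - 1 - 1)"
          using \<open>t - 1 \<in> {1..<\<tau>}\<close> power_eq_if[of "2::real" "t - 1"] by auto
        then show ?thesis by (simp add: Rs_sq)
      qed
      ultimately have "\<epsilon> \<le> \<mu> * (Rs t)\<^sup>2"
        using \<mu> by (simp add: add_nonneg_nonneg field_simps) (smt (verit) mult_nonneg_nonneg zero_le_power2)
      then have "es t \<le> \<mu> * (Rs t)\<^sup>2" using \<mu> by (simp add: es_def)
      then show False using False by simp
    qed
    moreover have "es t = \<epsilon>"
    proof -
      have "\<mu> * (Rs t)\<^sup>2 / 4 \<le> \<mu> * (Rs t)\<^sup>2" using \<mu> by simp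
      then show ?thesis using False by (auto simp: es_def max_def split: if_splits)
    qed
    ultimately show ?thesis using far by (simp add: Rs_def)
  qed
  then show ?thesis using es_pos[of t] by (simp add: X_def)
qed

text \<open>Replacing \<open>R\<^sub>t\<^sup>2\<close> by its bound \<open>4 e\<^sub>t / \<mu>\<close> gives, up to a constant, the second term of \<open>D\<close> with
  \<open>e\<^sub>t\<close> in place of \<open>\<epsilon>\<close>.\<close>

lemma X_powr_le:
  assumes t: "t \<in> {1..\<tau>}" shows "X t powr s \<le> 32 * D2 * (2 powr (- r)) ^ (\<tau> - t)"
proof -
  have e: "es t > 0" by (rule es_pos)
  have "Rs t powr (1 + \<nu>) = ((Rs t)\<^sup>2) powr ((1 + \<nu>) / 2)"
    using sq_powr[OF Rs_pos[of t], of "(1 + \<nu>) / 2"] by (simp only: mult_2 field_sum_of_halves)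
  also have "\<dots> \<le> (4 * es t / \<mu>) powr ((1 + \<nu>) / 2)"
    using Rs_sq_le \<nu> by (intro powr_mono2) auto
  finally have "X t \<le> M * (4 * es t / \<mu>) powr ((1 + \<nu>) / 2) / es t"
    unfolding X_def using M e by (intro divide_right_mono mult_left_mono) auto
  also have "\<dots> = 4 powr ((1 + \<nu>) / 2) * (M / (\<mu> powr ((1 + \<nu>) / 2) * es t powr ((1 - \<nu>) / 2)))"
  proof -
    have "es t = es t powr ((1 + \<nu>) / 2) * es t powr ((1 - \<nu>) / 2)"
      using e by (simp flip: powr_add add_divide_distrib)
    then have "(4 * es t / \<mu>) powr ((1 + \<nu>) / 2) / es t
        = 4 powr ((1 + \<nu>) / 2) / (\<mu> powr ((1 + \<nu>) / 2) * es t powr ((1 - \<nu>) / 2))"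
      using e \<mu> by (simp add: powr_mult powr_divide divide_simps)
    moreover have "M * u / v = c * (M / d)" if "u / v = c / d" for u v c d :: real
    proof -
      have "M * u / v = M * (u / v)" by simp
      then show ?thesis unfolding that by simp
    qed
    ultimately show ?thesis by blast
  qed
  finally have "X t \<le> 4 powr ((1 + \<nu>) / 2) * (M / (\<mu> powr ((1 + \<nu>) / 2) * es t powr ((1 - \<nu>) / 2)))" .
  then have "X t powr s \<le> (4 powr ((1 + \<nu>) / 2) * (M / (\<mu> powr ((1 + \<nu>) / 2) * es t powr ((1 - \<nu>) / 2)))) powr s"
    using X_ge_1[OF t] exponents by (intro powr_mono2) auto
  also have "\<dots> = 4 powr ((1 + \<nu>) / 2 * s) * (M / (\<mu> powr ((1 + \<nu>) / 2) * \<epsilon> powr ((1 - \<nu>) / 2))) powr s * (\<epsilon> / es t) powr r"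
    using M \<mu> e \<epsilon> exponents(7)
    by (simp add: powr_mult powr_divide powr_powr)
  also have "(M / (\<mu> powr ((1 + \<nu>) / 2) * \<epsilon> powr ((1 - \<nu>) / 2))) powr s = D2"
  proof -
    have "D2 = ((M / (\<mu> powr ((1 + \<nu>) / 2) * \<epsilon> powr ((1 - \<nu>) / 2)))\<^sup>2) powr (1 / (1 + 3 * \<nu>))"
      unfolding D2_def using \<mu> \<epsilon>
      by (simp only: power_divide power_mult_distrib half_powr_sq)
    also have "\<dots> = (M / (\<mu> powr ((1 + \<nu>) / 2) * \<epsilon> powr ((1 - \<nu>) / 2))) powr s"
      using M \<mu> \<epsilon> by (subst sq_powr) (auto simp: s_def)
    finally show ?thesis by simp
  qed
  also have "4 powr ((1 + \<nu>) / 2 * s) * D2 * (\<epsilon> / es t) powr r \<le> 16 * D2 * (2 * (2 powr (- r)) ^ (\<tau> - t))"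
  proof (intro mult_mono)
    have "(1 + \<nu>) / 2 * s \<le> 1 * 2" using \<nu> exponents by (intro mult_mono) auto
    then have "4 powr ((1 + \<nu>) / 2 * s) \<le> (4::real) powr 2" by (intro powr_mono) auto
    then show "4 powr ((1 + \<nu>) / 2 * s) \<le> (16::real)" by simp
    have "\<epsilon> / es t \<le> 2 / 2 ^ (\<tau> - t)"
      using es_growth[OF t] e by (simp add: field_simps)
    then have "(\<epsilon> / es t) powr r \<le> (2 / 2 ^ (\<tau> - t)) powr r"
      using \<epsilon> e exponents by (intro powr_mono2) auto
    also have "\<dots> = 2 powr r * (2 powr (- r)) ^ (\<tau> - t)"
    proof -
      have "(2 / 2 ^ k) powr r = 2 powr r * (2 powr (- r)) ^ k" for k :: nat
      proof -
        have "(2::real) / 2 ^ k = 2 powr (1 - real k)" by (simp add: powr_diff powr_realpow)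
        moreover have "(2 powr (- r)) ^ k = 2 powr (- r * real k)"
          by (simp add: powr_powr flip: powr_realpow)
        ultimately show ?thesis by (simp add: powr_powr algebra_simps flip: powr_add)
      qed
      then show ?thesis .
    qed
    also have "\<dots> \<le> 2 powr 1 * (2 powr (- r)) ^ (\<tau> - t)"
      using exponents by (intro mult_right_mono powr_mono) auto
    finally show "(\<epsilon> / es t) powr r \<le> 2 * (2 powr (- r)) ^ (\<tau> - t)" by simp
  qed (use D2_ge_1 in auto)
  finally show ?thesis by (simp add: mult_ac)
qed

lemma N_bounds:
  assumes t: "t \<in> {1..\<tau>}"
  shows "iteration_const \<nu> * (X t powr s * l powr p) \<le> real (Ns t)"
    and "real (Ns t) \<le> (iteration_const \<nu> + 1) * (X t powr s * l powr p)" and "Ns t \<ge> 1"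
proof -
  let ?Z = "X t powr s * l powr p"
  have Z: "1 \<le> ?Z"
    using X_ge_1[OF t] l exponents mult_mono[of 1 "X t powr s" 1 "l powr p"]
    by (simp add: ge_one_powr_ge_zero)
  have c: "iteration_const \<nu> \<ge> 1920" by (simp add: iteration_const_def)
  show lower: "iteration_const \<nu> * ?Z \<le> real (Ns t)" unfolding Ns_def by (rule real_nat_ceiling_ge)
  have "iteration_const \<nu> * ?Z \<ge> 0" using c Z by simp
  then have "real (Ns t) \<le> iteration_const \<nu> * ?Z + 1" unfolding Ns_def by linarith
  then show "real (Ns t) \<le> (iteration_const \<nu> + 1) * ?Z" using Z by (simp add: distrib_right)
  have "1 * 1 \<le> iteration_const \<nu> * ?Z" using c Z by (intro mult_mono) auto
  then show "Ns t \<ge> 1" using lower by linarith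
qed

lemma schedule:
  assumes t: "t \<in> {1..\<tau>}"
  shows "sstm_schedule \<nu> M (Rs t) (es t) l (as t) (Bs t) (Ns t)"
proof
  note suff = iteration_number_suffices[OF \<nu> X_ge_1[OF t] l N_bounds(1)[OF t, unfolded s_def p_def]]
  show "256 * (M * Rs t powr (1 + \<nu>) / es t) powr (2 / (1 + \<nu>)) \<le> real (Ns t) powr (1 + sstm_q \<nu>)"
    and "1920 * (M * Rs t powr (1 + \<nu>) / es t) * l \<le> real (Ns t) powr (1 + \<nu>)"
    and "768 * gradient_const \<nu> * (M * Rs t powr (1 + \<nu>) / es t) powr (1 / (1 + \<nu>)) * l \<le> real (Ns t)"
    using suff unfolding X_def by auto
qed (use \<nu> M Rs_pos es_pos l N_bounds(3)[OF t] in \<open>auto simp: as_def Bs_def\<close>)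

lemma batch_pos: "t \<in> {1..\<tau>} \<Longrightarrow> ms t k \<ge> 1"
proof -
  assume t: "t \<in> {1..\<tau>}"
  interpret sched: sstm_schedule \<nu> M "Rs t" "es t" l "as t" "Bs t" "Ns t" using schedule[OF t] .
  have "0 < 78 * real (Ns t) * (sstm_\<alpha> \<nu> (as t) (Suc k))\<^sup>2 * \<sigma>\<^sup>2 * l / (Rs t)\<^sup>2"
    using sched.N_pos sched.a_pos \<sigma> l Rs_pos[of t] by simp
  then show ?thesis unfolding ms_def by linarith
qed

text \<open>Rounding up costs at most \<open>1\<close> per iteration. The rest is bounded by replacing the index of the
  iteration by \<open>N\<close>, after which \<open>a N\<^sup>1\<^sup>+\<^sup>q\<close> appears, which is \<open>4 R\<^sup>2 / e\<close> by the choice of \<open>a\<close>.\<close>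

lemma batch_sum:
  assumes t: "t \<in> {1..\<tau>}"
  shows "real (\<Sum>k<Ns t. ms t k) \<le> real (Ns t) + 4992 * \<sigma>\<^sup>2 * l / (\<mu> * es t)"
proof -
  interpret sched: sstm_schedule \<nu> M "Rs t" "es t" l "as t" "Bs t" "Ns t" using schedule[OF t] .
  let ?N = "real (Ns t)" and ?q = "sstm_q \<nu>" and ?R = "Rs t" and ?a = "as t"
  have q: "0 \<le> ?q" using sched.q by simp
  define b where "b = 78 * ?N * (?a * ?N powr ?q)\<^sup>2 * \<sigma>\<^sup>2 * l / ?R\<^sup>2"
  have m: "real (ms t k) \<le> b + 1" if k: "k < Ns t" for k
  proof -
    have "0 \<le> 78 * ?N * (sstm_\<alpha> \<nu> ?a (Suc k))\<^sup>2 * \<sigma>\<^sup>2 * l / ?R\<^sup>2" using l by simp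
    then have "real (ms t k) \<le> 78 * ?N * (sstm_\<alpha> \<nu> ?a (Suc k))\<^sup>2 * \<sigma>\<^sup>2 * l / ?R\<^sup>2 + 1"
      unfolding ms_def by linarith
    moreover have "(sstm_\<alpha> \<nu> ?a (Suc k))\<^sup>2 \<le> (?a * ?N powr ?q)\<^sup>2"
      unfolding sstm_\<alpha>_Suc using k q sched.a_pos
      by (intro power_mono mult_left_mono powr_mono2) auto
    then have "78 * ?N * (sstm_\<alpha> \<nu> ?a (Suc k))\<^sup>2 * \<sigma>\<^sup>2 * l / ?R\<^sup>2 \<le> b"
      unfolding b_def using l by (intro divide_right_mono mult_right_mono mult_left_mono) auto
    ultimately show ?thesis by linarith
  qed
  have "real (\<Sum>k<Ns t. ms t k) \<le> (\<Sum>k<Ns t. b + 1)"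
    unfolding of_nat_sum using m by (intro sum_mono) simp
  also have "\<dots> = ?N + ?N * b" by (simp add: algebra_simps)
  also have "?N * b = 78 * (?a * ?N powr (1 + ?q))\<^sup>2 * \<sigma>\<^sup>2 * l / ?R\<^sup>2"
    using sched.N_pos by (simp add: b_def powr_add power2_eq_square mult_ac)
  also have "?a * ?N powr (1 + ?q) = 4 * ?R\<^sup>2 / es t"
    using sched.N_pos es_pos[of t] by (simp add: as_def)
  also have "78 * (4 * ?R\<^sup>2 / es t)\<^sup>2 * \<sigma>\<^sup>2 * l / ?R\<^sup>2 = 1248 * \<sigma>\<^sup>2 * l / (es t)\<^sup>2 * ?R\<^sup>2"
    using Rs_pos[of t] by (simp add: power2_eq_square)
  also have "\<dots> \<le> 1248 * \<sigma>\<^sup>2 * l / (es t)\<^sup>2 * (4 * es t / \<mu>)"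
    using Rs_sq_le l by (intro mult_left_mono) auto
  also have "\<dots> = 4992 * \<sigma>\<^sup>2 * l / (\<mu> * es t)"
    using es_pos[of t] \<mu> by (simp add: power2_eq_square mult_ac)
  finally show ?thesis by simp
qed

lemma run_if_problem:
  assumes prob: "sstm_problem n \<nu> M f G xs (3 * R0) P g \<sigma>" and t: "t \<in> {1..\<tau>}"
  shows "sstm_run n \<nu> M f G xs (3 * R0) P g \<sigma> (Rs t) (es t) l (as t) (Bs t) (Ns t) (ms t)"
proof (rule sstm_run.intro[OF prob schedule[OF t]])
  show "sstm_run_axioms \<nu> (3 * R0) \<sigma> (Rs t) l (as t) (Ns t) (ms t)"
  proof
    show "3 * Rs t \<le> 3 * R0" using Rs_le by simp
    show "1 \<le> ms t k" for k using batch_pos[OF t] .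
    show "78 * real (Ns t) * (sstm_\<alpha> \<nu> (as t) (Suc k))\<^sup>2 * \<sigma>\<^sup>2 * l / (Rs t)\<^sup>2 \<le> real (ms t k)" for k
      unfolding ms_def by (rule real_nat_ceiling_ge)
  qed
qed

lemma sum_restarts_reverse: "(\<Sum>t=1..\<tau>. h (\<tau> - t)) = (\<Sum>i<\<tau>. h i)" for h :: "nat \<Rightarrow> real"
  using sum.nat_diff_reindex[of h \<tau>] by (simp add: sum.atLeast1_atMost_eq)

text \<open>For \<open>\<nu> = 1\<close> the second term of \<open>D\<close> is the factor of the logarithm in the first one, and the number of
  restarts is bounded by this logarithm.\<close>

lemma geometric_sum: "D2 * (\<Sum>t=1..\<tau>. (2 powr (- r)) ^ (\<tau> - t)) \<le> geometric_const \<nu> * D"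
proof (cases "\<nu> = 1")
  case True
  have r: "r = 0" unfolding r_def using True by simp
  have "D2 = (M / (\<mu> * R0 powr (1 - \<nu>))) powr s"
  proof -
    have "D2 = ((M / \<mu>)\<^sup>2) powr (1 / 4)"
      unfolding D2_def using True \<mu> \<epsilon> by (simp add: power_divide)
    also have "\<dots> = (M / \<mu>) powr (1 / 2)" using M \<mu> by (subst sq_powr) auto
    finally show ?thesis unfolding s_def using True R0 by simp
  qed
  note D2 = this
  have "D2 * real \<tau> \<le> 2 * D"
  proof (cases "\<tau> = 1")
    case True then show ?thesis using D_ge(1) D2_ge_1 by simp
  next
    case False
    have "D2 * real \<tau> \<le> D2 * (2 * ln (\<mu> * R0\<^sup>2 / \<epsilon>))"
      using restarts_le_log[OF False] D2_ge_1 by (intro mult_left_mono) auto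
    also have "\<dots> \<le> 2 * D" using D_ge(2) unfolding D2 by simp
    finally show ?thesis .
  qed
  moreover have "(\<Sum>t=1..\<tau>. (2 powr (- r)) ^ (\<tau> - t)) = real \<tau>" by (simp add: r)
  moreover have "geometric_const \<nu> = 2" using True by (simp add: geometric_const_def)
  ultimately show ?thesis by (simp only:)
next
  case False
  define x where "x = (2::real) powr (- r)"
  have x: "0 < x" "x < 1" using exponents(8) False \<nu> by (auto simp: x_def powr_less_one)
  have "(\<Sum>t=1..\<tau>. x ^ (\<tau> - t)) = (1 - x ^ \<tau>) / (1 - x)"
    unfolding sum_restarts_reverse[of "\<lambda>i. x ^ i"] sum_gp_strict using x by simp
  also have "\<dots> \<le> 1 / (1 - x)" using x by (intro divide_right_mono) auto
  finally have "D2 * (\<Sum>t=1..\<tau>. x ^ (\<tau> - t)) \<le> D * (1 / (1 - x))"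
    using D_ge(1) D2_ge_1 x by (intro mult_mono sum_nonneg) auto
  then show ?thesis using False by (simp add: geometric_const_def x_def r_def)
qed

lemma total_iterations_le:
  "real (total_iterations \<tau> Ns) \<le> 128 * (iteration_const \<nu> + 1) * geometric_const \<nu> * (D * L powr p)"
proof -
  define c where "c = iteration_const \<nu> + 1"
  have c: "c \<ge> 0" by (simp add: c_def iteration_const_def)
  have "real (Ns t) \<le> c * (32 * D2 * (2 powr (- r)) ^ (\<tau> - t) * l powr p)" if t: "t \<in> {1..\<tau>}" for t
    using N_bounds(2)[OF t, folded c_def] mult_left_mono[OF mult_right_mono[OF X_powr_le[OF t]] c, of "l powr p"]
    by fastforce
  then have "real (total_iterations \<tau> Ns) \<le> (\<Sum>t=1..\<tau>. c * (32 * D2 * (2 powr (- r)) ^ (\<tau> - t) * l powr p))"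
    unfolding total_iterations_def of_nat_sum by (intro sum_mono) auto
  also have "\<dots> = 32 * c * l powr p * (D2 * (\<Sum>t=1..\<tau>. (2 powr (- r)) ^ (\<tau> - t)))"
    by (simp add: sum_distrib_left mult_ac)
  also have "\<dots> \<le> 32 * c * (4 * L powr p) * (geometric_const \<nu> * D)"
  proof (intro mult_mono[OF _ geometric_sum] mult_left_mono)
    have "l powr p = 2 powr p * L powr p" using L by (simp add: l_def powr_mult)
    also have "\<dots> \<le> 2 powr 2 * L powr p" using exponents by (intro mult_right_mono powr_mono) auto
    finally show "l powr p \<le> 4 * L powr p" by simp
    show "0 \<le> D2 * (\<Sum>t=1..\<tau>. (2 powr (- r)) ^ (\<tau> - t))" using D2_ge_1 by (intro mult_nonneg_nonneg sum_nonneg) auto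
  qed (use c in auto)
  finally show ?thesis unfolding c_def[symmetric] by (simp add: mult_ac)
qed

lemma oracle_calls_le:
  "real (oracle_calls \<tau> Ns ms)
    \<le> 128 * (iteration_const \<nu> + 1) * geometric_const \<nu> * (D * L powr p) + 39936 * (\<sigma>\<^sup>2 / (\<mu> * \<epsilon>) * L)"
proof -
  have inv: "1 / es t \<le> 2 / \<epsilon> * (1 / 2) ^ (\<tau> - t)" if t: "t \<in> {1..\<tau>}" for t
    using es_growth[OF t] es_pos[of t] \<epsilon> by (simp add: power_one_over field_simps)
  have "real (oracle_calls \<tau> Ns ms) \<le> (\<Sum>t=1..\<tau>. real (Ns t) + 4992 * \<sigma>\<^sup>2 * l / \<mu> * (2 / \<epsilon> * (1 / 2) ^ (\<tau> - t)))"
  proof -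
    have "real (\<Sum>k<Ns t. ms t k) \<le> real (Ns t) + 4992 * \<sigma>\<^sup>2 * l / \<mu> * (2 / \<epsilon> * (1 / 2) ^ (\<tau> - t))"
      if t: "t \<in> {1..\<tau>}" for t
    proof -
      have "4992 * \<sigma>\<^sup>2 * l / (\<mu> * es t) = 4992 * \<sigma>\<^sup>2 * l / \<mu> * (1 / es t)" by simp
      also have "\<dots> \<le> 4992 * \<sigma>\<^sup>2 * l / \<mu> * (2 / \<epsilon> * (1 / 2) ^ (\<tau> - t))"
        using inv[OF t] l \<mu> by (intro mult_left_mono) auto
      finally show ?thesis using batch_sum[OF t] by linarith
    qed
    then show ?thesis unfolding oracle_calls_def of_nat_sum[of _ "{1..\<tau>}"] by (intro sum_mono) auto
  qed
  also have "\<dots> = real (total_iterations \<tau> Ns)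
      + 9984 * \<sigma>\<^sup>2 * l / (\<mu> * \<epsilon>) * (\<Sum>t=1..\<tau>. (1 / 2) ^ (\<tau> - t))"
  proof -
    have "4992 * \<sigma>\<^sup>2 * l / \<mu> * (2 / \<epsilon> * h) = 9984 * \<sigma>\<^sup>2 * l / (\<mu> * \<epsilon>) * h" for h by simp
    then show ?thesis by (simp only: total_iterations_def of_nat_sum sum.distrib sum_distrib_left)
  qed
  also have "\<dots> \<le> real (total_iterations \<tau> Ns) + 9984 * \<sigma>\<^sup>2 * l / (\<mu> * \<epsilon>) * 2"
  proof (intro add_left_mono mult_left_mono)
    have "(\<Sum>t=1..\<tau>. (1 / 2 :: real) ^ (\<tau> - t)) = (1 - (1 / 2) ^ \<tau>) / (1 - 1 / 2)"
      by (simp only: sum_restarts_reverse[of "\<lambda>i. (1 / 2) ^ i"] sum_gp_strict) simp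
    also have "\<dots> \<le> 2" by simp
    finally show "(\<Sum>t=1..\<tau>. (1 / 2 :: real) ^ (\<tau> - t)) \<le> 2" .
  qed (use l \<mu> \<epsilon> in auto)
  also have "9984 * \<sigma>\<^sup>2 * l / (\<mu> * \<epsilon>) * 2 = 39936 * (\<sigma>\<^sup>2 / (\<mu> * \<epsilon>) * L)" by (simp add: l_def)
  finally show ?thesis using total_iterations_le by linarith
qed

end

section \<open>The theorem\<close>

lemma has_all_subgradients_if_strongly_convex:
  assumes "strongly_convex n \<mu> f G" "\<mu> \<ge> 0" "x \<in> Rn n"
  shows "is_subgradient n f (G x) x"
  unfolding is_subgradient_def
proof
  fix y assume "y \<in> Rn n"
  then have "f y \<ge> f x + inner_Rn n (G x) (\<lambda>i. y i - x i) + \<mu> / 2 * (dist_Rn n y x)\<^sup>2"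
    using assms by (simp add: strongly_convex_def)
  moreover have "\<mu> / 2 * (dist_Rn n y x)\<^sup>2 \<ge> 0" using assms(2) by simp
  ultimately show "f y \<ge> f x + inner_Rn n (G x) (\<lambda>i. y i - x i)" by linarith
qed

lemma problem_if_smooth_strongly_convex:
  assumes \<nu>: "0 \<le> \<nu>" "\<nu> \<le> 1" and M: "M > 0" and \<mu>: "\<mu> > 0" and rad: "rad \<ge> 0"
    and xs: "minimizer n f xs" and G: "gradient_map n \<nu> f xs G" and conv: "strongly_convex n \<mu> f G"
    and P: "prob_space P" and noise: "stochastic_oracle n P g G (cball_Rn n xs rad) \<sigma>"
    and smooth: "smoothness_conditions n \<nu> M f G xs (cball_Rn n xs rad)"
  shows "sstm_problem n \<nu> M f G xs rad P g \<sigma>"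
proof (rule sstm_problem.intro)
  show "is_subgradient n f (G x) x" if "x \<in> Rn n" for x
    using has_all_subgradients_if_strongly_convex[OF conv _ that] \<mu> by simp
  show "xs \<in> Rn n" using xs by (simp add: minimizer_def)
  show min: "f xs \<le> f x" if "x \<in> Rn n" for x
    using xs that by (simp add: minimizer_def)
  show "dist_Rn n (G x) (G y) \<le> M * dist_Rn n x y powr \<nu>"
    if "x \<in> cball_Rn n xs rad" "y \<in> cball_Rn n xs rad" for x y
    using smooth that by (simp add: smoothness_conditions_def)
  have bound: "norm_Rn n (G x) \<le> (if \<nu> = 0 then M
       else ((1 + \<nu>) / \<nu>) powr (\<nu> / (1 + \<nu>)) * M powr (1 / (1 + \<nu>)) * (f x - f xs) powr (\<nu> / (1 + \<nu>)))"
    if "x \<in> cball_Rn n xs rad" for x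
    using smooth that unfolding smoothness_conditions_def by blast
  show "norm_Rn n (G x) \<le> gradient_const \<nu> * M powr (1 / (1 + \<nu>)) * h powr (\<nu> / (1 + \<nu>))"
    if x: "x \<in> cball_Rn n xs rad" and h: "h > 0" "f x - f xs \<le> h" for x h
  proof (cases "\<nu> = 0")
    case True
    then show ?thesis using bound[OF x] h M by (simp add: gradient_const_def)
  next
    case False
    have "f x - f xs \<ge> 0" using min[of x] x by (simp add: cball_Rn_def)
    then have "(f x - f xs) powr (\<nu> / (1 + \<nu>)) \<le> h powr (\<nu> / (1 + \<nu>))"
      using h(2) \<nu> by (intro powr_mono2) auto
    then have "((1 + \<nu>) / \<nu>) powr (\<nu> / (1 + \<nu>)) * M powr (1 / (1 + \<nu>)) * (f x - f xs) powr (\<nu> / (1 + \<nu>))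
        \<le> ((1 + \<nu>) / \<nu>) powr (\<nu> / (1 + \<nu>)) * M powr (1 / (1 + \<nu>)) * h powr (\<nu> / (1 + \<nu>))"
      by (intro mult_left_mono) auto
    then show ?thesis using bound[OF x] False by (simp add: gradient_const_def)
  qed
  have xs_ball: "xs \<in> cball_Rn n xs rad" using xs rad by (simp add: minimizer_def cball_Rn_def L2_set_def)
  show "norm_Rn n (G xs) = 0"
  proof (cases "\<nu> = 0")
    case True
    then show ?thesis using G by (simp add: gradient_map_def L2_set_def)
  next
    case False
    then show ?thesis using bound[OF xs_ball] L2_set_nonneg[of "G xs" "{..<n}"] by simp
  qed
qed (fact P \<nu> M noise)+

text \<open>Strong monotonicity of the gradient against its Hoelder continuity, along a segment of length
  \<open>d\<close> starting in the minimizer.\<close>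

lemma (in sstm_problem) strong_convexity_constant_le:
  assumes conv: "strongly_convex n \<mu> f G" and n: "n \<ge> 1" and d: "0 < d" "d \<le> rad"
  shows "\<mu> * d powr (1 - \<nu>) \<le> M"
proof -
  define x where "x = xs(0 := xs 0 + d)"
  have xR: "x \<in> Rn n" using xs n by (auto simp: x_def Rn_def PiE_def extensional_def)
  have dist: "dist_Rn n x xs = d"
  proof -
    have "(dist_Rn n x xs)\<^sup>2 = (\<Sum>i<n. if i = 0 then d\<^sup>2 else 0)"
      unfolding norm_Rn_sq_sum by (intro sum.cong) (auto simp: x_def)
    also have "\<dots> = d\<^sup>2" using n by simp
    finally show ?thesis using d by (simp add: power2_eq_iff_nonneg)
  qed
  have xQ: "x \<in> cball_Rn n xs rad" using xR dist d by (simp add: cball_Rn_def)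
  have xsQ: "xs \<in> cball_Rn n xs rad" using xs d by (simp add: cball_Rn_def L2_set_def)
  have dist': "dist_Rn n xs x = d" using dist norm_Rn_diff_commute[of xs x n] by simp
  have 1: "f x \<ge> f xs + inner_Rn n (G xs) (\<lambda>i. x i - xs i) + \<mu> / 2 * d\<^sup>2"
    using conv xs xR dist by (auto simp: strongly_convex_def)
  have 2: "f xs \<ge> f x + inner_Rn n (G x) (\<lambda>i. xs i - x i) + \<mu> / 2 * d\<^sup>2"
    using conv xs xR dist' by (auto simp: strongly_convex_def)
  have 3: "inner_Rn n (G xs) (\<lambda>i. x i - xs i) \<ge> 0"
    using abs_inner_Rn_le[of n "G xs" "\<lambda>i. x i - xs i"] gradient_xs by simp
  have "\<mu> * d\<^sup>2 \<le> - inner_Rn n (G x) (\<lambda>i. xs i - x i)" using 1 2 3 by linarith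
  also have "\<dots> \<le> norm_Rn n (G x) * d"
    using abs_inner_Rn_le[of n "G x" "\<lambda>i. xs i - x i"] dist' by simp
  also have "norm_Rn n (G x) \<le> M * d powr \<nu>"
    using norm_Rn_le_dist_add[of "G x" n "G xs"] hoelder[OF xQ xsQ] gradient_xs dist by simp
  finally have "\<mu> * d\<^sup>2 \<le> M * d powr \<nu> * d" using d by simp
  moreover have "d\<^sup>2 = d powr (1 - \<nu>) * (d powr \<nu> * d)"
    using d by (simp add: power2_eq_square flip: powr_add mult.assoc)
  ultimately have "\<mu> * d powr (1 - \<nu>) * (d powr \<nu> * d) \<le> M * (d powr \<nu> * d)" by (simp add: mult.assoc)
  then show ?thesis using d by (simp only: mult_le_cancel_right_pos mult_pos_pos powr_gt_zero)
qed

lemma (in sstm_problem) start_gap_le: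
  assumes x0: "x0 \<in> Rn n" "dist_Rn n x0 xs \<le> d" and d: "d \<le> rad"
  shows "f x0 - f xs \<le> M * d powr (1 + \<nu>)"
proof -
  have x0Q: "x0 \<in> cball_Rn n xs rad" using x0 d by (simp add: cball_Rn_def)
  have d0: "0 \<le> d" using x0(2) L2_set_nonneg order_trans by blast
  have xsQ: "xs \<in> cball_Rn n xs rad" using xs d d0 by (simp add: cball_Rn_def L2_set_def)
  have "f x0 \<le> f xs + inner_Rn n (G xs) (\<lambda>i. x0 i - xs i) + M * dist_Rn n x0 xs powr (1 + \<nu>)"
    using hoelder_upper_bound[OF xsQ x0Q] .
  moreover have "inner_Rn n (G xs) (\<lambda>i. x0 i - xs i) \<le> 0"
    using inner_Rn_le[of n "G xs" "\<lambda>i. x0 i - xs i"] gradient_xs by simp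
  moreover have "M * dist_Rn n x0 xs powr (1 + \<nu>) \<le> M * d powr (1 + \<nu>)"
    using x0(2) nu Mpos by (intro mult_left_mono powr_mono2) auto
  ultimately show ?thesis by linarith
qed

lemma (in restart_choice) restarts_succeed:
  assumes prob: "sstm_problem n \<nu> M f G xs (3 * R0) P g \<sigma>" and conv: "strongly_convex n \<mu> f G"
    and x0: "x0 \<in> Rn n" "dist_Rn n x0 xs \<le> R0"
    and W: "prob_space W" and fresh: "fresh_samples W P \<tau> Ns ms \<xi>"
  shows "measure W {\<omega> \<in> space W.
    f (R_clipped_SSTM n \<nu> g x0 Ns ms as Bs (\<lambda>t k j. \<xi> t k j \<omega>) \<tau>) - f xs \<le> \<epsilon>} \<ge> 1 - \<beta>"
proof -
  interpret prob: sstm_problem n \<nu> M f G xs "3 * R0" P g \<sigma> by fact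
  interpret restarted: restarted_sstm n \<nu> M f G xs "3 * R0" P g \<sigma> x0 \<tau> Ns ms as Bs Rs es l
  proof (intro restarted_sstm.intro[OF prob] restarted_sstm_axioms.intro)
    show "x0 \<in> Rn n" by fact
    show "dist_Rn n x0 xs \<le> Rs 1"
      using x0(2) by (simp add: Rs_def)
    show "sstm_run n \<nu> M f G xs (3 * R0) P g \<sigma> (Rs t) (es t) l (as t) (Bs t) (Ns t) (ms t)"
      if "t \<in> {1..\<tau>}" for t
      using run_if_problem[OF prob that] .
    fix t y assume t: "t \<in> {1..<\<tau>}" and y: "y \<in> Rn n" and gap: "f y - f xs \<le> es t"
    have "f xs + inner_Rn n (G xs) (\<lambda>i. y i - xs i) + \<mu> / 2 * (dist_Rn n y xs)\<^sup>2 \<le> f y"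
      using conv y prob.xs by (auto simp: strongly_convex_def)
    moreover have "inner_Rn n (G xs) (\<lambda>i. y i - xs i) \<ge> 0"
      using abs_inner_Rn_le[of n "G xs" "\<lambda>i. y i - xs i"] prob.gradient_xs by simp
    moreover have "es t = \<mu> * (Rs t)\<^sup>2 / 4" using es_before[OF t] by (simp add: es_def)
    ultimately have "\<mu> / 2 * (dist_Rn n y xs)\<^sup>2 \<le> \<mu> / 2 * ((Rs t)\<^sup>2 / 2)" using gap by simp
    then have "(dist_Rn n y xs)\<^sup>2 \<le> (Rs t)\<^sup>2 / 2" using \<mu> by simp
    also have "\<dots> = (Rs (Suc t))\<^sup>2"
    proof -
      have "(2::real) ^ t = 2 * 2 ^ (t - 1)" using t power_eq_if[of "2::real" t] by auto
      then show ?thesis by (simp add: Rs_sq)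
    qed
    finally show "dist_Rn n y xs \<le> Rs (Suc t)"
      by (rule power2_le_imp_le) (use Rs_pos[of "Suc t"] in simp)
  qed
  have "1 - real \<tau> * exp (- l) \<le> measure W {\<omega> \<in> space W.
      f (R_clipped_SSTM n \<nu> g x0 Ns ms as Bs (\<lambda>t k j. \<xi> t k j \<omega>) \<tau>) - f xs \<le> es \<tau>}"
    by (rule restarted.restarted_success_probability[OF _ W fresh]) (simp add: \<tau>_def)
  then show ?thesis using failure_budget by (simp add: es_final)
qed

lemma geometric_const_pos: "0 \<le> \<nu> \<Longrightarrow> \<nu> \<le> 1 \<Longrightarrow> geometric_const \<nu> > 0"
proof (cases "\<nu> = 1")
  case False
  assume "0 \<le> \<nu>" "\<nu> \<le> 1"
  with False have "(1 - \<nu>) / (1 + 3 * \<nu>) > 0" by simp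
  then have "2 powr (- ((1 - \<nu>) / (1 + 3 * \<nu>))) < (1::real)" by (intro powr_less_one) auto
  then show ?thesis by (simp add: geometric_const_def)
qed (simp add: geometric_const_def)

lemma complexity_D_pos: "M > 0 \<Longrightarrow> \<mu> > 0 \<Longrightarrow> \<epsilon> > 0 \<Longrightarrow> complexity_D \<nu> M R0 \<mu> \<epsilon> > 0"
  by (simp add: complexity_D_def less_max_iff_disj)

text \<open>Outside the range covered by \<open>restart_choice\<close> no sample is needed: either no
  problem satisfies the hypotheses, or the starting point is already a solution.\<close>

lemma start_is_solution:
  assumes prob: "sstm_problem n \<nu> M f G xs (3 * R0) P g \<sigma>" and conv: "strongly_convex n \<mu> f G"
    and n: "n \<ge> 1" and R0: "R0 > 0" and \<mu>: "\<mu> > 0"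
    and x0: "x0 \<in> Rn n" "dist_Rn n x0 xs \<le> R0"
    and easy: "\<not> (\<mu> * R0 powr (1 - \<nu>) \<le> M \<and> \<epsilon> < M * R0 powr (1 + \<nu>))"
  shows "f x0 - f xs \<le> \<epsilon>"
proof -
  interpret prob: sstm_problem n \<nu> M f G xs "3 * R0" P g \<sigma> by fact
  have "\<mu> * R0 powr (1 - \<nu>) \<le> M"
    using prob.strong_convexity_constant_le[OF conv n R0] R0 by simp
  moreover have "f x0 - f xs \<le> M * R0 powr (1 + \<nu>)"
    using prob.start_gap_le[OF x0] R0 by simp
  ultimately show ?thesis using easy by linarith
qed

theorem theorem2p2:
  fixes \<nu> :: real
  assumes "0 \<le> \<nu>" and "\<nu> \<le> 1"
  shows "\<exists>C>0. \<forall>M R0 \<sigma> \<mu> \<epsilon> \<beta> :: real.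
    M > 0 \<longrightarrow> R0 > 0 \<longrightarrow> \<sigma> > 0 \<longrightarrow> \<mu> > 0 \<longrightarrow> \<epsilon> > 0 \<longrightarrow> 0 < \<beta> \<longrightarrow> \<beta> < 1 \<longrightarrow>
    (let D = complexity_D \<nu> M R0 \<mu> \<epsilon>;
         L = log_factor D \<beta>;
         p = 2 * (1 + \<nu>) / (1 + 3 * \<nu>)
     in \<exists>\<tau> Ns ms as Bs.
          admissible_parameters \<tau> Ns ms as Bs \<and>
          real (total_iterations \<tau> Ns) \<le> C * (D * L powr p) \<and>
          real (oracle_calls \<tau> Ns ms) \<le> C * max (D * L powr p) (\<sigma>\<^sup>2 / (\<mu> * \<epsilon>) * L) \<and>
          (\<forall>n f G xs x0 F g (P :: 'x measure) (W :: 'w measure) X.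
             n \<ge> 1 \<longrightarrow>
             minimizer n f xs \<longrightarrow>
             gradient_map n \<nu> f xs G \<longrightarrow>
             strongly_convex n \<mu> f G \<longrightarrow>
             x0 \<in> Rn n \<longrightarrow>
             dist_Rn n x0 xs \<le> R0 \<longrightarrow>
             prob_space P \<longrightarrow>
             stochastic_objective n P F f \<longrightarrow>
             stochastic_oracle n P g G (cball_Rn n xs (3 * R0)) \<sigma> \<longrightarrow>
             smoothness_conditions n \<nu> M f G xs (cball_Rn n xs (3 * R0)) \<longrightarrow>
             prob_space W \<longrightarrow>
             fresh_samples W P \<tau> Ns ms X \<longrightarrow>
             measure W {\<omega> \<in> space W.
               f (R_clipped_SSTM n \<nu> g x0 Ns ms as Bs (\<lambda>t k j. X t k j \<omega>) \<tau>) - f xs \<le> \<epsilon>}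
             \<ge> 1 - \<beta>))"
proof -
  define C1 where "C1 = 128 * (iteration_const \<nu> + 1) * geometric_const \<nu>"
  define C where "C = C1 + 39936"
  have "iteration_const \<nu> > 0" by (simp add: iteration_const_def)
  then have C1: "C1 > 0" using geometric_const_pos assms by (simp add: C1_def)
  show ?thesis
    unfolding Let_def
  proof (intro exI[of _ C] conjI allI impI)
    show "0 < C" using C1 by (simp add: C_def)
    fix M R0 \<sigma> \<mu> \<epsilon> \<beta> :: real
    assume pos: "M > 0" "R0 > 0" "\<sigma> > 0" "\<mu> > 0" "\<epsilon> > 0" "0 < \<beta>" "\<beta> < 1"
    let ?D = "complexity_D \<nu> M R0 \<mu> \<epsilon>"
    let ?L = "log_factor ?D \<beta>"
    let ?p = "2 * (1 + \<nu>) / (1 + 3 * \<nu>)"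
    let ?success = "\<lambda>\<tau> Ns ms as Bs. \<forall>n f G xs x0 F g (P :: 'x measure) (W :: 'w measure) X.
             n \<ge> 1 \<longrightarrow>
             minimizer n f xs \<longrightarrow>
             gradient_map n \<nu> f xs G \<longrightarrow>
             strongly_convex n \<mu> f G \<longrightarrow>
             x0 \<in> Rn n \<longrightarrow>
             dist_Rn n x0 xs \<le> R0 \<longrightarrow>
             prob_space P \<longrightarrow>
             stochastic_objective n P F f \<longrightarrow>
             stochastic_oracle n P g G (cball_Rn n xs (3 * R0)) \<sigma> \<longrightarrow>
             smoothness_conditions n \<nu> M f G xs (cball_Rn n xs (3 * R0)) \<longrightarrow>
             prob_space W \<longrightarrow>
             fresh_samples W P \<tau> Ns ms X \<longrightarrow>
             measure W {\<omega> \<in> space W.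
               f (R_clipped_SSTM n \<nu> g x0 Ns ms as Bs (\<lambda>t k j. X t k j \<omega>) \<tau>) - f xs \<le> \<epsilon>}
             \<ge> 1 - \<beta>"
    let ?complexity = "\<lambda>\<tau> Ns ms. real (total_iterations \<tau> Ns) \<le> C * (?D * ?L powr ?p) \<and>
          real (oracle_calls \<tau> Ns ms) \<le> C * max (?D * ?L powr ?p) (\<sigma>\<^sup>2 / (\<mu> * \<epsilon>) * ?L)"
    have D: "?D * ?L powr ?p \<ge> 0" using complexity_D_pos pos by (simp add: less_imp_le)
    have problem: "sstm_problem n \<nu> M f G xs (3 * R0) P g \<sigma>"
      if "minimizer n f xs" "gradient_map n \<nu> f xs G" "strongly_convex n \<mu> f G" "prob_space P"
        "stochastic_oracle n P g G (cball_Rn n xs (3 * R0)) \<sigma>"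
        "smoothness_conditions n \<nu> M f G xs (cball_Rn n xs (3 * R0))"
      for n f G xs g and P :: "'x measure"
      using problem_if_smooth_strongly_convex[OF assms pos(1,4) _ that] pos by simp
    have "\<exists>\<tau> Ns ms as Bs. admissible_parameters \<tau> Ns ms as Bs \<and> ?complexity \<tau> Ns ms \<and> ?success \<tau> Ns ms as Bs"
    proof (cases "\<mu> * R0 powr (1 - \<nu>) \<le> M \<and> \<epsilon> < M * R0 powr (1 + \<nu>)")
      case True
      interpret choice: restart_choice \<nu> M R0 \<sigma> \<mu> \<epsilon> \<beta>
        using True assms pos by unfold_locales auto
      have "admissible_parameters choice.\<tau> choice.Ns choice.ms choice.as choice.Bs"
        unfolding admissible_parameters_def
      proof (intro ballI conjI allI impI)
        fix t assume t: "t \<in> {1..choice.\<tau>}"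
        interpret sched: sstm_schedule \<nu> M "choice.Rs t" "choice.es t" choice.l
          "choice.as t" "choice.Bs t" "choice.Ns t"
          using choice.schedule[OF t] .
        show "1 \<le> choice.Ns t" "0 < choice.as t" "0 < choice.Bs t"
          by (fact sched.N1 sched.a_pos sched.B_pos)+
        show "1 \<le> choice.ms t k" for k using choice.batch_pos[OF t] .
      qed
      moreover have "?complexity choice.\<tau> choice.Ns choice.ms"
      proof
        show "real (total_iterations choice.\<tau> choice.Ns) \<le> C * (?D * ?L powr ?p)"
        proof -
          have "C1 * (?D * ?L powr ?p) \<le> C * (?D * ?L powr ?p)"
            using D by (intro mult_right_mono) (auto simp: C_def)
          then show ?thesis
            using choice.total_iterations_le
            unfolding C1_def choice.D_def choice.L_def choice.p_def by linarith
        qed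
        show "real (oracle_calls choice.\<tau> choice.Ns choice.ms)
            \<le> C * max (?D * ?L powr ?p) (\<sigma>\<^sup>2 / (\<mu> * \<epsilon>) * ?L)"
        proof -
          let ?m = "max (?D * ?L powr ?p) (\<sigma>\<^sup>2 / (\<mu> * \<epsilon>) * ?L)"
          have "C1 * (?D * ?L powr ?p) \<le> C1 * ?m" using C1 by (intro mult_left_mono) auto
          moreover have "39936 * (\<sigma>\<^sup>2 / (\<mu> * \<epsilon>) * ?L) \<le> 39936 * ?m" by (intro mult_left_mono) auto
          moreover have "C * ?m = C1 * ?m + 39936 * ?m" by (simp only: C_def distrib_right)
          ultimately show ?thesis
            using choice.oracle_calls_le
            unfolding C1_def choice.D_def choice.L_def choice.p_def by linarith
        qed
      qed
      moreover have "?success choice.\<tau> choice.Ns choice.ms choice.as choice.Bs"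
        using choice.restarts_succeed problem by blast
      ultimately show ?thesis by blast
    next
      case False
      have "?success 0 (\<lambda>_. 1) (\<lambda>_ _. 1) (\<lambda>_. 1) (\<lambda>_. 1)"
      proof (intro allI impI)
        fix n f G xs x0 F g and P :: "'x measure" and W :: "'w measure" and X
        assume hyps: "minimizer n f xs" "gradient_map n \<nu> f xs G" "strongly_convex n \<mu> f G" "prob_space P"
            "stochastic_oracle n P g G (cball_Rn n xs (3 * R0)) \<sigma>"
            "smoothness_conditions n \<nu> M f G xs (cball_Rn n xs (3 * R0))"
          and n: "n \<ge> 1" and x0: "x0 \<in> Rn n" "dist_Rn n x0 xs \<le> R0" and W: "prob_space W"
        interpret W: prob_space W by fact
        have "f x0 - f xs \<le> \<epsilon>"
          using start_is_solution[OF problem[OF hyps] hyps(3) n pos(2,4) x0 False] .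
        then show "1 - \<beta> \<le> measure W {\<omega> \<in> space W.
            f (R_clipped_SSTM n \<nu> g x0 (\<lambda>_. 1) (\<lambda>_ _. 1) (\<lambda>_. 1) (\<lambda>_. 1) (\<lambda>t k j. X t k j \<omega>) 0) - f xs \<le> \<epsilon>}"
          using pos(6) by (simp add: W.prob_space)
      qed
      moreover have "admissible_parameters 0 (\<lambda>_. 1) (\<lambda>_ _. 1) (\<lambda>_. 1) (\<lambda>_. 1)"
        by (simp add: admissible_parameters_def)
      moreover have "?complexity 0 (\<lambda>_. 1) (\<lambda>_ _. 1)"
        using D C1 by (simp add: total_iterations_def oracle_calls_def C_def max.coboundedI1)
      ultimately show ?thesis by blast
    qed
    then show "\<exists>\<tau> Ns ms as Bs.
          admissible_parameters \<tau> Ns ms as Bs \<and>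
          real (total_iterations \<tau> Ns) \<le> C * (?D * ?L powr ?p) \<and>
          real (oracle_calls \<tau> Ns ms) \<le> C * max (?D * ?L powr ?p) (\<sigma>\<^sup>2 / (\<mu> * \<epsilon>) * ?L) \<and>
          ?success \<tau> Ns ms as Bs"
      by (simp only: conj_assoc)
  qed
qed

end
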